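(* Let $k\ge 2$ be an integer and let $X$ be a random variable with values in $[0,1)$ having a bounded density and such that, for some $\alpha\in(0,\infty)$, $\mathbb{P}\{X\le t\}=t^{\alpha+o(1)}$ as $t\to0$. Let $\beta=\max\left(1-\frac{1}{k\alpha},0\right)$ and $\lambda_k=\sup\{z\ge 1/\mathbb{E}[-\log X]:\ \Lambda^\star(1/z)\le\log k\}$. Then the longest-path distances $D_x$ to the root in a random recursive $(X,k)$-DAG satisfy, as $n\to\infty$, $$\frac{\min_{n/2\le x\le n}D_x}{\log n}\to\beta\lambda_k\quad\text{in probability}.$$
   Context: $\log$ is the natural logarithm. Random recursive $(X,k)$-DAG (also called $k$-SARRD with attachment $X$): let $X_{x,p}$, $x\ge 0$, $1\le p\le k$, be independent copies of $X$. The nodes are $0,1,2,\dots$; node $0$ is the root (it has no parents), and every node $x\ge 1$ has $k$ parents (not necessarily distinct) $\lfloor xX_{x,1}\rfloor,\dots,\lfloor xX_{x,k}\rfloor$, with a directed edge from $x$ to each parent. $D_x$ is the number of edges on the longest directed path from $x$ to $0$ (so $D_0=0$ and $D_x=1+\max_{1\le p\le k}D_{\lfloor xX_{x,p}\rfloor}$ for $x\ge1$). Put $Y=-\log X$, $\Lambda(\lambda)=\log\mathbb{E}[e^{\lambda Y}]\in(-\infty,+\infty]$ for $\lambda\in\mathbb{R}$, and $\Lambda^\star(z)=\sup_{\lambda\in\mathbb{R}}\{\lambda z-\Lambda(\lambda)\}$. *)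

theory Defs
  imports "HOL-Probability.Probability" "Graph_Theory.Graph_Theory"
begin

text \<open>
  The recursive DAG determined by a realisation \<open>u\<close> of the variables \<open>X\<^sub>x\<^sub>,\<^sub>p\<close>. The arc \<open>(x, p)\<close> is
  the \<open>p\<close>-th parent edge of \<open>x\<close>; repeated parents give parallel arcs.
\<close>
definition recursive_dag :: "nat \<Rightarrow> (nat \<Rightarrow> nat \<Rightarrow> real) \<Rightarrow> (nat, nat \<times> nat) pre_digraph" where
  "recursive_dag k u =
     \<lparr>verts = UNIV, arcs = {1..} \<times> {1..k}, tail = fst,
      head = (\<lambda>(x, p). nat \<lfloor>real x * u x p\<rfloor>)\<rparr>"

definition longest_path_dist :: "nat \<Rightarrow> (nat \<Rightarrow> nat \<Rightarrow> real) \<Rightarrow> nat \<Rightarrow> nat" where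
  "longest_path_dist k u x =
     Max {length es |es. pre_digraph.apath (recursive_dag k u) x es 0}"

text \<open>
  The natural logarithm of an expectation taking values in \<open>(0, \<infinity>]\<close>.
\<close>
definition log_expectation :: "ennreal \<Rightarrow> ereal" where
  "log_expectation e = (if e = \<infinity> then \<infinity> else ereal (ln (enn2real e)))"

definition log_mgf :: "'a measure \<Rightarrow> ('a \<Rightarrow> real) \<Rightarrow> real \<Rightarrow> ereal" where
  "log_mgf N Y l = log_expectation (\<integral>\<^sup>+ \<omega>. ennreal (exp (l * Y \<omega>)) \<partial>N)"

definition log_mgf_conjugate :: "'a measure \<Rightarrow> ('a \<Rightarrow> real) \<Rightarrow> real \<Rightarrow> ereal" where
  "log_mgf_conjugate N Y z = (SUP l::real. ereal (l * z) - log_mgf N Y l)"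

text \<open>
  Here \<open>Y = - ln X\<close>. The convention \<open>ln 0 = 0\<close> is harmless when \<open>X\<close> has a density, since then
  \<open>X \<noteq> 0\<close> almost surely.
\<close>
definition lambda_const :: "'a measure \<Rightarrow> ('a \<Rightarrow> real) \<Rightarrow> nat \<Rightarrow> real" where
  "lambda_const N X k =
     (let Y = (\<lambda>\<omega>. - ln (X \<omega>))
      in Sup {z::real. z \<ge> 1 / (\<integral>\<omega>. Y \<omega> \<partial>N)
                     \<and> log_mgf_conjugate N Y (1 / z) \<le> ereal (ln (real k))})"

definition tendsto_in_probability ::
    "'a measure \<Rightarrow> (nat \<Rightarrow> 'a \<Rightarrow> real) \<Rightarrow> real \<Rightarrow> bool" where
  "tendsto_in_probability M Z c \<longleftrightarrow>
     (\<forall>\<epsilon>>0. (\<lambda>n. measure M {\<omega> \<in> space M. \<bar>Z n \<omega> - c\<bar> > \<epsilon>}) \<longlonglongrightarrow> 0)"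

text \<open>
  The distances satisfy the recursion \<open>D\<^sub>0 = 0\<close>, \<open>D\<^sub>x = 1 + max\<^sub>p D\<^bsub>parent p of x\<^esub>\<close>.
\<close>

lemma recursive_dag_simps [simp]:
  "verts (recursive_dag k u) = UNIV"
  "arcs (recursive_dag k u) = {1..} \<times> {1..k}"
  "tail (recursive_dag k u) = fst"
  "head (recursive_dag k u) (x, p) = nat \<lfloor>real x * u x p\<rfloor>"
  by (simp_all add: recursive_dag_def)

lemma wf_digraph_recursive_dag: "wf_digraph (recursive_dag k u)"
  by unfold_locales auto

lemma parent_less:
  assumes "0 \<le> t" "t < (1::real)" "x \<ge> 1"
  shows "nat \<lfloor>real x * t\<rfloor> < x"
proof -
  have "real x * t < real x" using assms by simp
  then have "\<lfloor>real x * t\<rfloor> < int x" by (simp add: floor_less_iff)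
  then show ?thesis using assms by linarith
qed

lemma recursive_dag_awalk_verts_le:
  assumes "\<And>x p. p \<in> {1..k} \<Longrightarrow> u x p \<in> {0..<1}"
    and "pre_digraph.awalk (recursive_dag k u) x es y"
  shows "set (pre_digraph.awalk_verts (recursive_dag k u) x es) \<subseteq> {..x}"
  using assms(2)
proof (induction es arbitrary: x)
  case Nil
  then show ?case by (simp add: pre_digraph.awalk_verts.simps)
next
  case (Cons e es)
  interpret wf_digraph "recursive_dag k u" by (rule wf_digraph_recursive_dag)
  obtain p where e: "e = (x, p)" "x \<ge> 1" "p \<in> {1..k}"
    and w: "awalk (nat \<lfloor>real x * u x p\<rfloor>) es y"
    using Cons.prems by (cases e) (auto simp: awalk_Cons_iff)
  have "nat \<lfloor>real x * u x p\<rfloor> < x" using assms(1)[OF e(3), of x] e(2) by (intro parent_less) auto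
  then show ?case using Cons.IH[OF w] e by auto
qed

lemma recursive_dag_apath_iff:
  assumes "\<And>x p. p \<in> {1..k} \<Longrightarrow> u x p \<in> {0..<1}"
  shows "pre_digraph.apath (recursive_dag k u) x es y \<longleftrightarrow>
           (if es = [] then x = y
            else \<exists>p\<in>{1..k}. x \<ge> 1 \<and> hd es = (x, p) \<and>
                   pre_digraph.apath (recursive_dag k u) (nat \<lfloor>real x * u x p\<rfloor>) (tl es) y)"
proof (cases es)
  case Nil
  interpret wf_digraph "recursive_dag k u" by (rule wf_digraph_recursive_dag)
  show ?thesis using Nil by (simp add: apath_Nil_iff)
next
  case (Cons e fs)
  interpret wf_digraph "recursive_dag k u" by (rule wf_digraph_recursive_dag)
  have "x \<notin> set (awalk_verts (nat \<lfloor>real x * u x p\<rfloor>) fs)"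
    if "p \<in> {1..k}" "x \<ge> 1" "apath (nat \<lfloor>real x * u x p\<rfloor>) fs y" for p
  proof -
    have "nat \<lfloor>real x * u x p\<rfloor> < x" using assms[OF that(1), of x] that(2) by (intro parent_less) auto
    moreover have "set (awalk_verts (nat \<lfloor>real x * u x p\<rfloor>) fs) \<subseteq> {..nat \<lfloor>real x * u x p\<rfloor>}"
      using that(3) assms by (intro recursive_dag_awalk_verts_le[of k u _ _ y]) (auto simp: apath_def)
    ultimately show ?thesis by auto
  qed
  then show ?thesis using Cons
    by (cases e) (auto simp: apath_Cons_iff)
qed

abbreviation root_path_lengths :: "nat \<Rightarrow> (nat \<Rightarrow> nat \<Rightarrow> real) \<Rightarrow> nat \<Rightarrow> nat set" where
  "root_path_lengths k u x \<equiv> {length es |es. pre_digraph.apath (recursive_dag k u) x es 0}"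

lemma root_path_lengths_0:
  assumes "\<And>x p. p \<in> {1..k} \<Longrightarrow> u x p \<in> {0..<1}"
  shows "root_path_lengths k u 0 = {0}"
proof -
  have "pre_digraph.apath (recursive_dag k u) 0 es 0 \<longleftrightarrow> es = []" for es
    using recursive_dag_apath_iff[of k u 0 es 0] assms by auto
  then show ?thesis by simp
qed

lemma root_path_lengths_pos:
  assumes "\<And>x p. p \<in> {1..k} \<Longrightarrow> u x p \<in> {0..<1}" and "x \<ge> 1"
  shows "root_path_lengths k u x =
           (\<Union>p\<in>{1..k}. Suc ` root_path_lengths k u (nat \<lfloor>real x * u x p\<rfloor>))"
    (is "?L = ?R")
proof (intro equalityI subsetI)
  fix n assume "n \<in> ?L"
  then obtain es where es: "n = length es" "pre_digraph.apath (recursive_dag k u) x es 0"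
    by auto
  then have "es \<noteq> []" using assms(2) recursive_dag_apath_iff[of k u x es 0] assms(1) by auto
  then obtain p where "p \<in> {1..k}"
    "pre_digraph.apath (recursive_dag k u) (nat \<lfloor>real x * u x p\<rfloor>) (tl es) 0"
    using recursive_dag_apath_iff[of k u x es 0] assms(1) es(2) by auto
  moreover have "n = Suc (length (tl es))" using es(1) \<open>es \<noteq> []\<close> by (cases es) auto
  ultimately show "n \<in> ?R" by blast
next
  fix n assume "n \<in> ?R"
  then obtain p es where "p \<in> {1..k}" "n = Suc (length es)"
    "pre_digraph.apath (recursive_dag k u) (nat \<lfloor>real x * u x p\<rfloor>) es 0" by auto
  moreover from this have "pre_digraph.apath (recursive_dag k u) x ((x, p) # es) 0"
    using recursive_dag_apath_iff[of k u x "(x, p) # es" 0] assms by auto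
  ultimately show "n \<in> ?L" by (intro CollectI exI[of _ "(x, p) # es"]) auto
qed

lemma root_path_lengths_finite_nonempty:
  assumes "\<And>x p. p \<in> {1..k} \<Longrightarrow> u x p \<in> {0..<1}" and "k \<ge> 1"
  shows "finite (root_path_lengths k u x) \<and> root_path_lengths k u x \<noteq> {}"
proof (induction x rule: less_induct)
  case (less x)
  show ?case
  proof (cases "x = 0")
    case True
    then show ?thesis using root_path_lengths_0[of k u] assms by simp
  next
    case False
    then have x: "x \<ge> 1" by simp
    have "nat \<lfloor>real x * u x p\<rfloor> < x" if "p \<in> {1..k}" for p
      using assms(1)[OF that, of x] x by (intro parent_less) auto
    then have IH: "finite (root_path_lengths k u (nat \<lfloor>real x * u x p\<rfloor>))"
       "root_path_lengths k u (nat \<lfloor>real x * u x p\<rfloor>) \<noteq> {}" if "p \<in> {1..k}" for p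
      using less.IH that by blast+
    have eq: "root_path_lengths k u x =
           (\<Union>p\<in>{1..k}. Suc ` root_path_lengths k u (nat \<lfloor>real x * u x p\<rfloor>))"
      using assms(1) x by (rule root_path_lengths_pos)
    have fin: "finite (root_path_lengths k u x)"
      unfolding eq using IH(1) by (intro finite_UN_I finite_imageI) auto
    have "1 \<in> {1..k}" using assms(2) by simp
    then have "root_path_lengths k u x \<noteq> {}"
      unfolding eq using IH(2)[of 1] by blast
    with fin show ?thesis by blast
  qed
qed

lemma longest_path_dist_0:
  assumes "\<And>x p. p \<in> {1..k} \<Longrightarrow> u x p \<in> {0..<1}"
  shows "longest_path_dist k u 0 = 0"
  using root_path_lengths_0[of k u] assms by (simp add: longest_path_dist_def)

lemma longest_path_dist_pos:
  assumes u: "\<And>x p. p \<in> {1..k} \<Longrightarrow> u x p \<in> {0..<1}" and k: "k \<ge> 1" and x: "x \<ge> 1"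
  shows "longest_path_dist k u x =
           1 + (MAX p\<in>{1..k}. longest_path_dist k u (nat \<lfloor>real x * u x p\<rfloor>))"
proof -
  define y where "y p = nat \<lfloor>real x * u x p\<rfloor>" for p
  let ?S = "root_path_lengths k u"
  note fin = root_path_lengths_finite_nonempty[of k u, OF u k]
  have eq: "?S x = (\<Union>p\<in>{1..k}. Suc ` ?S (y p))"
    unfolding y_def by (rule root_path_lengths_pos) (use u x in auto)
  have in_S: "longest_path_dist k u z \<in> ?S z" for z
    unfolding longest_path_dist_def using fin[of z] by (intro Max_in) auto
  have le_D: "n \<le> longest_path_dist k u z" if "n \<in> ?S z" for n z
    unfolding longest_path_dist_def using fin[of z] that by (intro Max_ge) auto
  let ?m = "MAX p\<in>{1..k}. longest_path_dist k u (y p)"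
  have "?m \<in> (\<lambda>p. longest_path_dist k u (y p)) ` {1..k}"
    using k by (intro Max_in) auto
  then obtain p where p: "p \<in> {1..k}" "?m = longest_path_dist k u (y p)" by blast
  have "Suc ?m \<in> ?S x" unfolding eq p(2) using p(1) in_S[of "y p"] by blast
  then have ge: "Suc ?m \<le> longest_path_dist k u x" by (rule le_D)
  obtain q n where q: "q \<in> {1..k}" "longest_path_dist k u x = Suc n" "n \<in> ?S (y q)"
    using in_S[of x] unfolding eq by blast
  have "n \<le> longest_path_dist k u (y q)" using q(3) by (rule le_D)
  also have "\<dots> \<le> ?m" using q(1) by (intro Max_ge) auto
  finally have "longest_path_dist k u x = 1 + ?m" using ge q(2) by simp
  then show ?thesis unfolding y_def .
qed

end

theory Submission
  imports Defs "HOL-Real_Asymp.Real_Asymp"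
begin

text \<open>
  Write \<open>\<mu>\<^sub>x\<close> for the law of a parent of \<open>x\<close>. All \<open>k\<close> parents of some \<open>x\<close> between \<open>n / 2\<close> and \<open>n\<close> are
  below \<open>n\<^sup>\<gamma>\<close> with high probability if and only if \<open>k \<alpha> (1 - \<gamma>) < 1\<close>, that is, \<open>\<gamma> > \<beta>\<close>. Such a node
  has typical parents, whose distance is at most \<open>(\<lambda>\<^sub>k + \<epsilon>) \<gamma> log n\<close> by a first moment bound on the
  number of long paths; this is the upper bound.

  For the lower bound let \<open>W\<^sub>h(x) = \<mu>\<^sub>x {y. D\<^sub>y < h}\<close>. Given the graph below \<open>x\<close>, the event \<open>D\<^sub>x < h + 1\<close>
  has probability \<open>W\<^sub>h(x)\<^sup>k\<close>, and since the atoms of \<open>\<mu>\<^sub>x\<close> are \<open>O(1 / x)\<close>, an exponential supermartingale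
  shows that, simultaneously for all \<open>x \<le> n\<close>,
  \<open>W\<^bsub>h+1\<^esub>(x) \<le> (1 + \<eta>) \<Sum>\<^sub>y \<mu>\<^sub>x(y) W\<^sub>h(y)\<^sup>k + O(log n / x)\<close>. This deterministic recursion is exploited three
  times. A travelling bump, built from the critical exponential tilt, keeps \<open>W\<^sub>h(x)\<close> away from \<open>1\<close> as
  long as \<open>h < z log x\<close> with \<open>z < \<lambda>\<^sub>k\<close>. A contraction argument then makes it small. Finally, once it is
  small, the only obstruction left is a parent below \<open>m\<close>, so that \<open>W\<^sub>h(x) \<le> (m / x)\<^bsup>\<alpha> - o(1)\<^esup>\<close>; for
  \<open>m = n\<^sup>\<gamma>\<close> with \<open>\<gamma> < \<beta>\<close> its \<open>k\<close>-th power is summable over the \<open>n\<close> nodes in question.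
\<close>

section \<open>The Markov chain of distances\<close>

text \<open>The distances of the possible parents of a node are strongly dependent. The upper bound
  avoids this by using marginal laws only. The lower bound spends its randomness on one inequality
  per pair (h, x); what remains is deterministic, and its error O(log n / x) is harmless only above
  a power of n, hence the slack \<tau> log n.

  The tilt comes from linearising: for small v = 1 - W, (1 - v)^k is about 1 - k v, so 1 - W evolves
  like the mean of a branching random walk with steps Y. Seen along log x - h / z it persists if k E
  exp(\<theta> (1 / z - Y)) > 1 at its minimum over \<theta>, the dual form of \<Lambda>*(1 / z) <
  log k. At the minimum the tilted step is centred, so a bump of width R loses only O(1 / R^2).

  Three stages are needed because the bump only yields W at most some \<rho> < 1. Contraction at
  rate \<rho> tolerates only a tiny power (m / x)^c, since parents above m multiply such a power by
  up to 2^c E[exp(c Y)]. That already makes W smaller than any constant, and then every c < \<alpha>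
  is admissible.\<close>

definition parent_arcs :: "nat \<Rightarrow> nat \<Rightarrow> (nat \<times> nat) set" where
  "parent_arcs k x = {x} \<times> {1..k}"

abbreviation parents_pmf :: "nat \<Rightarrow> (nat \<Rightarrow> nat pmf) \<Rightarrow> nat \<Rightarrow> (nat \<times> nat \<Rightarrow> nat) pmf" where
  "parents_pmf k \<mu> x \<equiv> Pi_pmf (parent_arcs k x) 0 (\<lambda>(x, p). \<mu> x)"

abbreviation new_depth :: "nat \<Rightarrow> (nat \<Rightarrow> nat) \<Rightarrow> nat \<Rightarrow> (nat \<times> nat \<Rightarrow> nat) \<Rightarrow> nat" where
  "new_depth k d x z \<equiv> Suc (Max (d ` z ` parent_arcs k x))"

text \<open>
  The joint law of \<open>D\<^sub>0, \<dots>, D\<^sub>n\<close>, as a Markov chain that adds one node per step; the entries above \<open>n\<close> are \<open>0\<close>.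
\<close>
primrec dag_pmf :: "nat \<Rightarrow> (nat \<Rightarrow> nat pmf) \<Rightarrow> nat \<Rightarrow> (nat \<Rightarrow> nat) pmf" where
  "dag_pmf k \<mu> 0 = return_pmf (\<lambda>_. 0)"
| "dag_pmf k \<mu> (Suc n) = bind_pmf (dag_pmf k \<mu> n) (\<lambda>d.
     map_pmf (\<lambda>z. d(Suc n := new_depth k d (Suc n) z))
       (parents_pmf k \<mu> (Suc n)))"

lemma finite_parent_arcs [simp, intro]: "finite (parent_arcs k x)"
  by (simp add: parent_arcs_def)

lemma parent_arcs_nonempty [simp]: "k \<ge> 1 \<Longrightarrow> parent_arcs k x \<noteq> {}"
  by (auto simp: parent_arcs_def)

lemma nn_integral_dag_pmf_Suc:
  "(\<integral>\<^sup>+ d. f d \<partial>dag_pmf k \<mu> (Suc n)) =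
    (\<integral>\<^sup>+ d. (\<integral>\<^sup>+ z. f (d(Suc n := new_depth k d (Suc n) z))
       \<partial>parents_pmf k \<mu> (Suc n)) \<partial>dag_pmf k \<mu> n)"
  by (simp add: nn_integral_bind_pmf)

text \<open>Steps after \<open>m\<close> overwrite only coordinates above \<open>m\<close>, so they
  cannot change such an \<open>f\<close>.\<close>

lemma nn_integral_dag_pmf_eq:
  assumes "m \<le> n" and dep: "\<And>d d'. (\<And>y. y \<le> m \<Longrightarrow> d y = d' y) \<Longrightarrow> f d = f d'"
  shows "(\<integral>\<^sup>+ d. f d \<partial>dag_pmf k \<mu> n) = (\<integral>\<^sup>+ d. f d \<partial>dag_pmf k \<mu> m)"
  using assms(1)
proof (induction n rule: dec_induct)
  case (step n)
  have "f (d(Suc n := v)) = f d" for d v using step.hyps by (intro dep) auto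
  then show ?case unfolding nn_integral_dag_pmf_Suc using step.IH by simp
qed simp


lemma measure_parents_in:
  fixes \<mu> :: "nat \<Rightarrow> nat pmf"
  shows "measure (parents_pmf k \<mu> x) {z. \<forall>e\<in>parent_arcs k x. z e \<in> A}
         = measure (\<mu> x) A ^ k"
proof -
  have eq: "{z. \<forall>e\<in>parent_arcs k x. z e \<in> A} = Pi (parent_arcs k x) (\<lambda>_. A)" by auto
  have "(\<Prod>e\<in>parent_arcs k x. measure (case e of (x, p) \<Rightarrow> \<mu> x) A) = (\<Prod>e\<in>parent_arcs k x. measure (\<mu> x) A)"
    by (intro prod.cong) (auto simp: parent_arcs_def)
  also have "\<dots> = measure (\<mu> x) A ^ k"
    by (simp add: parent_arcs_def card_cartesian_product)
  finally show ?thesis unfolding eq by (subst measure_Pi_pmf_Pi) auto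
qed

lemma measure_depth_less:
  fixes \<mu> :: "nat \<Rightarrow> nat pmf"
  assumes "k \<ge> 1"
  shows "measure (parents_pmf k \<mu> x) {z. new_depth k d x z < Suc h}
         = measure (\<mu> x) {y. d y < h} ^ k"
proof -
  have "{z. new_depth k d x z < Suc h} = {z. \<forall>e\<in>parent_arcs k x. z e \<in> {y. d y < h}}"
    using assms by (auto simp: Max_less_iff)
  then show ?thesis by (simp only: measure_parents_in)
qed

lemma measure_supported_cong:
  fixes p :: "'c pmf"
  assumes "set_pmf p \<subseteq> A" "\<And>y. y \<in> A \<Longrightarrow> P y \<longleftrightarrow> Q y"
  shows "measure p {y. P y} = measure p {y. Q y}"
  using assms by (intro measure_pmf.finite_measure_eq_AE) (auto simp: AE_measure_pmf_iff)

lemma ennreal_measure_pmf_eq: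
  "ennreal (measure (measure_pmf p) A) = (\<integral>\<^sup>+ x. indicator A x \<partial>p)"
  by (simp add: measure_pmf.emeasure_eq_measure)

lemma nn_integral_pmf_exp_of_bool:
  fixes p :: "'c pmf"
  assumes "c \<ge> 0"
  shows "(\<integral>\<^sup>+ x. ennreal (exp (c * of_bool (P x))) \<partial>p) = ennreal (1 + (exp c - 1) * measure p {x. P x})"
proof -
  have "ennreal (exp c) = ennreal (1 + (exp c - 1))" by simp
  also have "\<dots> = 1 + ennreal (exp c - 1)" using assms by (subst ennreal_plus) auto
  finally have *: "ennreal (exp c) = 1 + ennreal (exp c - 1)" .
  have "(\<integral>\<^sup>+ x. ennreal (exp (c * of_bool (P x))) \<partial>p) =
        (\<integral>\<^sup>+ x. 1 + ennreal (exp c - 1) * indicator {x. P x} x \<partial>p)"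
    by (intro nn_integral_cong) (auto simp: indicator_def *)
  also have "\<dots> = 1 + ennreal (exp c - 1) * emeasure p {x. P x}"
    by (subst nn_integral_add) (auto simp: nn_integral_cmult measure_pmf.emeasure_space_1[simplified])
  also have "\<dots> = ennreal (1 + (exp c - 1) * measure p {x. P x})"
    using assms by (subst ennreal_plus) (simp_all add: measure_pmf.emeasure_eq_measure ennreal_mult')
  finally show ?thesis .
qed

text \<open>
  The summands below have conditional exponential moment at most \<open>1\<close> given the graph so far, because
  \<open>d y < Suc h\<close> then has probability \<open>measure (\<mu> y) {z. d z < h} ^ k\<close> and \<open>1 + t \<le> exp t\<close>.
\<close>
lemma nn_integral_exp_depth_count_le_1:
  assumes k: "k \<ge> 1" and supp: "\<And>y. y \<ge> 1 \<Longrightarrow> set_pmf (\<mu> y) \<subseteq> {..<y}" and \<theta>: "\<And>y. \<theta> y \<ge> 0"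
  shows "(\<integral>\<^sup>+ d. ennreal (exp (\<Sum>y\<in>{1..j}. \<theta> y * of_bool (d y < Suc h)
            - (exp (\<theta> y) - 1) * measure (\<mu> y) {z. d z < h} ^ k)) \<partial>dag_pmf k \<mu> j) \<le> 1"
proof (induction j)
  case (Suc j)
  define S where "S i d = (\<Sum>y\<in>{1..i}. \<theta> y * of_bool (d y < Suc h)
            - (exp (\<theta> y) - 1) * measure (\<mu> y) {z. d z < h} ^ k)" for i and d :: "nat \<Rightarrow> nat"
  \<comment> \<open>Parents of \<open>y\<close> lie strictly below \<open>y\<close>, so writing the
    value at \<open>Suc j\<close> changes neither the earlier terms nor the compensator of the new
    one.\<close>
  have W: "measure (\<mu> y) {z. (d(Suc j := v)) z < h} = measure (\<mu> y) {z. d z < h}"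
    if "1 \<le> y" "y \<le> Suc j" for y d v
    by (rule measure_supported_cong[OF supp[OF that(1)]]) (use that in auto)
  have S: "S (Suc j) (d(Suc j := v)) = S j d + (\<theta> (Suc j) * of_bool (v < Suc h)
            - (exp (\<theta> (Suc j)) - 1) * measure (\<mu> (Suc j)) {z. d z < h} ^ k)" for d v
  proof -
    have "S j (d(Suc j := v)) = S j d" unfolding S_def
      by (intro sum.cong refl arg_cong2[where f="(-)"]) (use W in auto)
    moreover have "S (Suc j) (d(Suc j := v)) = S j (d(Suc j := v)) + (\<theta> (Suc j) * of_bool (v < Suc h)
            - (exp (\<theta> (Suc j)) - 1) * measure (\<mu> (Suc j)) {z. (d(Suc j := v)) z < h} ^ k)"
      unfolding S_def by simp
    ultimately show ?thesis using W by simp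
  qed
  have step: "(\<integral>\<^sup>+ z. ennreal (exp (S (Suc j) (d(Suc j := new_depth k d (Suc j) z))))
       \<partial>parents_pmf k \<mu> (Suc j)) \<le> ennreal (exp (S j d))" (is "?I \<le> _") for d
  proof -
    define w where "w = measure (\<mu> (Suc j)) {z. d z < h} ^ k"
    define c where "c = exp (\<theta> (Suc j)) - 1"
    have c: "c \<ge> 0" unfolding c_def using \<theta>[of "Suc j"] by simp
    have w: "w \<ge> 0" unfolding w_def by simp
    have "?I = (\<integral>\<^sup>+ z. ennreal (exp (S j d - c * w)) * ennreal (exp (\<theta> (Suc j) *
             of_bool (new_depth k d (Suc j) z < Suc h)))
       \<partial>parents_pmf k \<mu> (Suc j))"
      unfolding S
      by (intro nn_integral_cong, subst ennreal_mult'[symmetric], simp, subst exp_add[symmetric])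
        (simp only: c_def w_def diff_add_eq add_diff_eq)
    also have "\<dots> = ennreal (exp (S j d - c * w)) * ennreal (1 + c * w)"
      unfolding c_def w_def measure_depth_less[OF k, symmetric]
      by (subst nn_integral_cmult, simp, subst nn_integral_pmf_exp_of_bool[OF \<theta>], rule refl)
    also have "\<dots> = ennreal (exp (S j d - c * w) * (1 + c * w))"
      by (simp add: ennreal_mult')
    also have "exp (S j d - c * w) * (1 + c * w) \<le> exp (S j d - c * w) * exp (c * w)"
      by (intro mult_left_mono exp_ge_add_one_self) auto
    also have "\<dots> = exp (S j d)" by (simp flip: exp_add)
    finally show ?thesis by (simp only: ennreal_leI)
  qed
  have "(\<integral>\<^sup>+ d. ennreal (exp (S (Suc j) d)) \<partial>dag_pmf k \<mu> (Suc j)) \<le> (\<integral>\<^sup>+ d. ennreal (exp (S j d)) \<partial>dag_pmf k \<mu> j)"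
    unfolding nn_integral_dag_pmf_Suc by (intro nn_integral_mono step)
  also have "\<dots> \<le> 1" using Suc.IH unfolding S_def .
  finally show ?case unfolding S_def .
qed simp

lemma measure_pmf_eq_sum:
  fixes p :: "nat pmf"
  assumes "set_pmf p \<subseteq> A" "finite A"
  shows "measure p {y. P y} = (\<Sum>y\<in>A. pmf p y * of_bool (P y))"
proof -
  have "measure p {y. P y} = measure p ({y. P y} \<inter> A)"
    using assms by (intro measure_pmf.finite_measure_eq_AE) (auto simp: AE_measure_pmf_iff)
  also have "\<dots> = (\<Sum>y\<in>{y. P y} \<inter> A. pmf p y)" using assms by (subst measure_measure_pmf_finite) auto
  also have "\<dots> = (\<Sum>y\<in>A. pmf p y * of_bool (P y))"
    using assms by (intro sum.mono_neutral_cong_left) auto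
  finally show ?thesis .
qed

lemma exp_minus_one_le:
  fixes t :: real
  assumes "0 \<le> t" "t \<le> \<eta>" "\<eta> \<le> 1"
  shows "exp t - 1 \<le> (1 + \<eta>) * t"
proof -
  have "exp t \<le> 1 + t + t\<^sup>2" using assms by (intro exp_bound) auto
  also have "t\<^sup>2 \<le> \<eta> * t" using assms by (simp add: power2_eq_square mult_right_mono)
  finally show ?thesis by (simp add: algebra_simps)
qed

lemma measure_dag_pmf_eq:
  assumes "m \<le> n" and "\<And>d d'. (\<And>y. y \<le> m \<Longrightarrow> d y = d' y) \<Longrightarrow> P d \<longleftrightarrow> P d'"
  shows "measure (dag_pmf k \<mu> n) {d. P d} = measure (dag_pmf k \<mu> m) {d. P d}"
proof -
  have "emeasure (dag_pmf k \<mu> n) {d. P d} = (\<integral>\<^sup>+ d. indicator {d. P d} d \<partial>dag_pmf k \<mu> n)" by simp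
  also have "\<dots> = (\<integral>\<^sup>+ d. indicator {d. P d} d \<partial>dag_pmf k \<mu> m)"
  proof (rule nn_integral_dag_pmf_eq[OF assms(1)])
    fix d d' :: "nat \<Rightarrow> nat" assume "\<And>y. y \<le> m \<Longrightarrow> d y = d' y"
    then have "P d \<longleftrightarrow> P d'" by (rule assms(2))
    then show "indicator {d. P d} d = (indicator {d. P d} d' :: ennreal)" by (simp add: indicator_def)
  qed
  also have "\<dots> = emeasure (dag_pmf k \<mu> m) {d. P d}" by simp
  finally show ?thesis by (simp add: measure_def)
qed

text \<open>
  The root has distance \<open>0\<close> whatever the recursion says, hence its separate term with weight one.
\<close>
definition depth_mean :: "nat \<Rightarrow> (nat \<Rightarrow> nat pmf) \<Rightarrow> (nat \<Rightarrow> real) \<Rightarrow> nat \<Rightarrow> real" where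
  "depth_mean k \<mu> w x = pmf (\<mu> x) 0 + (\<Sum>y\<in>{1..<x}. pmf (\<mu> x) y * w y ^ k)"

text \<open>A Chernoff bound: the left side of the inequality is a sum of indicators of
  \<open>d y < Suc h\<close> with weights \<open>pmf (\<mu> x) y\<close>, and its compensator is
  \<open>depth_mean\<close>. Small atoms make every single weight negligible, which keeps the
  deviation of order \<open>u / x\<close>.\<close>

lemma measure_dag_pmf_concentration:
  assumes k: "k \<ge> 1" and supp: "\<And>y. y \<ge> 1 \<Longrightarrow> set_pmf (\<mu> y) \<subseteq> {..<y}"
    and x: "1 \<le> x" "x \<le> n" and atoms: "\<And>y. pmf (\<mu> x) y \<le> C / real x"
    and \<eta>: "0 < \<eta>" "\<eta> \<le> 1" and C: "C > 0"
  shows "measure (dag_pmf k \<mu> n)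
     {d. measure (\<mu> x) {y. d y < Suc h} >
         (1 + \<eta>) * depth_mean k \<mu> (\<lambda>y. measure (\<mu> y) {z. d z < h}) x + C * u / (\<eta> * real x)} \<le> exp (- u)"
proof -
  define W where "W d y = measure (\<mu> y) {z. d z < h}" for y and d :: "nat \<Rightarrow> nat"
  \<comment> \<open>The atom bound keeps these scaled weights below \<open>\<eta>\<close>, so that
    \<open>exp (\<theta> y) - 1\<close> costs only a factor \<open>1 + \<eta>\<close>. Undoing the
    scaling turns the exponent \<open>u\<close> into the additive error
    \<open>C * u / (\<eta> * real x)\<close>.\<close>
  define \<theta> where "\<theta> y = (\<eta> * real x / C) * pmf (\<mu> x) y" for y
  have \<theta>0: "\<theta> y \<ge> 0" for y using \<eta> C by (simp add: \<theta>_def)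
  have \<theta>1: "\<theta> y \<le> \<eta>" for y
  proof -
    have "\<theta> y \<le> (\<eta> * real x / C) * (C / real x)" unfolding \<theta>_def
      using \<eta> C by (intro mult_left_mono atoms) auto
    then show ?thesis using C x by simp
  qed
  define S where "S d = (\<Sum>y\<in>{1..x-1}. \<theta> y * of_bool (d y < Suc h) - (exp (\<theta> y) - 1) * W d y ^ k)"
    for d :: "nat \<Rightarrow> nat"
  have Wloc: "W d y = W d' y" if "1 \<le> y" "y \<le> x" "\<And>z. z \<le> x - 1 \<Longrightarrow> d z = d' z" for d d' y
    unfolding W_def by (rule measure_supported_cong[OF supp[OF that(1)]]) (use that(2,3) in auto)
  let ?P = "\<lambda>d. measure (\<mu> x) {y. d y < Suc h} >
         (1 + \<eta>) * depth_mean k \<mu> (W d) x + C * u / (\<eta> * real x)"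
  have imp: "S d \<ge> u" if "?P d" for d
  proof -
    have fin: "insert 0 {1..x-1} = {..<x}" "{1..<x} = {1..x-1}" using x by auto
    have "measure (\<mu> x) {y. d y < Suc h} = (\<Sum>y\<in>insert 0 {1..x-1}. pmf (\<mu> x) y * of_bool (d y < Suc h))"
      using supp[OF x(1)] fin by (intro measure_pmf_eq_sum) auto
    also have "\<dots> \<le> pmf (\<mu> x) 0 + (\<Sum>y\<in>{1..x-1}. pmf (\<mu> x) y * of_bool (d y < Suc h))"
      by (subst sum.insert) auto
    finally have "pmf (\<mu> x) 0 + (\<Sum>y\<in>{1..x-1}. pmf (\<mu> x) y * of_bool (d y < Suc h)) >
       (1 + \<eta>) * depth_mean k \<mu> (W d) x + C * u / (\<eta> * real x)" using that by simp
    moreover have "(1 + \<eta>) * depth_mean k \<mu> (W d) x \<ge>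
         pmf (\<mu> x) 0 + (1 + \<eta>) * (\<Sum>y\<in>{1..x-1}. pmf (\<mu> x) y * W d y ^ k)"
      unfolding depth_mean_def fin using \<eta> by (simp add: algebra_simps)
    ultimately have "(\<Sum>y\<in>{1..x-1}. pmf (\<mu> x) y * of_bool (d y < Suc h)) >
       (1 + \<eta>) * (\<Sum>y\<in>{1..x-1}. pmf (\<mu> x) y * W d y ^ k) + C * u / (\<eta> * real x)" by linarith
    then have "(\<eta> * real x / C) * (\<Sum>y\<in>{1..x-1}. pmf (\<mu> x) y * of_bool (d y < Suc h)) >
       (\<eta> * real x / C) * ((1 + \<eta>) * (\<Sum>y\<in>{1..x-1}. pmf (\<mu> x) y * W d y ^ k) + C * u / (\<eta> * real x))"
      using \<eta> C x by (intro mult_strict_left_mono) auto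
    also have "(\<eta> * real x / C) * ((1 + \<eta>) * (\<Sum>y\<in>{1..x-1}. pmf (\<mu> x) y * W d y ^ k) + C * u / (\<eta> * real x))
       = (\<Sum>y\<in>{1..x-1}. (1 + \<eta>) * \<theta> y * W d y ^ k) + u"
      unfolding \<theta>_def using \<eta> C x by (simp add: distrib_left sum_distrib_left field_simps)
    finally have *: "(\<Sum>y\<in>{1..x-1}. \<theta> y * of_bool (d y < Suc h)) > (\<Sum>y\<in>{1..x-1}. (1 + \<eta>) * \<theta> y * W d y ^ k) + u"
      unfolding \<theta>_def sum_distrib_left by (simp add: mult.assoc)
    have "(\<Sum>y\<in>{1..x-1}. (exp (\<theta> y) - 1) * W d y ^ k) \<le> (\<Sum>y\<in>{1..x-1}. (1 + \<eta>) * \<theta> y * W d y ^ k)"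
      using \<theta>0 \<theta>1 \<eta> by (intro sum_mono mult_right_mono exp_minus_one_le) (auto simp: W_def)
    with * show ?thesis unfolding S_def sum_subtractf by linarith
  qed
  \<comment> \<open>The bad event is decided by the nodes below \<open>x\<close>, so the exponential
    moment at time \<open>x - 1\<close> and Markov's inequality suffice.\<close>
  have eq: "measure (dag_pmf k \<mu> n) {d. ?P d} = measure (dag_pmf k \<mu> (x - 1)) {d. ?P d}"
  proof (rule measure_dag_pmf_eq)
    fix d d' :: "nat \<Rightarrow> nat" assume eq: "\<And>y. y \<le> x - 1 \<Longrightarrow> d y = d' y"
    have "depth_mean k \<mu> (W d) x = depth_mean k \<mu> (W d') x"
      unfolding depth_mean_def using Wloc[OF _ _ eq] by (intro arg_cong2[where f="(+)"] sum.cong) auto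
    moreover have "measure (\<mu> x) {y. d y < Suc h} = measure (\<mu> x) {y. d' y < Suc h}"
      by (rule measure_supported_cong[OF supp[OF x(1)]]) (use eq x in auto)
    ultimately show "?P d \<longleftrightarrow> ?P d'" by simp
  qed (use x in auto)
  have "ennreal (measure (dag_pmf k \<mu> (x - 1)) {d. ?P d}) =
      (\<integral>\<^sup>+ d. indicator {d. ?P d} d \<partial>dag_pmf k \<mu> (x - 1))"
    by (rule ennreal_measure_pmf_eq)
  also have "\<dots> \<le> (\<integral>\<^sup>+ d. ennreal (exp (- u)) * ennreal (exp (S d)) \<partial>dag_pmf k \<mu> (x - 1))"
  proof (intro nn_integral_mono)
    fix d :: "nat \<Rightarrow> nat"
    show "indicator {d. ?P d} d \<le> ennreal (exp (- u)) * ennreal (exp (S d))"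
    proof (cases "?P d")
      case True
      have "1 \<le> exp (- u + S d)" using imp[OF True] by simp
      then have "ennreal 1 \<le> ennreal (exp (- u) * exp (S d))" by (intro ennreal_leI) (simp only: exp_add)
      then show ?thesis by (simp add: ennreal_mult' indicator_def)
    qed (simp add: indicator_def)
  qed
  also have "\<dots> = ennreal (exp (- u)) * (\<integral>\<^sup>+ d. ennreal (exp (S d)) \<partial>dag_pmf k \<mu> (x - 1))"
    by (rule nn_integral_cmult) simp
  also have "\<dots> \<le> ennreal (exp (- u)) * 1"
    unfolding S_def W_def by (intro mult_left_mono nn_integral_exp_depth_count_le_1 k supp \<theta>0) auto
  finally have "measure (dag_pmf k \<mu> n) {d. ?P d} \<le> exp (- u)" unfolding eq by simp
  then show ?thesis unfolding W_def .
qed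

text \<open>The bound \<open>w\<close> is part of the event because the measure it controls is
  random. That condition is decided before the parents of \<open>x\<close> are drawn; given it, all
  \<open>k\<close> of them are shallow with probability at most \<open>w ^ k\<close>, and a union
  bound over \<open>S\<close> follows.\<close>

lemma measure_dag_pmf_depth_less:
  assumes k: "k \<ge> 1" and supp: "\<And>y. y \<ge> 1 \<Longrightarrow> set_pmf (\<mu> y) \<subseteq> {..<y}"
    and S: "S \<subseteq> {1..n}" and w: "w \<ge> 0"
  shows "measure (dag_pmf k \<mu> n) {d. (\<forall>x\<in>S. measure (\<mu> x) {z. d z < h} \<le> w) \<and> (\<exists>x\<in>S. d x < Suc h)}
    \<le> real (card S) * w ^ k"
proof -
  have one: "measure (dag_pmf k \<mu> n) {d. measure (\<mu> x) {z. d z < h} \<le> w \<and> d x < Suc h} \<le> w ^ k"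
    (is "measure _ {d. ?P d} \<le> _") if xS: "x \<in> S" for x
  proof -
    obtain j where j: "x = Suc j" "Suc j \<le> n" using xS S by (cases x) fastforce+
    have loc: "measure (\<mu> x) {z. d z < h} = measure (\<mu> x) {z. d' z < h}" if "\<And>y. y \<le> j \<Longrightarrow> d y = d' y" for d d'
      by (rule measure_supported_cong[OF supp[of x]]) (use that j in auto)
    have eq: "measure (dag_pmf k \<mu> n) {d. ?P d} = measure (dag_pmf k \<mu> (Suc j)) {d. ?P d}"
    proof (rule measure_dag_pmf_eq)
      fix d d' :: "nat \<Rightarrow> nat" assume eq: "\<And>y. y \<le> Suc j \<Longrightarrow> d y = d' y"
      show "?P d \<longleftrightarrow> ?P d'" using loc[of d d'] eq j by auto
    qed (use j in auto)
    have "ennreal (measure (dag_pmf k \<mu> (Suc j)) {d. ?P d}) =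
        (\<integral>\<^sup>+ d. indicator {d. ?P d} d \<partial>dag_pmf k \<mu> (Suc j))"
      by (rule ennreal_measure_pmf_eq)
    also have "\<dots> \<le> (\<integral>\<^sup>+ d. ennreal (w ^ k) \<partial>dag_pmf k \<mu> j)"
      unfolding nn_integral_dag_pmf_Suc
    proof (intro nn_integral_mono)
      fix d :: "nat \<Rightarrow> nat"
      have *: "measure (\<mu> x) {z. (d(Suc j := v)) z < h} = measure (\<mu> x) {z. d z < h}" for v
        by (rule loc) auto
      let ?Q = "parents_pmf k \<mu> (Suc j)"
      have "(\<integral>\<^sup>+ z. indicator {d. ?P d} (d(Suc j := new_depth k d (Suc j) z)) \<partial>?Q)
        = (\<integral>\<^sup>+ z. of_bool (measure (\<mu> x) {z. d z < h} \<le> w) *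
             indicator {z. new_depth k d (Suc j) z < Suc h} z \<partial>?Q)"
        by (intro nn_integral_cong) (simp only: mem_Collect_eq * indicator_def, simp add: j(1))
      also have "\<dots> = of_bool (measure (\<mu> x) {z. d z < h} \<le> w) *
           ennreal (measure (\<mu> (Suc j)) {z. d z < h} ^ k)"
        using measure_depth_less[OF k, of "Suc j" \<mu> d h]
        by (subst nn_integral_cmult) (auto simp: measure_pmf.emeasure_eq_measure simp del: not_less_eq Suc_less_eq)
      also have "\<dots> \<le> ennreal (w ^ k)"
        by (auto simp: of_bool_def j(1) intro!: ennreal_leI power_mono)
      finally show "(\<integral>\<^sup>+ z. indicator {d. ?P d} (d(Suc j := new_depth k d (Suc j) z)) \<partial>?Q) \<le> ennreal (w ^ k)" .
    qed
    also have "\<dots> = ennreal (w ^ k)" by simp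
    finally show ?thesis unfolding eq using w by simp
  qed
  have "measure (dag_pmf k \<mu> n) {d. (\<forall>x\<in>S. measure (\<mu> x) {z. d z < h} \<le> w) \<and> (\<exists>x\<in>S. d x < Suc h)}
     \<le> measure (dag_pmf k \<mu> n) (\<Union>x\<in>S. {d. measure (\<mu> x) {z. d z < h} \<le> w \<and> d x < Suc h})"
    by (intro measure_pmf.finite_measure_mono) auto
  also have "\<dots> \<le> (\<Sum>x\<in>S. measure (dag_pmf k \<mu> n) {d. measure (\<mu> x) {z. d z < h} \<le> w \<and> d x < Suc h})"
    using S by (intro measure_pmf.finite_measure_subadditive_finite) (auto intro: finite_subset)
  also have "\<dots> \<le> (\<Sum>x\<in>S. w ^ k)" by (intro sum_mono one)
  finally show ?thesis by simp
qed

section \<open>First moment bounds\<close>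

lemma measure_parents_ex_le:
  fixes \<mu> :: "nat \<Rightarrow> nat pmf"
  assumes k: "k \<ge> 1"
  shows "measure (parents_pmf k \<mu> x) {z. new_depth k d x z > Suc t}
         \<le> real k * measure (\<mu> x) {y. d y > t}"
proof -
  let ?Q = "parents_pmf k \<mu> x"
  have "{z. new_depth k d x z > Suc t} = (\<Union>e\<in>parent_arcs k x. {z. d (z e) > t})"
    using k by (auto simp: Max_gr_iff)
  then have "measure ?Q {z. new_depth k d x z > Suc t} \<le>
      (\<Sum>e\<in>parent_arcs k x. measure ?Q {z. d (z e) > t})"
    by (simp only:) (intro measure_pmf.finite_measure_subadditive_finite, auto)
  also have "\<dots> = (\<Sum>e\<in>parent_arcs k x. measure (\<mu> x) {y. d y > t})"
  proof (intro sum.cong refl)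
    fix e assume e: "e \<in> parent_arcs k x"
    have "measure (map_pmf (\<lambda>z. z e) ?Q) {y. d y > t} = measure ?Q {z. d (z e) > t}"
      by (simp add: vimage_def)
    then show "measure ?Q {z. d (z e) > t} = measure (\<mu> x) {y. d y > t}"
      using e by (subst (asm) Pi_pmf_component) (auto simp: parent_arcs_def)
  qed
  also have "\<dots> = real k * measure (\<mu> x) {y. d y > t}"
    by (simp add: parent_arcs_def card_cartesian_product)
  finally show ?thesis .
qed

text \<open>Averaging over the graph commutes with averaging over a parent, so only the laws of
  single distances enter.\<close>

lemma nn_integral_measure_depth:
  fixes p :: "nat pmf" and q :: "(nat \<Rightarrow> nat) pmf"
  assumes "set_pmf p \<subseteq> A" "finite A"
  shows "(\<integral>\<^sup>+ d. ennreal (measure p {y. P y (d y)}) \<partial>q) =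
         ennreal (\<Sum>y\<in>A. pmf p y * measure q {d. P y (d y)})"
proof -
  have "(\<integral>\<^sup>+ d. ennreal (measure p {y. P y (d y)}) \<partial>q) =
      (\<integral>\<^sup>+ d. (\<Sum>y\<in>A. ennreal (pmf p y) * indicator {d. P y (d y)} d) \<partial>q)"
    by (intro nn_integral_cong, subst measure_pmf_eq_sum[OF assms], subst sum_ennreal[symmetric])
      (auto simp: ennreal_mult' indicator_def intro!: sum.cong)
  also have "\<dots> = (\<Sum>y\<in>A. ennreal (pmf p y) * ennreal (measure q {d. P y (d y)}))"
    by (subst nn_integral_sum) (auto simp: nn_integral_cmult measure_pmf.emeasure_eq_measure)
  also have "\<dots> = ennreal (\<Sum>y\<in>A. pmf p y * measure q {d. P y (d y)})"
    by (subst sum_ennreal[symmetric]) (auto simp: ennreal_mult')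
  finally show ?thesis .
qed

lemma measure_dag_pmf_root: "measure (dag_pmf k \<mu> n) {d. d 0 > t} = 0"
proof -
  have "measure (dag_pmf k \<mu> n) {d. d 0 > t} = measure (dag_pmf k \<mu> 0) {d. d 0 > t}"
    by (rule measure_dag_pmf_eq) auto
  then show ?thesis by simp
qed

text \<open>First moment method: each step of a path costs a factor \<open>k\<close> for the choice
  of the arc and a factor \<open>m\<close> for the mean of the weight \<open>g\<close>, while
  \<open>g y \<ge> 1\<close> starts the induction. The root is left out of the sum because its
  distance never exceeds \<open>t\<close>. The intended weight is a power of the node.\<close>

lemma measure_dag_pmf_depth_greater:
  assumes k: "k \<ge> 1" and supp: "\<And>y. y \<ge> 1 \<Longrightarrow> set_pmf (\<mu> y) \<subseteq> {..<y}"
    and g1: "\<And>y. y \<ge> 1 \<Longrightarrow> g y \<ge> 1" and m: "m \<ge> 0"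
    and g: "\<And>y. y \<ge> 1 \<Longrightarrow> (\<Sum>z\<in>{1..<y}. pmf (\<mu> y) z * g z) \<le> m * g y"
    and y: "1 \<le> y" "y \<le> n"
  shows "measure (dag_pmf k \<mu> n) {d. d y > t} \<le> (real k * m) ^ t * g y"
  using y
proof (induction t arbitrary: y n)
  case 0
  have "measure (dag_pmf k \<mu> n) {d. d y > 0} \<le> 1" by simp
  also have "\<dots> \<le> g y" using g1[of y] 0 by simp
  finally show ?case by simp
next
  case (Suc t)
  obtain j where j: "y = Suc j" "Suc j \<le> n" using Suc.prems by (cases y) auto
  have eq: "measure (dag_pmf k \<mu> n) {d. d y > Suc t} = measure (dag_pmf k \<mu> (Suc j)) {d. d y > Suc t}"
    by (rule measure_dag_pmf_eq) (use j in auto)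
  have "ennreal (measure (dag_pmf k \<mu> (Suc j)) {d. d y > Suc t}) =
      (\<integral>\<^sup>+ d. indicator {d. d y > Suc t} d \<partial>dag_pmf k \<mu> (Suc j))"
    by (rule ennreal_measure_pmf_eq)
  also have "\<dots> \<le> (\<integral>\<^sup>+ d. ennreal (real k) * ennreal (measure (\<mu> y) {z. d z > t}) \<partial>dag_pmf k \<mu> j)"
    unfolding nn_integral_dag_pmf_Suc
  proof (intro nn_integral_mono)
    fix d :: "nat \<Rightarrow> nat"
    let ?Q = "parents_pmf k \<mu> (Suc j)"
    have "(\<integral>\<^sup>+ z. indicator {d. d y > Suc t} (d(Suc j := new_depth k d (Suc j) z)) \<partial>?Q)
        = (\<integral>\<^sup>+ z. indicator {z. new_depth k d (Suc j) z > Suc t} z \<partial>?Q)"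
      by (intro nn_integral_cong) (simp add: indicator_def j(1))
    also have "\<dots> = ennreal (measure ?Q {z. new_depth k d (Suc j) z > Suc t})"
      by (rule ennreal_measure_pmf_eq[symmetric])
    also have "\<dots> \<le> ennreal (real k * measure (\<mu> y) {z. d z > t})"
      unfolding j(1) by (intro ennreal_leI measure_parents_ex_le k)
    finally show "(\<integral>\<^sup>+ z. indicator {d. d y > Suc t} (d(Suc j := new_depth k d (Suc j) z)) \<partial>?Q)
       \<le> ennreal (real k) * ennreal (measure (\<mu> y) {z. d z > t})"
      by (simp only: ennreal_mult' of_nat_0_le_iff)
  qed
  also have "\<dots> = ennreal (real k * (\<Sum>z\<in>{..<y}. pmf (\<mu> y) z * measure (dag_pmf k \<mu> j) {d. d z > t}))"
    using supp[of y] Suc.prems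
    by (subst nn_integral_cmult, simp, subst nn_integral_measure_depth[where A="{..<y}"]) (auto simp: ennreal_mult')
  finally have le: "measure (dag_pmf k \<mu> (Suc j)) {d. d y > Suc t} \<le>
      real k * (\<Sum>z\<in>{..<y}. pmf (\<mu> y) z * measure (dag_pmf k \<mu> j) {d. d z > t})"
    by (subst (asm) ennreal_le_iff) (auto intro!: mult_nonneg_nonneg sum_nonneg)
  have ins: "{..<y} = insert 0 {1..<y}" using Suc.prems by auto
  have "(\<Sum>z\<in>{..<y}. pmf (\<mu> y) z * measure (dag_pmf k \<mu> j) {d. d z > t}) =
      (\<Sum>z\<in>{1..<y}. pmf (\<mu> y) z * measure (dag_pmf k \<mu> j) {d. d z > t})"
    unfolding ins by (subst sum.insert) (auto simp: measure_dag_pmf_root[of k \<mu> j t, simplified])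
  also have "\<dots> \<le> (\<Sum>z\<in>{1..<y}. pmf (\<mu> y) z * ((real k * m) ^ t * g z))"
    using Suc.IH j by (intro sum_mono mult_left_mono) auto
  also have "\<dots> = (real k * m) ^ t * (\<Sum>z\<in>{1..<y}. pmf (\<mu> y) z * g z)"
    by (simp add: sum_distrib_left mult.left_commute)
  also have "\<dots> \<le> (real k * m) ^ t * (m * g y)"
    using m Suc.prems by (intro mult_left_mono g) auto
  finally have "real k * (\<Sum>z\<in>{..<y}. pmf (\<mu> y) z * measure (dag_pmf k \<mu> j) {d. d z > t}) \<le>
      real k * ((real k * m) ^ t * (m * g y))" by (intro mult_left_mono) auto
  also have "\<dots> = (real k * m) ^ Suc t * g y" by simp
  finally show ?case unfolding eq using le by linarith
qed

text \<open>The nodes are peeled off from \<open>n\<close> downwards. A node whose parents are all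
  at most \<open>m\<close> with distance at most \<open>t\<close> is not deep, so given the past it
  is deep with probability at most one minus a \<open>k\<close>-th power. \<open>G\<close> collects
  the factors already produced, which depend only on the nodes up to \<open>m\<close>; hence it
  varies in the induction.\<close>

lemma nn_integral_all_deep_le:
  assumes k: "k \<ge> 1" and supp: "\<And>y. y \<ge> 1 \<Longrightarrow> set_pmf (\<mu> y) \<subseteq> {..<y}"
    and m: "m \<le> a" and an: "a \<le> n" and G: "\<And>d d'. (\<And>y. y \<le> m \<Longrightarrow> d y = d' y) \<Longrightarrow> G d = G d'"
  shows "(\<integral>\<^sup>+ d. G d * indicator {d. \<forall>x\<in>{a<..n}. d x > Suc t} d \<partial>dag_pmf k \<mu> n) \<le>
    (\<integral>\<^sup>+ d. G d * ennreal (\<Prod>x\<in>{a<..n}. 1 - measure (\<mu> x) {y. y \<le> m \<and> d y \<le> t} ^ k) \<partial>dag_pmf k \<mu> m)"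
  using an G
  proof (induction n arbitrary: G rule: dec_induct)
    case base
    have "(\<integral>\<^sup>+ d. G d \<partial>dag_pmf k \<mu> a) = (\<integral>\<^sup>+ d. G d \<partial>dag_pmf k \<mu> m)"
      by (rule nn_integral_dag_pmf_eq[OF m base])
    then show ?case by simp
  next
    case (step n)
    define q where "q d = measure (\<mu> (Suc n)) {y. y \<le> m \<and> d y \<le> t} ^ k" for d :: "nat \<Rightarrow> nat"
    have q: "0 \<le> q d" "q d \<le> 1" for d unfolding q_def by (auto intro!: power_le_one)
    have mn: "m \<le> n" using m step.hyps by simp
    have ins: "{a<..Suc n} = insert (Suc n) {a<..n}" using step.hyps by auto
    have "(\<integral>\<^sup>+ d. G d * indicator {d. \<forall>x\<in>{a<..Suc n}. d x > Suc t} d \<partial>dag_pmf k \<mu> (Suc n)) \<le>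
       (\<integral>\<^sup>+ d. (G d * ennreal (1 - q d)) * indicator {d. \<forall>x\<in>{a<..n}. d x > Suc t} d \<partial>dag_pmf k \<mu> n)"
      unfolding nn_integral_dag_pmf_Suc
    proof (intro nn_integral_mono)
      fix d :: "nat \<Rightarrow> nat"
      let ?Q = "parents_pmf k \<mu> (Suc n)"
      let ?u = "\<lambda>z. d(Suc n := new_depth k d (Suc n) z)"
      let ?B = "{z. \<forall>e\<in>parent_arcs k (Suc n). z e \<in> {y. y \<le> m \<and> d y \<le> t}}"
      have Gd: "G (d(Suc n := v)) = G d" for v using mn by (intro step.prems) auto
      have "indicator {d. \<forall>x\<in>{a<..Suc n}. d x > Suc t} (?u z) \<le>
          indicator {d. \<forall>x\<in>{a<..n}. d x > Suc t} d * (indicator (- ?B) z :: ennreal)" for z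
      proof (cases "\<forall>x\<in>{a<..Suc n}. ?u z x > Suc t")
        case True
        have "\<forall>x\<in>{a<..n}. d x > Suc t"
        proof
          fix x assume "x \<in> {a<..n}"
          then show "d x > Suc t" using True[rule_format, of x] by auto
        qed
        moreover have "z \<notin> ?B"
        proof
          assume "z \<in> ?B"
          then have "Max (d ` z ` parent_arcs k (Suc n)) \<le> t" using k by (subst Max_le_iff) auto
          moreover have "?u z (Suc n) > Suc t" using True[rule_format, of "Suc n"] step.hyps by simp
          ultimately show False by simp
        qed
        ultimately show ?thesis by (simp add: indicator_def)
      qed (simp add: indicator_def del: fun_upd_apply)
      then have "(\<integral>\<^sup>+ z. G (?u z) * indicator {d. \<forall>x\<in>{a<..Suc n}. d x > Suc t} (?u z) \<partial>?Q) \<le>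
        (\<integral>\<^sup>+ z. (G d * indicator {d. \<forall>x\<in>{a<..n}. d x > Suc t} d) * indicator (- ?B) z \<partial>?Q)"
        unfolding Gd mult.assoc by (intro nn_integral_mono mult_left_mono) auto
      also have "\<dots> = (G d * indicator {d. \<forall>x\<in>{a<..n}. d x > Suc t} d) * ennreal (measure ?Q (- ?B))"
        by (subst nn_integral_cmult) (auto simp: measure_pmf.emeasure_eq_measure)
      also have "measure ?Q (- ?B) = 1 - q d"
        unfolding q_def measure_parents_in[symmetric] Compl_eq_Diff_UNIV
        using measure_pmf.prob_compl[of ?B ?Q] by simp
      finally show "(\<integral>\<^sup>+ z. G (?u z) * indicator {d. \<forall>x\<in>{a<..Suc n}. d x > Suc t} (?u z) \<partial>?Q) \<le>
         G d * ennreal (1 - q d) * indicator {d. \<forall>x\<in>{a<..n}. d x > Suc t} d"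
        by (simp only: mult_ac)
    qed
    also have "\<dots> \<le> (\<integral>\<^sup>+ d. (G d * ennreal (1 - q d)) *
        ennreal (\<Prod>x\<in>{a<..n}. 1 - measure (\<mu> x) {y. y \<le> m \<and> d y \<le> t} ^ k) \<partial>dag_pmf k \<mu> m)"
    proof (rule step.IH)
      fix d d' :: "nat \<Rightarrow> nat" assume eq: "\<And>y. y \<le> m \<Longrightarrow> d y = d' y"
      then have "{y. y \<le> m \<and> d y \<le> t} = {y. y \<le> m \<and> d' y \<le> t}" by auto
      then show "G d * ennreal (1 - q d) = G d' * ennreal (1 - q d')"
        using step.prems[OF eq] unfolding q_def by simp
    qed
    also have "\<dots> = (\<integral>\<^sup>+ d. G d * ennreal (\<Prod>x\<in>{a<..Suc n}. 1 - measure (\<mu> x) {y. y \<le> m \<and> d y \<le> t} ^ k) \<partial>dag_pmf k \<mu> m)"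
    proof (intro nn_integral_cong)
      fix d :: "nat \<Rightarrow> nat"
      have "(\<Prod>x\<in>{a<..Suc n}. 1 - measure (\<mu> x) {y. y \<le> m \<and> d y \<le> t} ^ k) =
         (1 - q d) * (\<Prod>x\<in>{a<..n}. 1 - measure (\<mu> x) {y. y \<le> m \<and> d y \<le> t} ^ k)"
        unfolding ins q_def by (subst prod.insert) auto
      then show "G d * ennreal (1 - q d) *
        ennreal (\<Prod>x\<in>{a<..n}. 1 - measure (\<mu> x) {y. y \<le> m \<and> d y \<le> t} ^ k) =
        G d * ennreal (\<Prod>x\<in>{a<..Suc n}. 1 - measure (\<mu> x) {y. y \<le> m \<and> d y \<le> t} ^ k)"
        using q[of d] by (simp only: ennreal_mult' mult.assoc diff_ge_0_iff_ge)
    qed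
    finally show ?case .
  qed

text \<open>
  The bad parents of \<open>x\<close> are controlled by Markov's inequality for their total weight, which is
  averaged over \<open>x\<close>, so that only the marginal laws of the distances enter.
\<close>
lemma measure_dag_pmf_all_deep:
  assumes k: "k \<ge> 1" and supp: "\<And>y. y \<ge> 1 \<Longrightarrow> set_pmf (\<mu> y) \<subseteq> {..<y}"
    and m: "m \<le> a" "a \<le> n" and s: "\<And>y. y \<le> m \<Longrightarrow> measure (dag_pmf k \<mu> m) {d. d y > t} \<le> s"
    and T: "T = (\<Sum>x\<in>{a<..n}. measure (\<mu> x) {y. y \<le> m} ^ k)" "T > 0"
  shows "measure (dag_pmf k \<mu> n) {d. \<forall>x\<in>{a<..n}. d x > Suc t} \<le> exp (- T / 2) + 2 * real k * s"
proof -
  define P where "P x = measure (\<mu> x) {y. y \<le> m}" for x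
  define q where "q d x = measure (\<mu> x) {y. y \<le> m \<and> d y > t}" for d :: "nat \<Rightarrow> nat" and x
  define r where "r d x = measure (\<mu> x) {y. y \<le> m \<and> d y \<le> t}" for d :: "nat \<Rightarrow> nat" and x
  define v where "v d = (\<Sum>x\<in>{a<..n}. real k * P x ^ (k - 1) * q d x)" for d
  have Pqr: "r d x + q d x = P x" for d x
    unfolding r_def q_def P_def
    by (subst measure_pmf.finite_measure_Union[symmetric]) (auto intro!: arg_cong2[where f=measure])
  have nn: "P x \<ge> 0" "q d x \<ge> 0" "r d x \<ge> 0" "P x \<le> 1" "r d x \<le> 1" for d x
    unfolding P_def q_def r_def by auto
  \<comment> \<open>Bernoulli's inequality for \<open>r = P - q\<close>. The bound is linear in the
    bad mass \<open>q\<close>, so its expectation can be taken.\<close>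
  have pow: "r d x ^ k \<ge> P x ^ k - real k * P x ^ (k - 1) * q d x" for d x
  proof (cases "P x = 0")
    case True
    then have "q d x = 0" "r d x = 0" using Pqr[of d x] nn(1)[of x] nn(2,3)[of d x] by auto
    then show ?thesis using True k by simp
  next
    case False
    then have P: "P x > 0" using nn(1)[of x] by simp
    have "1 + real k * (- (q d x / P x)) \<le> (1 + (- (q d x / P x))) ^ k"
      using Pqr[of d x] nn(1)[of x] nn(2,3)[of d x] P by (intro Bernoulli_inequality) (auto simp: field_simps)
    also have "1 + (- (q d x / P x)) = r d x / P x" using Pqr[of d x] P by (simp add: field_simps)
    finally have "P x ^ k * (1 - real k * (q d x / P x)) \<le> P x ^ k * ((r d x / P x) ^ k)"
      using P by (intro mult_left_mono) auto
    also have "\<dots> = r d x ^ k" using P by (simp add: power_divide)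
    finally have "P x ^ k - P x ^ k * (real k * (q d x / P x)) \<le> r d x ^ k" by (simp add: algebra_simps)
    also have "P x ^ k * (real k * (q d x / P x)) = real k * P x ^ (k - 1) * q d x"
      using P k by (cases k) auto
    finally show ?thesis .
  qed
  have v0: "v d \<ge> 0" for d unfolding v_def using nn by (intro sum_nonneg) auto
  \<comment> \<open>If the bad weight \<open>v d\<close> reaches \<open>T / 2\<close>, the second
    term is at least 1; otherwise the good weight is still at least \<open>T / 2\<close> and the
    first term suffices.\<close>
  have prod: "(\<Prod>x\<in>{a<..n}. 1 - r d x ^ k) \<le> exp (- T / 2) + 2 / T * v d" for d
  proof -
    have "(\<Prod>x\<in>{a<..n}. 1 - r d x ^ k) \<le> (\<Prod>x\<in>{a<..n}. exp (- (r d x ^ k)))"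
    proof (intro prod_mono conjI)
      fix x
      show "0 \<le> 1 - r d x ^ k" using nn by (simp add: power_le_one)
      show "1 - r d x ^ k \<le> exp (- (r d x ^ k))" using exp_ge_add_one_self[of "- (r d x ^ k)"] by simp
    qed
    also have "\<dots> = exp (- (\<Sum>x\<in>{a<..n}. r d x ^ k))" by (simp add: exp_sum sum_negf[symmetric])
    finally have le: "(\<Prod>x\<in>{a<..n}. 1 - r d x ^ k) \<le> exp (- (\<Sum>x\<in>{a<..n}. r d x ^ k))" .
    have ge: "(\<Sum>x\<in>{a<..n}. r d x ^ k) \<ge> T - v d"
      unfolding T v_def P_def[symmetric] sum_subtractf[symmetric] by (intro sum_mono pow)
    show ?thesis
    proof (cases "v d \<ge> T / 2")
      case True
      have "(\<Sum>x\<in>{a<..n}. r d x ^ k) \<ge> 0" using nn by (intro sum_nonneg) auto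
      then have "(\<Prod>x\<in>{a<..n}. 1 - r d x ^ k) \<le> 1" using le by (auto elim: order_trans)
      also have "1 \<le> 2 / T * v d" using True T(2) by (simp add: field_simps)
      finally show ?thesis by (smt (verit) exp_gt_zero)
    next
      case False
      then have "exp (- (\<Sum>x\<in>{a<..n}. r d x ^ k)) \<le> exp (- T / 2)" using ge by simp
      then show ?thesis using le v0[of d] T(2) by (smt (verit) divide_nonneg_pos mult_nonneg_nonneg)
    qed
  qed
  have Eq: "(\<integral>\<^sup>+ d. ennreal (q d x) \<partial>dag_pmf k \<mu> m) \<le> ennreal (s * P x)" if "x \<in> {a<..n}" for x
  proof -
    have sx: "set_pmf (\<mu> x) \<subseteq> {..<x}" using supp[of x] that by auto
    have "(\<integral>\<^sup>+ d. ennreal (q d x) \<partial>dag_pmf k \<mu> m) =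
       ennreal (\<Sum>y\<in>{..<x}. pmf (\<mu> x) y * measure (dag_pmf k \<mu> m) {d. y \<le> m \<and> d y > t})"
      unfolding q_def using nn_integral_measure_depth[OF sx, where P="\<lambda>y v. y \<le> m \<and> v > t" and q="dag_pmf k \<mu> m"] by simp
    also have "\<dots> \<le> ennreal (\<Sum>y\<in>{..<x}. s * (pmf (\<mu> x) y * of_bool (y \<le> m)))"
      using s by (intro ennreal_leI sum_mono) (auto simp: mult.commute[of s] mult.assoc intro!: mult_left_mono)
    also have "(\<Sum>y\<in>{..<x}. s * (pmf (\<mu> x) y * of_bool (y \<le> m))) = s * P x"
      unfolding P_def sum_distrib_left[symmetric] by (subst measure_pmf_eq_sum[OF sx]) auto
    finally show ?thesis .
  qed
  have s0: "s \<ge> 0" using s[of 0] measure_nonneg[of "dag_pmf k \<mu> m" "{d. d 0 > t}"] by linarith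
  have Ev: "(\<integral>\<^sup>+ d. ennreal (v d) \<partial>dag_pmf k \<mu> m) \<le> ennreal (real k * s * T)"
  proof -
    have "(\<integral>\<^sup>+ d. ennreal (v d) \<partial>dag_pmf k \<mu> m) =
       (\<Sum>x\<in>{a<..n}. ennreal (real k * P x ^ (k - 1)) * (\<integral>\<^sup>+ d. ennreal (q d x) \<partial>dag_pmf k \<mu> m))"
      unfolding v_def using nn
      by (subst sum_ennreal[symmetric], simp, subst nn_integral_sum, simp)
         (auto simp: ennreal_mult' nn_integral_cmult intro!: sum.cong)
    also have "\<dots> \<le> (\<Sum>x\<in>{a<..n}. ennreal (real k * P x ^ (k - 1)) * ennreal (s * P x))"
      by (intro sum_mono mult_left_mono Eq) auto
    also have "\<dots> = (\<Sum>x\<in>{a<..n}. ennreal (real k * s * P x ^ k))"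
    proof (intro sum.cong refl)
      fix x
      have "P x ^ k = P x ^ (k - 1) * P x" using k by (cases k) auto
      then show "ennreal (real k * P x ^ (k - 1)) * ennreal (s * P x) = ennreal (real k * s * P x ^ k)"
        using nn by (subst ennreal_mult'[symmetric]) (auto simp: mult_ac)
    qed
    also have "\<dots> = ennreal (real k * s * T)"
      unfolding T P_def[symmetric] sum_distrib_left using nn s0 by (subst sum_ennreal) auto
    finally show ?thesis .
  qed
  have "ennreal (measure (dag_pmf k \<mu> n) {d. \<forall>x\<in>{a<..n}. d x > Suc t}) =
      (\<integral>\<^sup>+ d. 1 * indicator {d. \<forall>x\<in>{a<..n}. d x > Suc t} d \<partial>dag_pmf k \<mu> n)"
    by (simp only: ennreal_measure_pmf_eq mult_1)
  also have "\<dots> \<le> (\<integral>\<^sup>+ d. 1 * ennreal (\<Prod>x\<in>{a<..n}. 1 - r d x ^ k) \<partial>dag_pmf k \<mu> m)"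
    unfolding r_def by (rule nn_integral_all_deep_le[OF k supp m]) auto
  also have "\<dots> \<le> (\<integral>\<^sup>+ d. ennreal (exp (- T / 2)) + ennreal (2 / T) * ennreal (v d) \<partial>dag_pmf k \<mu> m)"
  proof (intro nn_integral_mono)
    fix d
    have "ennreal (\<Prod>x\<in>{a<..n}. 1 - r d x ^ k) \<le> ennreal (exp (- T / 2) + 2 / T * v d)"
      by (intro ennreal_leI prod)
    also have "\<dots> = ennreal (exp (- T / 2)) + ennreal (2 / T) * ennreal (v d)"
      using T(2) v0[of d] by (subst ennreal_plus) (auto simp: ennreal_mult'[symmetric])
    finally show "1 * ennreal (\<Prod>x\<in>{a<..n}. 1 - r d x ^ k) \<le> ennreal (exp (- T / 2)) + ennreal (2 / T) * ennreal (v d)"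
      by simp
  qed
  also have "\<dots> = ennreal (exp (- T / 2)) + ennreal (2 / T) * (\<integral>\<^sup>+ d. ennreal (v d) \<partial>dag_pmf k \<mu> m)"
    by (subst nn_integral_add) (auto simp: nn_integral_cmult)
  also have "\<dots> \<le> ennreal (exp (- T / 2)) + ennreal (2 / T) * ennreal (real k * s * T)"
    by (intro add_left_mono mult_left_mono Ev) auto
  also have "\<dots> = ennreal (exp (- T / 2) + 2 * real k * s)"
    using T(2) s0 by (subst ennreal_mult'[symmetric], simp, subst ennreal_plus[symmetric]) (auto simp: field_simps)
  finally show ?thesis using s0 by (subst (asm) ennreal_le_iff) (auto intro!: add_nonneg_nonneg)
qed

section \<open>The distances in the graph\<close>

definition parent_pmf :: "'b measure \<Rightarrow> ('b \<Rightarrow> real) \<Rightarrow> nat \<Rightarrow> nat pmf" where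
  "parent_pmf N X x = Abs_pmf (distr N (count_space UNIV) (\<lambda>\<omega>. nat \<lfloor>real x * X \<omega>\<rfloor>))"

lemma measure_parent_pmf:
  assumes "prob_space N" and X[measurable]: "X \<in> borel_measurable N"
  shows "measure (parent_pmf N X x) A = measure N {\<omega> \<in> space N. nat \<lfloor>real x * X \<omega>\<rfloor> \<in> A}"
proof -
  interpret N: prob_space N by fact
  let ?D = "distr N (count_space UNIV) (\<lambda>\<omega>. nat \<lfloor>real x * X \<omega>\<rfloor>)"
  interpret D: prob_space ?D by (rule N.prob_space_distr) simp
  have "AE y in ?D. measure ?D {y} \<noteq> 0"
    by (subst D.AE_support_countable) (auto intro!: exI[of _ UNIV])
  then have "measure_pmf (parent_pmf N X x) = ?D"
    unfolding parent_pmf_def by (intro Abs_pmf_inverse) (simp add: D.prob_space_axioms)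
  then show ?thesis by (simp add: measure_distr vimage_def Int_def conj_commute)
qed

text \<open>The pathwise counterpart of \<open>dag_pmf\<close>: all parent choices are fixed in
  advance by \<open>f\<close>.\<close>

primrec depths :: "nat \<Rightarrow> (nat \<times> nat \<Rightarrow> nat) \<Rightarrow> nat \<Rightarrow> nat \<Rightarrow> nat" where
  "depths k f 0 = (\<lambda>_. 0)"
| "depths k f (Suc n) = (depths k f n)(Suc n := Suc (Max (depths k f n ` f ` parent_arcs k (Suc n))))"

lemma depths_cong:
  "(\<And>e. e \<in> {1..n} \<times> {1..k} \<Longrightarrow> f e = g e) \<Longrightarrow> depths k f n = depths k g n"
proof (induction n)
  case (Suc n)
  have "depths k f n = depths k g n" using Suc.prems by (intro Suc.IH) auto
  moreover have "f ` parent_arcs k (Suc n) = g ` parent_arcs k (Suc n)"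
    using Suc.prems by (intro image_cong) (auto simp: parent_arcs_def)
  ultimately show ?case by simp
qed simp

text \<open>In the product law the arcs leaving \<open>Suc n\<close> form a block independent of the
  earlier ones, so drawing all arcs at once agrees with drawing them node by node.\<close>

lemma dag_pmf_eq_map_depths:
  "dag_pmf k \<mu> n = map_pmf (\<lambda>f. depths k f n) (Pi_pmf ({1..n} \<times> {1..k}) 0 (\<lambda>(x, p). \<mu> x))"
proof (induction n)
  case (Suc n)
  let ?A = "{1..n} \<times> {1..k}" and ?B = "parent_arcs k (Suc n)"
  have split: "{1..Suc n} \<times> {1..k} = ?A \<union> ?B" by (auto simp: parent_arcs_def)
  have merge: "depths k (\<lambda>e. if e \<in> ?A then f e else g e) (Suc n) =
      (depths k f n)(Suc n := Suc (Max (depths k f n ` g ` ?B)))" for f g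
  proof -
    have "depths k (\<lambda>e. if e \<in> ?A then f e else g e) n = depths k f n" by (rule depths_cong) simp
    moreover have "(\<lambda>e. if e \<in> ?A then f e else g e) ` ?B = g ` ?B"
      by (intro image_cong) (auto simp: parent_arcs_def)
    ultimately show ?thesis by simp
  qed
  have "map_pmf (\<lambda>f. depths k f (Suc n)) (Pi_pmf (?A \<union> ?B) 0 (\<lambda>(x, p). \<mu> x)) =
    bind_pmf (Pi_pmf ?A 0 (\<lambda>(x, p). \<mu> x)) (\<lambda>f. map_pmf (\<lambda>g. (depths k f n)(Suc n := Suc (Max (depths k f n ` g ` ?B))))
       (Pi_pmf ?B 0 (\<lambda>(x, p). \<mu> x)))"
    by (subst Pi_pmf_union)
      (auto simp: parent_arcs_def[of k "Suc n"] pair_pmf_def map_bind_pmf map_pmf_def[symmetric] pmf.map_comp o_def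
         merge[unfolded parent_arcs_def One_nat_def] simp del: depths.simps)
  then show ?case by (simp only: split dag_pmf.simps Suc.IH bind_map_pmf)
qed simp

lemma depths_eq_longest_path_dist:
  assumes u: "\<And>x p. p \<in> {1..k} \<Longrightarrow> u x p \<in> {0..<1}" and k: "k \<ge> 1"
    and f: "\<And>x p. x \<in> {1..n} \<Longrightarrow> p \<in> {1..k} \<Longrightarrow> f (x, p) = nat \<lfloor>real x * u x p\<rfloor>" and "y \<le> n"
  shows "depths k f n y = longest_path_dist k u y"
  using f \<open>y \<le> n\<close>
proof (induction n arbitrary: y)
  case 0
  then show ?case using longest_path_dist_0[of k u] u by simp
next
  case (Suc n)
  show ?case
  proof (cases "y = Suc n")
    case True
    have "depths k f n (f (Suc n, p)) = longest_path_dist k u (nat \<lfloor>real (Suc n) * u (Suc n) p\<rfloor>)"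
      if "p \<in> {1..k}" for p
    proof -
      have "nat \<lfloor>real (Suc n) * u (Suc n) p\<rfloor> < Suc n"
        using u[OF that, of "Suc n"] by (intro parent_less) auto
      then show ?thesis using Suc.prems(1)[of "Suc n" p] that Suc.IH Suc.prems(1) by simp
    qed
    then have "depths k f n ` f ` parent_arcs k (Suc n) =
        (\<lambda>p. longest_path_dist k u (nat \<lfloor>real (Suc n) * u (Suc n) p\<rfloor>)) ` {1..k}"
      unfolding parent_arcs_def image_image by (force simp: image_iff)
    then show ?thesis using True longest_path_dist_pos[of k u "Suc n"] u k by simp
  next
    case False
    then show ?thesis using Suc.IH[of y] Suc.prems by auto
  qed
qed

text \<open>Up to node \<open>n\<close> there are only finitely many parent assignments.
  Independence gives each of them the same mass under both laws, and the event is a finite disjoint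
  union of measurable sets on which the assignment is constant.\<close>

lemma measure_longest_path_dist:
  fixes N :: "'b measure" and M :: "'a measure" and U :: "nat \<Rightarrow> nat \<Rightarrow> 'a \<Rightarrow> real"
  assumes k: "k \<ge> 1" and N: "prob_space N" and X[measurable]: "X \<in> borel_measurable N"
    and M: "prob_space M"
    and indep: "prob_space.indep_vars M (\<lambda>_. borel) (\<lambda>(x, p). U x p) (UNIV \<times> {1..k})"
    and copies: "\<And>x p. p \<in> {1..k} \<Longrightarrow> distr M borel (U x p) = distr N borel X"
    and U_range: "\<And>x p \<omega>. p \<in> {1..k} \<Longrightarrow> \<omega> \<in> space M \<Longrightarrow> U x p \<omega> \<in> {0..<1}"
    and n: "n \<ge> 1" and loc: "\<And>d d'. (\<And>y. y \<le> n \<Longrightarrow> d y = d' y) \<Longrightarrow> R d \<longleftrightarrow> R d'"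
  shows "measure M {\<omega> \<in> space M. R (longest_path_dist k (\<lambda>x p. U x p \<omega>))} =
         measure (dag_pmf k (parent_pmf N X) n) {d. R d}"
proof -
  interpret M: prob_space M by fact
  define I where "I = {1..n} \<times> {1..k}"
  have I: "finite I" "I \<noteq> {}" using n k by (auto simp: I_def)
  define Z where "Z \<omega> e = (if e \<in> I then nat \<lfloor>real (fst e) * U (fst e) (snd e) \<omega>\<rfloor> else 0)" for \<omega> e
  define FF where "FF = PiE_dflt I (0::nat) (\<lambda>e. {..fst e})"
  have FF: "finite FF" unfolding FF_def using I by auto
  have ZFF: "Z \<omega> \<in> FF" if "\<omega> \<in> space M" for \<omega>
  proof -
    have "nat \<lfloor>real x * U x p \<omega>\<rfloor> < x" if "x \<in> {1..n}" "p \<in> {1..k}" for x p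
      using U_range[OF that(2) \<open>\<omega> \<in> space M\<close>, of x] that(1) by (intro parent_less) auto
    then show ?thesis unfolding FF_def PiE_dflt_def Z_def I_def by (force intro: less_imp_le)
  qed
  have meas[measurable]: "(\<lambda>\<omega>. U x p \<omega>) \<in> borel_measurable M" if "p \<in> {1..k}" for x p
    using indep that unfolding M.indep_vars_def by auto
  have point: "{\<omega> \<in> space M. Z \<omega> = f} \<in> sets M \<and>
      measure M {\<omega> \<in> space M. Z \<omega> = f} = pmf (Pi_pmf I 0 (\<lambda>(x, p). parent_pmf N X x)) f" if f: "f \<in> FF" for f
  proof -
    define B where "B e = {t::real. nat \<lfloor>real (fst e) * t\<rfloor> = f e}" for e
    have B[measurable]: "B e \<in> sets borel" for e unfolding B_def by measurable
    have f0: "f e = 0" if "e \<notin> I" for e using f that by (cases e) (auto simp: FF_def PiE_dflt_def)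
    have eq: "{\<omega> \<in> space M. Z \<omega> = f} = (\<Inter>e\<in>I. (case e of (x, p) \<Rightarrow> U x p) -` B e \<inter> space M)"
      using I(2) f0 by (force simp: Z_def B_def fun_eq_iff)
    have one: "measure M ((case e of (x, p) \<Rightarrow> U x p) -` B e \<inter> space M) = pmf (parent_pmf N X (fst e)) (f e)"
      if e: "e \<in> I" for e
    proof -
      obtain x p where xp: "e = (x, p)" "p \<in> {1..k}" using e by (cases e) (auto simp: I_def)
      have "measure M (U x p -` B e \<inter> space M) = measure (distr M borel (U x p)) (B e)"
        using xp by (subst measure_distr) auto
      also have "\<dots> = measure N (X -` B e \<inter> space N)"
        unfolding copies[OF xp(2)] by (subst measure_distr) auto
      also have "\<dots> = measure (parent_pmf N X x) {f e}"
        unfolding measure_parent_pmf[OF N X] B_def xp by (intro arg_cong2[where f=measure]) auto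
      finally show ?thesis using xp by (simp add: measure_pmf_single)
    qed
    have "measure M {\<omega> \<in> space M. Z \<omega> = f} = (\<Prod>e\<in>I. measure M ((case e of (x, p) \<Rightarrow> U x p) -` B e \<inter> space M))"
      unfolding eq using I by (intro M.indep_varsD[OF indep]) (auto simp: I_def)
    also have "\<dots> = (\<Prod>e\<in>I. pmf (case e of (x, p) \<Rightarrow> parent_pmf N X x) (f e))"
      using one by (intro prod.cong) (auto simp: case_prod_beta)
    also have "\<dots> = pmf (Pi_pmf I 0 (\<lambda>(x, p). parent_pmf N X x)) f"
      using f0 I by (subst pmf_Pi') auto
    moreover have "{\<omega> \<in> space M. Z \<omega> = f} \<in> sets M"
      unfolding eq using I by (intro sets.finite_INT) (auto simp: I_def intro!: measurable_sets[OF meas])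
    ultimately show ?thesis by simp
  qed
  have R: "R (longest_path_dist k (\<lambda>x p. U x p \<omega>)) \<longleftrightarrow> R (depths k (Z \<omega>) n)" if "\<omega> \<in> space M" for \<omega>
    using U_range that k
    by (intro loc depths_eq_longest_path_dist[symmetric]) (auto simp: Z_def I_def)
  let ?F = "{f \<in> FF. R (depths k f n)}" and ?Q = "Pi_pmf I 0 (\<lambda>(x, p). parent_pmf N X x)"
  have "{\<omega> \<in> space M. R (longest_path_dist k (\<lambda>x p. U x p \<omega>))} = (\<Union>f\<in>?F. {\<omega> \<in> space M. Z \<omega> = f})"
    using R ZFF by auto
  then have "measure M {\<omega> \<in> space M. R (longest_path_dist k (\<lambda>x p. U x p \<omega>))} =
      measure M (\<Union>f\<in>?F. {\<omega> \<in> space M. Z \<omega> = f})" by simp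
  also have "\<dots> = (\<Sum>f\<in>?F. measure M {\<omega> \<in> space M. Z \<omega> = f})"
    using FF point by (intro M.finite_measure_finite_Union) (auto simp: disjoint_family_on_def)
  also have "\<dots> = (\<Sum>f\<in>?F. pmf ?Q f)" using point by (intro sum.cong) auto
  also have "\<dots> = measure ?Q ?F" using FF by (subst measure_measure_pmf_finite) auto
  also have "\<dots> = measure ?Q {f. R (depths k f n)}"
  \<comment> \<open>The sets \<open>Z \<omega> = f\<close> with \<open>f \<in> FF\<close> exhaust
    \<open>space M\<close>, so the matching point masses sum to 1 and the product law lives on
    \<open>FF\<close>.\<close>
  proof (rule measure_pmf.finite_measure_eq_AE)
    have "measure ?Q FF = (\<Sum>f\<in>FF. measure M {\<omega> \<in> space M. Z \<omega> = f})"
      using FF point by (subst measure_measure_pmf_finite) auto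
    also have "\<dots> = measure M (\<Union>f\<in>FF. {\<omega> \<in> space M. Z \<omega> = f})"
      using FF point by (intro M.finite_measure_finite_Union[symmetric]) (auto simp: disjoint_family_on_def)
    also have "(\<Union>f\<in>FF. {\<omega> \<in> space M. Z \<omega> = f}) = space M" using ZFF by auto
    finally have "measure ?Q FF = 1" by (simp add: M.prob_space)
    then have "AE f in ?Q. f \<in> FF" by (subst (asm) measure_pmf.prob_eq_1) auto
    then show "AE f in ?Q. f \<in> ?F \<longleftrightarrow> f \<in> {f. R (depths k f n)}" by eventually_elim auto
  qed auto
  also have "\<dots> = measure (dag_pmf k (parent_pmf N X) n) {d. R d}"
    unfolding dag_pmf_eq_map_depths I_def by (simp add: vimage_def)
  finally show ?thesis .
qed

section \<open>The law of \<open>X\<close> and the constant \<open>\<lambda>\<^sub>k\<close>\<close>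

text \<open>The density enters through this linear bound on interval probabilities. It yields the
  atom bound \<open>C / x\<close> for parents, the absence of atoms of \<open>Y\<close>, and a first
  exponential moment of \<open>Y\<close>.\<close>

locale bounded_density_variable = prob_space N for N :: "'b measure" +
  fixes X :: "'b \<Rightarrow> real" and C :: real
  assumes X_measurable [measurable]: "X \<in> borel_measurable N"
    and X_range: "w \<in> space N \<Longrightarrow> X w \<in> {0..<1}"
    and C_pos: "C > 0"
    and prob_interval: "a \<le> b \<Longrightarrow> prob {w \<in> space N. a \<le> X w \<and> X w \<le> b} \<le> C * (b - a)"
begin

abbreviation cdf_X :: "real \<Rightarrow> real" where
  "cdf_X t \<equiv> prob {w \<in> space N. X w \<le> t}"

abbreviation parent :: "nat \<Rightarrow> 'b \<Rightarrow> nat" where "parent x w \<equiv> nat \<lfloor>real x * X w\<rfloor>"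

definition Y :: "'b \<Rightarrow> real" where "Y w = - ln (X w)"

text \<open>This is E[X^\<theta>], whose logarithm is \<Lambda>(-\<theta>); with this sign it is
  finite for all \<theta> at least 0.\<close>

definition mgf :: "real \<Rightarrow> real" where "mgf \<theta> = expectation (\<lambda>w. exp (- \<theta> * Y w))"

lemma Y_measurable [measurable]: "Y \<in> borel_measurable N"
  unfolding Y_def by measurable

lemma Y_nonneg: "w \<in> space N \<Longrightarrow> Y w \<ge> 0"
  using X_range[of w] by (cases "X w = 0") (auto simp: Y_def)

lemma AE_X_pos: "AE w in N. 0 < X w"
proof -
  have "prob {w \<in> space N. 0 \<le> X w \<and> X w \<le> 0} \<le> C * (0 - 0)" by (rule prob_interval) simp
  also have "{w \<in> space N. 0 \<le> X w \<and> X w \<le> 0} = {w \<in> space N. X w = 0}" by auto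
  finally have "prob {w \<in> space N. X w = 0} = 0" by (simp add: measure_le_0_iff)
  then have "AE w in N. X w \<noteq> 0"
    by (subst (asm) prob_eq_0) auto
  then show ?thesis using X_range by (auto simp: less_le)
qed

lemma X_eq_exp: "0 < X w \<Longrightarrow> X w = exp (- Y w)"
  by (simp add: Y_def)

lemma prob_le: "0 \<le> t \<Longrightarrow> cdf_X t \<le> C * t"
proof -
  assume "0 \<le> t"
  moreover have "{w \<in> space N. X w \<le> t} = {w \<in> space N. 0 \<le> X w \<and> X w \<le> t}" using X_range by auto
  ultimately show ?thesis using prob_interval[of 0 t] by simp
qed

text \<open>Dyadic decomposition: where X lies between 2^(-j-1) and 2^(-j), exp(c Y) is at most 2^(c
  (j+1)), while the probability is at most A 2^(-a j). The resulting geometric series has ratio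
  2^(c-a) < 1.\<close>

lemma integrable_exp_of_tail:
  assumes tail: "\<And>t. 0 < t \<Longrightarrow> t \<le> 1 \<Longrightarrow> cdf_X t \<le> A * t powr a"
    and c: "0 \<le> c" "c < a"
  shows "integrable N (\<lambda>w. exp (c * Y w))"
proof (rule integrableI_bounded)
  define r where "r = (2::real) powr (c - a)"
  have r: "0 < r" "r < 1" unfolding r_def using c by (auto simp: powr_less_one)
  have "cdf_X 1 \<le> A" using tail[of 1] by simp
  then have A: "A \<ge> 0" by (rule order_trans[OF measure_nonneg])
  have pt: "ennreal (norm (exp (c * Y w))) \<le>
      (\<Sum>j. ennreal (2 powr (c * (real j + 1))) * indicator {w \<in> space N. X w \<le> 2 powr (- real j)} w)"
    if w: "w \<in> space N" "0 < X w" for w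
  proof -
    define j where "j = nat \<lfloor>Y w / ln 2\<rfloor>"
    have "Y w / ln 2 \<ge> 0" using Y_nonneg[OF w(1)] by simp
    then have j: "real j \<le> Y w / ln 2" "Y w / ln 2 \<le> real j + 1" unfolding j_def by linarith+
    have "X w \<le> 2 powr (- real j)"
      using j(1) by (subst X_eq_exp[OF w(2)]) (simp add: powr_def field_simps)
    moreover have "exp (c * Y w) \<le> 2 powr (c * (real j + 1))"
    proof -
      have "Y w \<le> (real j + 1) * ln 2" using j(2) by (simp add: field_simps)
      then have "c * Y w \<le> c * ((real j + 1) * ln 2)" using c by (intro mult_left_mono)
      then show ?thesis by (simp add: powr_def algebra_simps)
    qed
    ultimately have "ennreal (norm (exp (c * Y w))) \<le>
       ennreal (2 powr (c * (real j + 1))) * indicator {w \<in> space N. X w \<le> 2 powr (- real j)} w"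
      using w(1) by (simp add: ennreal_leI)
    also have "\<dots> = (\<Sum>i\<in>{j}. ennreal (2 powr (c * (real i + 1))) * indicator {w \<in> space N. X w \<le> 2 powr (- real i)} w)"
      by (simp del: sum_mult_indicator)
    also have "\<dots> \<le> (\<Sum>i. ennreal (2 powr (c * (real i + 1))) * indicator {w \<in> space N. X w \<le> 2 powr (- real i)} w)"
      by (intro sum_le_suminf) auto
    finally show ?thesis .
  qed
  have "(\<integral>\<^sup>+ w. ennreal (norm (exp (c * Y w))) \<partial>N) \<le>
     (\<integral>\<^sup>+ w. (\<Sum>j. ennreal (2 powr (c * (real j + 1))) * indicator {w \<in> space N. X w \<le> 2 powr (- real j)} w) \<partial>N)"
    using AE_X_pos pt by (intro nn_integral_mono_AE) auto
  also have "\<dots> = (\<Sum>j. ennreal (2 powr (c * (real j + 1))) * ennreal (cdf_X (2 powr (- real j))))"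
    by (subst nn_integral_suminf) (auto simp: nn_integral_cmult emeasure_eq_measure)
  also have "\<dots> \<le> (\<Sum>j. ennreal (2 powr c * A * r ^ j))"
  proof (intro suminf_le)
    fix j :: nat
    have "2 powr (c * (real j + 1)) * cdf_X (2 powr (- real j)) \<le>
      2 powr (c * (real j + 1)) * (A * (2 powr (- real j)) powr a)"
      by (intro mult_left_mono tail) (auto simp: powr_minus inverse_le_1_iff ge_one_powr_ge_zero)
    also have "\<dots> = 2 powr c * A * r ^ j"
      using r by (simp add: r_def powr_powr powr_realpow[symmetric] algebra_simps powr_add[symmetric])
    finally show "ennreal (2 powr (c * (real j + 1))) * ennreal (cdf_X (2 powr (- real j)))
       \<le> ennreal (2 powr c * A * r ^ j)"
      by (simp add: ennreal_mult'[symmetric] ennreal_leI)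
  qed auto
  also have "\<dots> = ennreal (\<Sum>j. 2 powr c * A * r ^ j)"
    using r A by (intro suminf_ennreal2) (auto intro!: summable_mult summable_geometric)
  also have "\<dots> < \<infinity>" by simp
  finally show "(\<integral>\<^sup>+ w. ennreal (norm (exp (c * Y w))) \<partial>N) < \<infinity>" .
qed simp

lemma integrable_exp_half: "integrable N (\<lambda>w. exp (Y w / 2))"
  using integrable_exp_of_tail[of C 1 "1/2"] prob_le by simp

lemma integrable_Y: "integrable N Y"
proof (rule Bochner_Integration.integrable_bound)
  show "integrable N (\<lambda>w. 2 * exp (Y w / 2))" using integrable_exp_half by simp
  have "\<bar>Y w\<bar> \<le> 2 * exp (Y w / 2)" if "w \<in> space N" for w
    using exp_ge_add_one_self[of "Y w / 2"] Y_nonneg[OF that] by linarith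
  then show "AE w in N. norm (Y w) \<le> norm (2 * exp (Y w / 2))" by auto
qed simp

lemma integrable_Y_squared: "integrable N (\<lambda>w. (Y w)\<^sup>2)"
proof (rule Bochner_Integration.integrable_bound)
  show "integrable N (\<lambda>w. 8 * exp (Y w / 2))" using integrable_exp_half by simp
  have "(Y w)\<^sup>2 \<le> 8 * exp (Y w / 2)" if "w \<in> space N" for w
    using exp_lower_Taylor_quadratic[of "Y w / 2"] Y_nonneg[OF that] by (simp add: power2_eq_square)
  then show "AE w in N. norm ((Y w)\<^sup>2) \<le> norm (8 * exp (Y w / 2))" by auto
qed simp

lemma integrable_exp_neg: "\<theta> \<ge> 0 \<Longrightarrow> integrable N (\<lambda>w. exp (- \<theta> * Y w))"
  by (rule integrable_const_bound[where B=1]) (auto intro!: AE_I2 simp: Y_nonneg)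

lemma mgf_pos: "\<theta> \<ge> 0 \<Longrightarrow> mgf \<theta> > 0"
  unfolding mgf_def using integrable_exp_neg[of \<theta>] by (intro expectation_greater) auto

lemma AE_Y_pos: "AE w in N. Y w > 0"
  using AE_X_pos X_range by (auto simp: Y_def elim!: eventually_mono[rotated] intro: AE_mp)

lemma expectation_Y_pos: "expectation Y > 0"
  using AE_Y_pos integrable_Y by (intro expectation_greater) auto

text \<open>By convexity \<open>exp (c * Y w)\<close> lies below the chord between the exponents 0
  and \<open>Y w / 2\<close>. The bound tends to 1 as c tends to 0, which is what leaves room for a
  contraction at rate \<rho> < 1.\<close>

lemma expectation_exp_small:
  assumes "0 \<le> c" "c \<le> 1/2"
  shows "integrable N (\<lambda>w. exp (c * Y w))"
    "expectation (\<lambda>w. exp (c * Y w)) \<le> 1 + 2 * c * (expectation (\<lambda>w. exp (Y w / 2)) - 1)"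
proof -
  have le: "exp (c * Y w) \<le> 1 + 2 * c * (exp (Y w / 2) - 1)" for w
    using convex_onD[OF exp_convex, of "2 * c" 0 "Y w / 2"] assms by (simp add: algebra_simps)
  have int: "integrable N (\<lambda>w. 1 + 2 * c * (exp (Y w / 2) - 1))"
    using integrable_exp_half by simp
  show *: "integrable N (\<lambda>w. exp (c * Y w))"
    by (rule Bochner_Integration.integrable_bound[OF int]) (use le in \<open>auto intro!: AE_I2 order_trans[OF le]\<close>)
  have "expectation (\<lambda>w. exp (c * Y w)) \<le> expectation (\<lambda>w. 1 + 2 * c * (exp (Y w / 2) - 1))"
    using le by (intro integral_mono * int)
  also have "\<dots> = 1 + 2 * c * (expectation (\<lambda>w. exp (Y w / 2)) - 1)"
    using integrable_exp_half by (simp add: prob_space)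
  finally show "expectation (\<lambda>w. exp (c * Y w)) \<le> 1 + 2 * c * (expectation (\<lambda>w. exp (Y w / 2)) - 1)" .
qed

text \<open>Y is rarely close to 0: \<open>b\<close> is chosen so that the density bound gives
  probability at most \<epsilon> / 3 to \<open>Y w \<le> b\<close>, and then \<open>\<theta>\<close>
  so large that \<open>exp (- \<theta> * b)\<close> is at most \<epsilon> / 3.\<close>

lemma ex_mgf_small:
  assumes "\<epsilon> > 0"
  shows "\<exists>\<theta>>0. mgf \<theta> < \<epsilon>"
proof -
  define b where "b = \<epsilon> / (3 * C)"
  have b: "b > 0" unfolding b_def using assms C_pos by simp
  have small: "prob {w \<in> space N. Y w \<le> b} \<le> \<epsilon> / 3"
  proof -
    have "prob {w \<in> space N. Y w \<le> b} \<le> prob {w \<in> space N. exp (- b) \<le> X w \<and> X w \<le> 1}"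
    proof (rule finite_measure_mono_AE)
      show "AE w in N. w \<in> {w \<in> space N. Y w \<le> b} \<longrightarrow> w \<in> {w \<in> space N. exp (- b) \<le> X w \<and> X w \<le> 1}"
      using AE_X_pos AE_space
      proof eventually_elim
        case (elim w)
        then show ?case using X_eq_exp[of w] X_range[of w] by (auto simp: less_imp_le)
      qed
    qed auto
    also have "\<dots> \<le> C * (1 - exp (- b))" using b by (intro prob_interval) auto
    also have "\<dots> \<le> C * b" using exp_ge_add_one_self[of "- b"] C_pos by (intro mult_left_mono) auto
    also have "\<dots> = \<epsilon> / 3" unfolding b_def using C_pos by simp
    finally show ?thesis .
  qed
  define \<theta> where "\<theta> = max 1 (- ln (\<epsilon> / 3) / b)"
  have \<theta>: "\<theta> > 0" unfolding \<theta>_def by simp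
  have "\<theta> * b \<ge> - ln (\<epsilon> / 3)" using b unfolding \<theta>_def by (simp add: field_simps max_def)
  then have "exp (- \<theta> * b) \<le> exp (ln (\<epsilon> / 3))" by simp
  then have exps: "exp (- \<theta> * b) \<le> \<epsilon> / 3" using assms by simp
  have "mgf \<theta> \<le> expectation (\<lambda>w. indicator {w \<in> space N. Y w \<le> b} w + \<epsilon> / 3)"
    unfolding mgf_def
  proof (intro integral_mono integrable_exp_neg)
    fix w assume w: "w \<in> space N"
    show "exp (- \<theta> * Y w) \<le> indicator {w \<in> space N. Y w \<le> b} w + \<epsilon> / 3"
    proof (cases "Y w \<le> b")
      case True
      have "exp (- \<theta> * Y w) \<le> 1" using \<theta> Y_nonneg[OF w] by simp
      moreover have "indicator {w \<in> space N. Y w \<le> b} w = (1 :: real)" using True w by simp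
      ultimately show ?thesis using assms by linarith
    next
      case False
      then have "exp (- \<theta> * Y w) \<le> exp (- \<theta> * b)" using \<theta> by simp
      then have "exp (- \<theta> * Y w) \<le> \<epsilon> / 3" using exps by (rule order_trans)
      then show ?thesis by (simp add: indicator_def)
    qed
  qed (use \<theta> in \<open>auto intro!: Bochner_Integration.integrable_add integrable_real_indicator simp: less_top[symmetric]\<close>)
  also have "\<dots> = prob {w \<in> space N. Y w \<le> b} + \<epsilon> / 3"
    by (subst Bochner_Integration.integral_add) (auto simp: prob_space less_top[symmetric])
  also have "\<dots> < \<epsilon>" using small assms by simp
  finally show ?thesis using \<theta> by blast
qed

lemma log_mgf_neg: "\<theta> \<ge> 0 \<Longrightarrow> log_mgf N Y (- \<theta>) = ereal (ln (mgf \<theta>))"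
  using integrable_exp_neg[of \<theta>] mgf_pos[of \<theta>]
  unfolding log_mgf_def log_expectation_def
  by (subst (1 2) nn_integral_eq_integral) (auto simp: mgf_def)

text \<open>Jensen's inequality, obtained by integrating the tangent of the exponential at the
  mean.\<close>

lemma log_mgf_ge: "log_mgf N Y l \<ge> ereal (l * expectation Y)"
proof (cases "(\<integral>\<^sup>+ w. ennreal (exp (l * Y w)) \<partial>N) = \<infinity>")
  case False
  then have int: "integrable N (\<lambda>w. exp (l * Y w))"
    by (intro integrableI_bounded) (auto simp: less_top)
  have "exp (l * expectation Y) = expectation (\<lambda>w. exp (l * expectation Y) * (1 + l * (Y w - expectation Y)))"
    using integrable_Y by (simp add: prob_space)
  also have "\<dots> \<le> expectation (\<lambda>w. exp (l * Y w))"
  proof (intro integral_mono int)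
    fix w
    have "exp (l * expectation Y) * (1 + l * (Y w - expectation Y)) \<le>
        exp (l * expectation Y) * exp (l * (Y w - expectation Y))"
      by (intro mult_left_mono exp_ge_add_one_self) auto
    then show "exp (l * expectation Y) * (1 + l * (Y w - expectation Y)) \<le> exp (l * Y w)"
      by (simp add: exp_add[symmetric] algebra_simps)
  qed (use integrable_Y in auto)
  finally have le: "exp (l * expectation Y) \<le> expectation (\<lambda>w. exp (l * Y w))" .
  then have "l * expectation Y \<le> ln (expectation (\<lambda>w. exp (l * Y w)))"
    by (subst ln_ge_iff) (auto intro: less_le_trans[OF exp_gt_zero])
  then show ?thesis
    using False int le unfolding log_mgf_def log_expectation_def
    by (subst (1 2) nn_integral_eq_integral)
       (auto intro: order_trans[OF less_imp_le[OF exp_gt_zero]])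
qed (simp add: log_mgf_def log_expectation_def)

section \<open>Exponential moments below and above \<lambda>_k\<close>

lemma lambda_const_eq:
  "lambda_const N X k = Sup {z. z \<ge> 1 / expectation Y \<and> log_mgf_conjugate N Y (1 / z) \<le> ereal (ln (real k))}"
  unfolding lambda_const_def Let_def Y_def[abs_def] ..

context
  fixes k :: nat
  assumes k: "k \<ge> 2"
begin

definition rate_set :: "real set" where
  "rate_set = {z. z \<ge> 1 / expectation Y \<and> log_mgf_conjugate N Y (1 / z) \<le> ereal (ln (real k))}"

text \<open>The supremum defining the conjugate is tested at -\<theta>.\<close>

lemma rate_set_mgf_ge:
  assumes "z \<in> rate_set" "\<theta> \<ge> 0"
  shows "1 \<le> real k * mgf \<theta> * exp (\<theta> / z)"
proof -
  have "ereal (- \<theta> * (1 / z)) - log_mgf N Y (- \<theta>) \<le> log_mgf_conjugate N Y (1 / z)"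
    unfolding log_mgf_conjugate_def by (intro SUP_upper) auto
  also have "\<dots> \<le> ereal (ln (real k))" using assms unfolding rate_set_def by auto
  finally have "0 \<le> ln (real k) + ln (mgf \<theta>) + \<theta> / z" using assms by (simp add: log_mgf_neg)
  also have "\<dots> = ln (real k * mgf \<theta> * exp (\<theta> / z))"
    using k mgf_pos[OF assms(2)] by (simp add: ln_mult)
  finally show ?thesis using k mgf_pos[OF assms(2)] by (subst (asm) ln_ge_zero_iff) auto
qed

lemma inverse_mean_in_rate_set: "1 / expectation Y \<in> rate_set"
proof -
  have "log_mgf_conjugate N Y (expectation Y) \<le> ereal 0"
    unfolding log_mgf_conjugate_def
  proof (rule SUP_least)
    fix l show "ereal (l * expectation Y) - log_mgf N Y l \<le> ereal 0"
      using log_mgf_ge[of l] by (cases "log_mgf N Y l") auto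
  qed
  also have "\<dots> \<le> ereal (ln (real k))" using k by simp
  finally show ?thesis unfolding rate_set_def by simp
qed

text \<open>For a \<theta> with k E[X^\<theta>] < 1 the necessary condition
  \<open>rate_set_mgf_ge\<close> fails once z is large.\<close>

lemma rate_set_bdd_above: "bdd_above rate_set"
proof -
  obtain \<theta> where \<theta>: "\<theta> > 0" "mgf \<theta> < 1 / real k" using ex_mgf_small[of "1 / real k"] k by auto
  define b where "b = - ln (real k * mgf \<theta>)"
  have "real k * mgf \<theta> < 1" using \<theta>(2) k by (simp add: field_simps)
  then have b: "b > 0" unfolding b_def using mgf_pos[of \<theta>] \<theta> k by simp
  have "z \<le> \<theta> / b" if z: "z \<in> rate_set" for z
  proof -
    have zpos: "z > 0" using z expectation_Y_pos unfolding rate_set_def by (auto intro: less_le_trans[of 0 "1 / expectation Y"])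
    have "1 \<le> real k * mgf \<theta> * exp (\<theta> / z)" using rate_set_mgf_ge[OF z] \<theta> by simp
    then have "0 \<le> ln (real k * mgf \<theta> * exp (\<theta> / z))" by simp
    also have "\<dots> = - b + \<theta> / z" unfolding b_def using k mgf_pos[of \<theta>] \<theta> by (simp add: ln_mult)
    finally show ?thesis using b zpos by (simp add: field_simps)
  qed
  then show ?thesis by (auto simp: bdd_above_def)
qed

lemma lambda_const_ge: "1 / expectation Y \<le> lambda_const N X k"
  unfolding lambda_const_eq rate_set_def[symmetric] by (intro cSup_upper inverse_mean_in_rate_set rate_set_bdd_above)

lemma lambda_const_pos: "lambda_const N X k > 0"
  using lambda_const_ge expectation_Y_pos by (auto intro: less_le_trans[of 0 "1 / expectation Y"])

text \<open>Outside the rate set some \<open>l\<close> makes l / z - \<Lambda>(l) exceed log k. It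
  must be negative: for \<open>l\<close> at least 0, 1 / z being at most E[Y] and Jensen's
  inequality make this difference at most 0. Then \<theta> = -l.\<close>

lemma mgf_above_lambda_const:
  assumes "z > lambda_const N X k"
  obtains \<theta> where "\<theta> > 0" "real k * mgf \<theta> * exp (\<theta> / z) < 1"
proof -
  have z1: "z \<ge> 1 / expectation Y" using assms lambda_const_ge by simp
  have zpos: "z > 0" using assms lambda_const_pos by simp
  have "z \<notin> rate_set" using assms cSup_upper[OF _ rate_set_bdd_above, of z] unfolding lambda_const_eq rate_set_def[symmetric] by auto
  then have "log_mgf_conjugate N Y (1 / z) > ereal (ln (real k))" using z1 unfolding rate_set_def by auto
  then obtain l where l: "ereal (ln (real k)) < ereal (l * (1 / z)) - log_mgf N Y l"
    unfolding log_mgf_conjugate_def less_SUP_iff by auto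
  have "l < 0"
  proof (rule ccontr)
    assume "\<not> l < 0"
    then have "l * (1 / z) \<le> l * expectation Y"
      using z1 zpos expectation_Y_pos by (intro mult_left_mono) (auto simp: field_simps)
    then have "ereal (l * (1 / z)) - log_mgf N Y l \<le> ereal 0"
      using log_mgf_ge[of l] by (cases "log_mgf N Y l") auto
    then have "ereal (ln (real k)) < ereal 0" using l by (rule less_le_trans[rotated])
    then show False using k by simp
  qed
  define \<theta> where "\<theta> = - l"
  have \<theta>: "\<theta> > 0" "l = - \<theta>" using \<open>l < 0\<close> by (auto simp: \<theta>_def)
  have "ln (real k) < - (\<theta> / z) - ln (mgf \<theta>)" using l \<theta> by (simp add: log_mgf_neg)
  then have "ln (real k * mgf \<theta> * exp (\<theta> / z)) < 0"
    using k mgf_pos[of \<theta>] \<theta> by (simp add: ln_mult)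
  then have "real k * mgf \<theta> * exp (\<theta> / z) < 1"
    using k mgf_pos[of \<theta>] \<theta> by (subst (asm) ln_less_zero_iff) auto
  then show ?thesis using that \<theta>(1) by blast
qed

text \<open>The critical point \<open>\<theta>\<close> of the moment generating function of \<open>1 / z - Y\<close> makes the tilted step centred.\<close>
definition critical :: "real \<Rightarrow> real \<Rightarrow> bool" where
  "critical z \<theta> \<longleftrightarrow> 0 < z \<and> 0 \<le> \<theta> \<and>
     expectation (\<lambda>w. (1 / z - Y w) * exp (\<theta> * (1 / z - Y w))) = 0 \<and>
     1 < real k * expectation (\<lambda>w. exp (\<theta> * (1 / z - Y w)))"

text \<open>With a = 1 / z, \<open>G\<close> is the derivative of the convex function
  \<open>M\<close>. It is negative at 0 because z exceeds 1 / E[Y], and positive at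
  \<open>\<theta>1\<close> because M(\<theta>1) > 1 = M(0); so it vanishes in between. The gap
  \<kappa> to a larger element z' of the rate set makes k M strictly larger than 1 at the
  zero.\<close>

lemma critical_tilt:
  assumes "z0 < lambda_const N X k"
  obtains z \<theta> where "z0 < z" "critical z \<theta>"
proof (cases "lambda_const N X k > 1 / expectation Y")
  case False
  then have eq: "lambda_const N X k = 1 / expectation Y" using lambda_const_ge by simp
  show ?thesis
    by (rule that[of "1 / expectation Y" 0])
      (use assms eq expectation_Y_pos integrable_Y k in \<open>auto simp: critical_def prob_space\<close>)
next
  case True
  obtain z where z: "max z0 (1 / expectation Y) < z" "z < lambda_const N X k"
    using dense[of "max z0 (1 / expectation Y)" "lambda_const N X k"] True assms by auto
  obtain z' where z': "z' \<in> rate_set" "z < z'"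
    using z(2) unfolding lambda_const_eq rate_set_def[symmetric] using inverse_mean_in_rate_set by (auto elim!: less_cSupE)
  have zpos: "z > 0" using z expectation_Y_pos by (auto intro: less_trans[of 0 "1 / expectation Y"])
  define a where "a = 1 / z"
  have a: "a > 0" using zpos by (simp add: a_def)
  define M where "M \<theta> = expectation (\<lambda>w. exp (\<theta> * (a - Y w)))" for \<theta>
  define G where "G \<theta> = expectation (\<lambda>w. (a - Y w) * exp (\<theta> * (a - Y w)))" for \<theta>
  define \<kappa> where "\<kappa> = 1 / z - 1 / z'"
  have \<kappa>: "\<kappa> > 0" unfolding \<kappa>_def using z' zpos by (simp add: field_simps)
  have bound: "exp (\<theta> * (a - Y w)) \<le> exp (K * a)" if "\<theta> \<in> {0..K}" "w \<in> space N" for \<theta> w K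
  proof -
    have "\<theta> * (a - Y w) \<le> \<theta> * a" using that Y_nonneg[of w] by (intro mult_left_mono) auto
    also have "\<dots> \<le> K * a" using that a by (intro mult_right_mono) auto
    finally show ?thesis by simp
  qed
  have intM: "integrable N (\<lambda>w. exp (\<theta> * (a - Y w)))" if "\<theta> \<ge> 0" for \<theta>
    using that by (intro integrable_const_bound[where B="exp (\<theta> * a)"]) (auto intro!: AE_I2 mult_left_mono simp: Y_nonneg)
  have int1: "integrable N (\<lambda>w. \<bar>a - Y w\<bar> * c)" for c :: real using integrable_Y by auto
  have intG: "integrable N (\<lambda>w. (a - Y w) * exp (\<theta> * (a - Y w)))" if "\<theta> \<ge> 0" for \<theta>
    using bound[of \<theta> \<theta>] that
    by (intro Bochner_Integration.integrable_bound[OF int1[of "exp (\<theta> * a)"]]) (auto simp: abs_mult Y_nonneg intro!: AE_I2 mult_left_mono)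
  have Mge: "real k * M \<theta> \<ge> exp (\<theta> * \<kappa>)" if "\<theta> \<ge> 0" for \<theta>
  proof -
    have "M \<theta> = expectation (\<lambda>w. exp (\<theta> * a) * exp (- \<theta> * Y w))"
      unfolding M_def by (intro Bochner_Integration.integral_cong) (auto simp: exp_add[symmetric] algebra_simps)
    then have M: "M \<theta> = exp (\<theta> * a) * mgf \<theta>" unfolding mgf_def by simp
    have "exp (\<theta> * \<kappa>) * 1 \<le> exp (\<theta> * \<kappa>) * (real k * mgf \<theta> * exp (\<theta> / z'))"
      using rate_set_mgf_ge[OF z'(1) that] by (intro mult_left_mono) auto
    also have "\<dots> = real k * M \<theta>" unfolding M \<kappa>_def a_def by (simp add: exp_add[symmetric] algebra_simps)
    finally show ?thesis by simp
  qed
  have G0: "G 0 < 0"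
    unfolding G_def using integrable_Y z zpos expectation_Y_pos by (simp add: prob_space a_def field_simps)
  \<comment> \<open>Large enough that exp(\<theta>1 \<kappa>) > k, which forces M(\<theta>1) >
    1.\<close>
  define \<theta>1 where "\<theta>1 = ln (real k) / \<kappa> + 1"
  have \<theta>1: "\<theta>1 > 0" unfolding \<theta>1_def using \<kappa> k by (auto intro!: add_nonneg_pos)
  have "M \<theta>1 > 1"
  proof -
    have "real k = exp (ln (real k))" using k by simp
    also have "\<dots> < exp (\<theta>1 * \<kappa>)" unfolding \<theta>1_def using \<kappa> by (simp add: field_simps)
    also have "\<dots> \<le> real k * M \<theta>1" using Mge \<theta>1 by simp
    finally show ?thesis using k by simp
  qed
  \<comment> \<open>The convexity argument in elementary form: e^t - t e^t is at most 1 for every t,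
    so M(\<theta>1) > 1 forces G(\<theta>1) > 0.\<close>
  have "M \<theta>1 - \<theta>1 * G \<theta>1 = expectation (\<lambda>w. exp (\<theta>1 * (a - Y w)) - \<theta>1 * ((a - Y w) * exp (\<theta>1 * (a - Y w))))"
    unfolding M_def G_def using intM[of \<theta>1] intG[of \<theta>1] \<theta>1 by simp
  also have "\<dots> \<le> expectation (\<lambda>w. 1)"
  proof (intro integral_mono)
    fix w
    define t where "t = \<theta>1 * (a - Y w)"
    have "exp t * (1 + - t) \<le> exp t * exp (- t)" by (intro mult_left_mono exp_ge_add_one_self) auto
    then have "exp t - t * exp t \<le> 1" by (simp add: exp_add[symmetric] algebra_simps)
    then show "exp (\<theta>1 * (a - Y w)) - \<theta>1 * ((a - Y w) * exp (\<theta>1 * (a - Y w))) \<le> 1"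
      unfolding t_def by (simp add: mult.assoc)
  qed (use intM[of \<theta>1] intG[of \<theta>1] \<theta>1 in auto)
  finally have "\<theta>1 * G \<theta>1 > 0" using \<open>M \<theta>1 > 1\<close> by (simp add: prob_space)
  then have G1: "G \<theta>1 > 0" using \<theta>1 by (simp add: zero_less_mult_iff)
  have "continuous_on {0..\<theta>1} G"
    unfolding continuous_on_sequentially
  proof (intro ballI allI impI)
    fix x :: "nat \<Rightarrow> real" and t assume t: "t \<in> {0..\<theta>1}" and x: "(\<forall>n. x n \<in> {0..\<theta>1}) \<and> x \<longlonglongrightarrow> t"
    show "(G \<circ> x) \<longlonglongrightarrow> G t"
      unfolding o_def G_def
    proof (rule integral_dominated_convergence[OF _ _ int1[of "exp (\<theta>1 * a)"]])
      show "AE w in N. (\<lambda>i. (a - Y w) * exp (x i * (a - Y w))) \<longlonglongrightarrow> (a - Y w) * exp (t * (a - Y w))"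
        using x by (intro AE_I2 tendsto_intros) auto
      show "AE w in N. norm ((a - Y w) * exp (x i * (a - Y w))) \<le> \<bar>a - Y w\<bar> * exp (\<theta>1 * a)" for i
        using bound[of "x i" \<theta>1] x by (intro AE_I2) (auto simp: abs_mult intro!: mult_left_mono)
    qed auto
  qed
  then obtain \<theta> where \<theta>: "0 \<le> \<theta>" "\<theta> \<le> \<theta>1" "G \<theta> = 0"
    using IVT'[of G 0 0 \<theta>1] G0 G1 \<theta>1 by auto
  have "\<theta> \<noteq> 0" using \<theta>(3) G0 by auto
  then have "1 < exp (\<theta> * \<kappa>)" using \<theta>(1) \<kappa> by simp
  then have "1 < real k * M \<theta>" using Mge[OF \<theta>(1)] by (rule less_le_trans)
  then show ?thesis using that[of z \<theta>] z zpos \<theta> unfolding critical_def G_def M_def a_def by simp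
qed

end

end

section \<open>A travelling subsolution\<close>

definition parabola :: "real \<Rightarrow> real" where "parabola x = max (x * (1 - x)) 0"

context bounded_density_variable
begin

lemma AE_Y_neq: "AE w in N. Y w \<noteq> a"
proof -
  have "prob {w \<in> space N. exp (- a) \<le> X w \<and> X w \<le> exp (- a)} \<le> C * (exp (- a) - exp (- a))"
    by (rule prob_interval) simp
  also have "{w \<in> space N. exp (- a) \<le> X w \<and> X w \<le> exp (- a)} = {w \<in> space N. X w = exp (- a)}" by auto
  finally have "prob {w \<in> space N. X w = exp (- a)} = 0" by (simp add: measure_le_0_iff)
  then have "AE w in N. X w \<noteq> exp (- a)" by (subst (asm) prob_eq_0) auto
  with AE_X_pos show ?thesis by eventually_elim (use X_eq_exp in auto)
qed

text \<open>
  The boundary layer of the parabola is the delicate part: there the jump of the random walk into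
  the interval contributes order \<open>1 / R\<close>, which beats the curvature loss of order \<open>1 / R\<^sup>2\<close>.
\<close>
lemma bump_subsolution:
  assumes a: "a > 0" and \<theta>: "\<theta> \<ge> 0" and \<kappa>: "\<kappa> \<ge> 1"
    and centred: "expectation (\<lambda>w. (a - Y w) * exp (\<theta> * (a - Y w))) = 0"
    and super: "1 < \<kappa> * expectation (\<lambda>w. exp (\<theta> * (a - Y w)))"
  obtains R s q \<phi> where "R \<ge> 6 * a" "s > 0" "q > 0" "continuous_on UNIV \<phi>"
    "\<And>u. 0 \<le> \<phi> u" "\<And>u. \<phi> u \<le> 1" "\<And>u. u < 0 \<Longrightarrow> \<phi> u = 0" "\<And>u. R < u \<Longrightarrow> \<phi> u = 0"
    "\<And>u. R / 3 \<le> u \<Longrightarrow> u \<le> 2 * R / 3 \<Longrightarrow> q \<le> \<phi> u"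
    "\<And>u. 0 \<le> u \<Longrightarrow> u \<le> R \<Longrightarrow> \<phi> u + s \<le> \<kappa> * expectation (\<lambda>w. \<phi> (u + (a - Y w)))"
proof -
  define \<xi> where "\<xi> w = a - Y w" for w
  define f where "f w = exp (\<theta> * \<xi> w)" for w
  have [measurable]: "\<xi> \<in> borel_measurable N" "f \<in> borel_measurable N" unfolding \<xi>_def f_def by measurable
  have f: "0 < f w" "w \<in> space N \<Longrightarrow> f w \<le> exp (\<theta> * a)" for w
    unfolding f_def \<xi>_def using \<theta> Y_nonneg by (auto intro!: mult_left_mono)
  have intf: "integrable N f"
    using f by (intro integrable_const_bound[where B="exp (\<theta> * a)"]) (auto intro!: AE_I2 simp: less_imp_le)
  have dom: "integrable N (\<lambda>w. g w * f w)" if "integrable N g" for g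
  proof (rule Bochner_Integration.integrable_bound)
    show "integrable N (\<lambda>w. g w * exp (\<theta> * a))" using that by simp
    show "(\<lambda>w. g w * f w) \<in> borel_measurable N" using that by (auto intro!: borel_measurable_times)
    show "AE w in N. norm (g w * f w) \<le> norm (g w * exp (\<theta> * a))"
      using f by (intro AE_I2) (auto simp: abs_mult less_imp_le intro!: mult_left_mono)
  qed
  have int1: "integrable N (\<lambda>w. \<xi> w * f w)" using integrable_Y unfolding \<xi>_def by (intro dom) auto
  have intabs: "integrable N (\<lambda>w. \<bar>\<xi> w\<bar> * f w)" using integrable_Y unfolding \<xi>_def by (intro dom) auto
  have "integrable N (\<lambda>w. (\<xi> w)\<^sup>2)"
    unfolding \<xi>_def power2_diff using integrable_Y integrable_Y_squared by auto
  then have int2: "integrable N (\<lambda>w. (\<xi> w)\<^sup>2 * f w)" by (rule dom)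
  define M where "M = expectation f"
  define V where "V = expectation (\<lambda>w. (\<xi> w)\<^sup>2 * f w)"
  define J where "J = expectation (\<lambda>w. \<bar>\<xi> w\<bar> * f w) / 2"
  have M: "1 < \<kappa> * M" using super unfolding M_def f_def \<xi>_def .
  have V: "V \<ge> 0" unfolding V_def using f by (intro integral_nonneg_AE AE_I2) (auto simp: less_imp_le)
  have E0: "expectation (\<lambda>w. \<xi> w * f w) = 0" using centred unfolding f_def \<xi>_def .
  \<comment> \<open>The centred step is nonzero almost surely because Y has no atom at
    \<open>a\<close>.\<close>
  have J: "J > 0"
  proof -
    have "AE w in N. 0 < \<bar>\<xi> w\<bar> * f w" using AE_Y_neq[of a] f by (auto simp: \<xi>_def)
    then have "0 < expectation (\<lambda>w. \<bar>\<xi> w\<bar> * f w)" using intabs by (intro expectation_greater)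
    then show ?thesis unfolding J_def by simp
  qed
  \<comment> \<open>Where the parabola exceeds c1 / R^2, the surplus \<open>\<kappa> * M - 1\<close>
    pays for the curvature loss \<open>\<kappa> * V / R\<^sup>2\<close> and for the gain 1 /
    R^2.\<close>
  define c1 where "c1 = (\<kappa> * V + 1) / (\<kappa> * M - 1)"
  have c1: "c1 > 0" unfolding c1_def using M V \<kappa> by (intro divide_pos_pos add_nonneg_pos) auto
  \<comment> \<open>\<open>6 * c1\<close> confines the boundary layer to the two outer quarters; the
    last entry lets the jump gain J / (2 R) win there; \<open>6 * a\<close> leaves room for a shift
    by \<open>a\<close> inside the middle third, needed because levels are integers.\<close>
  define R where "R = Max {1, 6 * a, 6 * c1, 2 * (V + c1 + 1) / J}"
  have R: "R \<ge> 1" "R \<ge> 6 * a" "R \<ge> 6 * c1" "R \<ge> 2 * (V + c1 + 1) / J" unfolding R_def by auto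
  have Rpos: "R > 0" using R(1) by simp
  define p where "p x w = f w * parabola (x + \<xi> w / R)" for x w
  have par_le: "parabola x \<le> 1/4" "0 \<le> parabola x" for x
  proof -
    have "x * (1 - x) \<le> 1/4" using zero_le_square[of "x - 1/2"] by (simp add: algebra_simps)
    then show "parabola x \<le> 1/4" "0 \<le> parabola x" unfolding parabola_def by auto
  qed
  have intp: "integrable N (p x)" for x
  proof (rule integrable_const_bound[where B="exp (\<theta> * a) * (1/4)"])
    have "f w * parabola (x + \<xi> w / R) \<le> exp (\<theta> * a) * (1/4)" if "w \<in> space N" for w
      using f(2)[OF that] par_le by (intro mult_mono) auto
    moreover have "0 \<le> f w * parabola (x + \<xi> w / R)" for w
      using f(1)[of w] par_le by (intro mult_nonneg_nonneg) (auto simp: less_imp_le)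
    ultimately show "AE w in N. norm (p x w) \<le> exp (\<theta> * a) * (1/4)"
      by (intro AE_I2) (auto simp: p_def simp del: abs_mult)
    show "p x \<in> borel_measurable N" unfolding p_def[abs_def] parabola_def by measurable
  qed
  have key: "parabola x + 1 / R\<^sup>2 \<le> \<kappa> * expectation (p x)" if x: "0 \<le> x" "x \<le> 1" for x
  proof -
    have px: "parabola x = x * (1 - x)" unfolding parabola_def using x by (intro max_absorb1 mult_nonneg_nonneg) auto
    have shift: "(x + d) * (1 - (x + d)) = x * (1 - x) + (1 - 2 * x) * d - d\<^sup>2" for d
      by (simp add: algebra_simps power2_eq_square)
    show ?thesis
    proof (cases "parabola x \<ge> c1 / R\<^sup>2")
      case True
      have "expectation (\<lambda>w. f w * parabola x + (1 - 2 * x) / R * (\<xi> w * f w) - 1 / R\<^sup>2 * ((\<xi> w)\<^sup>2 * f w))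
        \<le> expectation (p x)"
      proof (intro integral_mono intp)
        fix w
        have "f w * (x * (1 - x) + (1 - 2 * x) * (\<xi> w / R) - (\<xi> w / R)\<^sup>2) \<le> p x w"
          unfolding p_def shift[symmetric] using f(1)[of w] by (intro mult_left_mono) (auto simp: parabola_def)
        then show "f w * parabola x + (1 - 2 * x) / R * (\<xi> w * f w) - 1 / R\<^sup>2 * ((\<xi> w)\<^sup>2 * f w) \<le> p x w"
          unfolding px by (simp add: algebra_simps power_divide add_divide_distrib diff_divide_distrib)
      qed (use int1 int2 intf in auto)
      also have "expectation (\<lambda>w. f w * parabola x + (1 - 2 * x) / R * (\<xi> w * f w) - 1 / R\<^sup>2 * ((\<xi> w)\<^sup>2 * f w))
         = M * parabola x - V / R\<^sup>2"
        using int1 int2 intf E0 unfolding M_def V_def by simp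
      finally have "\<kappa> * (M * parabola x - V / R\<^sup>2) \<le> \<kappa> * expectation (p x)"
        using \<kappa> by (intro mult_left_mono) auto
      moreover have "(\<kappa> * M - 1) * parabola x \<ge> (\<kappa> * V + 1) / R\<^sup>2"
      proof -
        have "(\<kappa> * V + 1) / R\<^sup>2 = (\<kappa> * M - 1) * (c1 / R\<^sup>2)" unfolding c1_def using M by simp
        then show ?thesis using True M by (simp only: mult_left_mono less_imp_le diff_gt_0_iff_gt)
      qed
      ultimately show ?thesis by (simp add: algebra_simps add_divide_distrib)
    next
      case False
      have "c1 / R\<^sup>2 \<le> 1/6"
      proof -
        have "6 * c1 \<le> R * 1" using R by simp
        also have "\<dots> \<le> R * R" using R by (intro mult_left_mono) auto
        finally show ?thesis using Rpos by (simp add: field_simps power2_eq_square)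
      qed
      then have small: "x * (1 - x) < 1/6" using False px by linarith
      have side: "x \<le> 1/4 \<or> x \<ge> 3/4"
      proof (rule ccontr)
        assume "\<not> ?thesis"
        then have "0 \<le> (x - 1/4) * (3/4 - x)" by (intro mult_nonneg_nonneg) auto
        also have "(x - 1/4) * (3/4 - x) = x * (1 - x) - 3/16" by (simp add: field_simps)
        finally show False using small by linarith
      qed
      \<comment> \<open>The sign of a displacement pointing into the interval from the nearer
        end.\<close>
      define \<sigma> :: real where "\<sigma> = (if x \<le> 1/4 then 1 else -1)"
      have sg: "\<sigma> * (1 - 2 * x) \<ge> 1/2" "\<bar>\<sigma>\<bar> = 1" using side unfolding \<sigma>_def by auto
      have "expectation (\<lambda>w. 1 / (4 * R) * (\<bar>\<xi> w\<bar> * f w) + \<sigma> / (4 * R) * (\<xi> w * f w) - 1 / R\<^sup>2 * ((\<xi> w)\<^sup>2 * f w))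
        \<le> expectation (p x)"
      proof (intro integral_mono intp)
        fix w
        define d where "d = \<xi> w / R"
        \<comment> \<open>The first term is half the inward part of the displacement. In expectation
          the linear term cancels by centring and the modulus leaves J / (2 R).\<close>
        have "(\<bar>d\<bar> + \<sigma> * d) / 4 - d\<^sup>2 \<le> parabola (x + d)"
        proof (cases "\<sigma> * d > 0")
          case True
          then have ad: "\<bar>d\<bar> = \<sigma> * d" using sg(2) by (cases "d \<ge> 0") (auto simp: \<sigma>_def split: if_splits)
          have "(1/2) * (\<sigma> * d) \<le> (\<sigma> * (1 - 2 * x)) * (\<sigma> * d)" using sg True by (intro mult_right_mono) auto
          also have "\<dots> = (1 - 2 * x) * d" using sg(2) unfolding \<sigma>_def by auto
          finally have "(1/2) * (\<sigma> * d) \<le> (1 - 2 * x) * d" .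
          moreover have "0 \<le> x * (1 - x)" using x by simp
          ultimately have "(\<sigma> * d) / 2 - d\<^sup>2 \<le> (x + d) * (1 - (x + d))"
            unfolding shift by linarith
          moreover have "(\<bar>d\<bar> + \<sigma> * d) / 4 = (\<sigma> * d) / 2" unfolding ad by simp
          ultimately show ?thesis unfolding parabola_def by (simp only: le_max_iff_disj simp_thms)
        next
          case False
          then have "\<bar>d\<bar> = - (\<sigma> * d)" using sg(2) by (cases "d \<ge> 0") (auto simp: \<sigma>_def split: if_splits)
          then have "(\<bar>d\<bar> + \<sigma> * d) / 4 = 0" by simp
          moreover have "- (d\<^sup>2) \<le> parabola (x + d)"
            using par_le(2)[of "x + d"] by (rule order_trans[rotated]) simp
          ultimately show ?thesis by simp
        qed
        then have "f w * ((\<bar>d\<bar> + \<sigma> * d) / 4 - d\<^sup>2) \<le> p x w"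
          unfolding p_def d_def using f(1)[of w] by (intro mult_left_mono) auto
        then show "1 / (4 * R) * (\<bar>\<xi> w\<bar> * f w) + \<sigma> / (4 * R) * (\<xi> w * f w) - 1 / R\<^sup>2 * ((\<xi> w)\<^sup>2 * f w) \<le> p x w"
          unfolding d_def using Rpos by (simp add: algebra_simps power_divide add_divide_distrib diff_divide_distrib)
      qed (use int1 int2 intabs in auto)
      also have "expectation (\<lambda>w. 1 / (4 * R) * (\<bar>\<xi> w\<bar> * f w) + \<sigma> / (4 * R) * (\<xi> w * f w) - 1 / R\<^sup>2 * ((\<xi> w)\<^sup>2 * f w))
         = J / (2 * R) - V / R\<^sup>2"
        using int1 int2 intabs E0 unfolding J_def V_def by simp
      finally have le: "J / (2 * R) - V / R\<^sup>2 \<le> expectation (p x)" .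
      have "2 * (V + c1 + 1) \<le> R * J" using R(4) J by (simp add: field_simps)
      then have "(V + c1 + 1) / R\<^sup>2 \<le> (R * J / 2) / R\<^sup>2" by (intro divide_right_mono) auto
      also have "\<dots> = J / (2 * R)" using Rpos by (simp add: power2_eq_square)
      finally have "(c1 + 1) / R\<^sup>2 \<le> J / (2 * R) - V / R\<^sup>2" by (simp add: add_divide_distrib)
      with le have 1: "(c1 + 1) / R\<^sup>2 \<le> expectation (p x)" by simp
      have "parabola x + 1 / R\<^sup>2 \<le> (c1 + 1) / R\<^sup>2" using False by (simp add: add_divide_distrib)
      also have "\<dots> \<le> expectation (p x)" by (rule 1)
      also have "1 * expectation (p x) \<le> \<kappa> * expectation (p x)"
        using \<kappa> 1 c1 by (intro mult_right_mono) (auto intro: order_trans[rotated])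
      finally show ?thesis by simp
    qed
  qed
  \<comment> \<open>The exponential factor undoes the tilt, turning the estimate for
    \<open>p\<close> into one for the plain expectation; normalising it at \<open>R\<close> keeps
    \<open>\<phi>\<close> at most 1.\<close>
  define \<phi> where "\<phi> u = exp (\<theta> * (u - R)) * parabola (u / R)" for u
  show ?thesis
  proof (rule that[of R "exp (- \<theta> * R) / R\<^sup>2" "exp (- \<theta> * R) * (2/9)" \<phi>])
    show "continuous_on UNIV \<phi>" unfolding \<phi>_def parabola_def by (intro continuous_intros) (use Rpos in auto)
    show "0 \<le> \<phi> u" for u unfolding \<phi>_def using par_le by auto
    show z1: "u < 0 \<Longrightarrow> \<phi> u = 0" for u
      unfolding \<phi>_def parabola_def using Rpos by (auto simp: max_def divide_le_0_iff zero_le_mult_iff mult_le_0_iff field_simps)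
    show z2: "R < u \<Longrightarrow> \<phi> u = 0" for u
      unfolding \<phi>_def parabola_def using Rpos by (auto simp: max_def divide_le_0_iff zero_le_mult_iff mult_le_0_iff field_simps)
    show "\<phi> u \<le> 1" for u
    proof (cases "u \<le> R")
      case True
      then have "exp (\<theta> * (u - R)) \<le> 1" using \<theta> by (simp add: mult_nonneg_nonpos)
      then have "\<phi> u \<le> 1 * (1/4)" unfolding \<phi>_def using par_le by (intro mult_mono) auto
      then show ?thesis by simp
    qed (use z2 in auto)
    show "exp (- \<theta> * R) * (2/9) \<le> \<phi> u" if "R / 3 \<le> u" "u \<le> 2 * R / 3" for u
    proof -
      have x: "1/3 \<le> u / R" "u / R \<le> 2/3" using that Rpos by (auto simp: field_simps)
      have "0 \<le> (u / R - 1/3) * (2/3 - u / R)" using x by (intro mult_nonneg_nonneg) auto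
      also have "\<And>v::real. (v - 1/3) * (2/3 - v) = v * (1 - v) - 2/9" by (simp add: field_simps)
      finally have "2/9 \<le> parabola (u / R)" unfolding parabola_def by (intro order_trans[OF _ max.cobounded1]) linarith
      moreover have "0 \<le> \<theta> * u" using \<theta> that Rpos by (intro mult_nonneg_nonneg) auto
      then have "exp (- \<theta> * R) \<le> exp (\<theta> * (u - R))" by (simp add: algebra_simps)
      ultimately show ?thesis unfolding \<phi>_def by (intro mult_mono) auto
    qed
    show "\<phi> u + exp (- \<theta> * R) / R\<^sup>2 \<le> \<kappa> * expectation (\<lambda>w. \<phi> (u + (a - Y w)))" if u: "0 \<le> u" "u \<le> R" for u
    proof -
      have "exp (\<theta> * (u - R)) * (parabola (u / R) + 1 / R\<^sup>2) \<le> exp (\<theta> * (u - R)) * (\<kappa> * expectation (p (u / R)))"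
        using u Rpos by (intro mult_left_mono key) auto
      also have "\<dots> = \<kappa> * expectation (\<lambda>w. exp (\<theta> * (u - R)) * p (u / R) w)" by simp
      also have "(\<lambda>w. exp (\<theta> * (u - R)) * p (u / R) w) = (\<lambda>w. \<phi> (u + (a - Y w)))"
      proof
        fix w
        have "exp (\<theta> * (u - R)) * exp (\<theta> * (a - Y w)) = exp (\<theta> * (u + (a - Y w) - R))"
          by (simp add: exp_add[symmetric] algebra_simps)
        then show "exp (\<theta> * (u - R)) * p (u / R) w = \<phi> (u + (a - Y w))"
          unfolding p_def \<phi>_def f_def \<xi>_def mult.assoc[symmetric] by (simp only: add_divide_distrib)
      qed
      finally have le: "exp (\<theta> * (u - R)) * (parabola (u / R) + 1 / R\<^sup>2) \<le> \<kappa> * expectation (\<lambda>w. \<phi> (u + (a - Y w)))" .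
      have "0 \<le> \<theta> * u" using \<theta> u by simp
      then have "exp (- \<theta> * R) \<le> exp (\<theta> * (u - R))" by (simp add: algebra_simps)
      then have "exp (- \<theta> * R) * (1 / R\<^sup>2) \<le> exp (\<theta> * (u - R)) * (1 / R\<^sup>2)" by (intro mult_right_mono) auto
      with le show ?thesis unfolding \<phi>_def by (simp add: distrib_left)
    qed
  qed (use R Rpos in auto)
qed

end

section \<open>The recursion for the lower tail\<close>

text \<open>The tangent slope \<open>k\<close> at v = 0 may be lowered to any c < k on a short
  interval: with s = k v, the power is at most exp(-s), hence at most 1 - s + s^2, and
  \<open>q\<close> is the range in which s^2 is at most (k - c) v.\<close>

lemma one_minus_power_le:
  fixes c :: real
  assumes "c < real k" "c \<ge> 0"
  obtains q where "0 < q" "q \<le> 1" "\<And>v. 0 \<le> v \<Longrightarrow> v \<le> q \<Longrightarrow> (1 - v) ^ k \<le> 1 - c * v"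
proof -
  have k: "real k > 0" using assms by simp
  define q where "q = min 1 ((real k - c) / (real k)\<^sup>2)"
  have q: "0 < q" "q \<le> 1" "q \<le> (real k - c) / (real k)\<^sup>2"
    unfolding q_def using assms k by auto
  have "(1 - v) ^ k \<le> 1 - c * v" if v: "0 \<le> v" "v \<le> q" for v
  proof -
    define s where "s = real k * v"
    have s: "s \<ge> 0" unfolding s_def using v by simp
    have "(1 - v) ^ k \<le> exp (- v) ^ k"
      using exp_ge_add_one_self[of "- v"] v q by (intro power_mono) auto
    also have "\<dots> = 1 / exp s" by (simp add: s_def exp_of_nat_mult exp_minus power_inverse inverse_eq_divide[symmetric])
    also have "\<dots> \<le> 1 / (1 + s)"
      using exp_ge_add_one_self[of s] s by (intro divide_left_mono mult_pos_pos) auto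
    also have "\<dots> \<le> 1 - s + s\<^sup>2"
    proof -
      have "(1 - s + s\<^sup>2) * (1 + s) = 1 + s ^ 3" by (simp add: algebra_simps power2_eq_square power3_eq_cube)
      then have "1 \<le> (1 - s + s\<^sup>2) * (1 + s)" using s by simp
      then show ?thesis using s by (simp add: pos_divide_le_eq)
    qed
    also have "\<dots> \<le> 1 - c * v"
    proof -
      have "v * (real k)\<^sup>2 \<le> q * (real k)\<^sup>2" using v by (intro mult_right_mono) auto
      also have "\<dots> \<le> real k - c" using q(3) k by (simp add: field_simps)
      finally have "v * (v * (real k)\<^sup>2) \<le> v * (real k - c)" using v by (intro mult_left_mono) auto
      then show ?thesis by (simp add: algebra_simps power2_eq_square s_def)
    qed
    finally show ?thesis .
  qed
  with q show ?thesis using that by blast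
qed

lemma two_powr_le: "0 \<le> c \<Longrightarrow> c \<le> 1 \<Longrightarrow> 2 powr c \<le> 1 + (c::real)"
  using convex_onD[OF exp_convex, of c 0 "ln 2"] by (simp add: powr_def algebra_simps)

lemma power_nat_ceiling_le:
  assumes "0 < r" "r < (1::real)" "0 \<le> t"
  shows "r ^ nat \<lceil>t\<rceil> \<le> r powr t"
proof -
  have "r ^ nat \<lceil>t\<rceil> = r powr real (nat \<lceil>t\<rceil>)" using assms(1) by (rule powr_realpow[symmetric])
  also have "\<dots> \<le> r powr t" using assms by (intro powr_mono') (auto intro: real_nat_ceiling_ge)
  finally show ?thesis .
qed

text \<open>
  \<open>W h x\<close> stands for the probability that a fresh parent of \<open>x\<close> has distance below \<open>h\<close>.
\<close>
definition depth_recursion :: "nat \<Rightarrow> (nat \<Rightarrow> nat pmf) \<Rightarrow> nat \<Rightarrow> real \<Rightarrow> real \<Rightarrow> (nat \<Rightarrow> nat \<Rightarrow> real) \<Rightarrow> bool" where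
  "depth_recursion k \<mu> n \<eta> \<kappa> W \<longleftrightarrow>
     (\<forall>h x. 0 \<le> W h x \<and> W h x \<le> 1) \<and> mono W \<and> (\<forall>x. W 0 x = 0) \<and>
     (\<forall>h<n. \<forall>x\<in>{1..n}. W (Suc h) x \<le> (1 + \<eta>) * depth_mean k \<mu> (W h) x + \<kappa> / real x)"

context bounded_density_variable
begin

section \<open>The law of a parent, compared with x X before rounding\<close>

abbreviation (input) \<mu> :: "nat \<Rightarrow> nat pmf" where "\<mu> \<equiv> parent_pmf N X"

lemma measure_parent: "measure (\<mu> x) A = prob {w \<in> space N. parent x w \<in> A}"
  by (rule measure_parent_pmf) (auto intro: prob_space_axioms)

lemma pmf_parent: "pmf (\<mu> x) y = prob {w \<in> space N. parent x w \<in> {y}}"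
  by (simp only: measure_pmf_single[symmetric] measure_parent)

lemma parent_lt: "x \<ge> 1 \<Longrightarrow> w \<in> space N \<Longrightarrow> parent x w < x"
  using X_range[of w] by (intro parent_less) auto

lemma set_parent_pmf: "x \<ge> 1 \<Longrightarrow> set_pmf (\<mu> x) \<subseteq> {..<x}"
proof
  fix y assume x: "x \<ge> 1" and y: "y \<in> set_pmf (\<mu> x)"
  show "y \<in> {..<x}"
  proof (rule ccontr)
    assume "y \<notin> {..<x}"
    then have "{w \<in> space N. parent x w \<in> {y}} = {}" using parent_lt[OF x] by auto
    then have "pmf (\<mu> x) y = 0" by (simp only: pmf_parent measure_empty)
    then show False using y by (simp add: set_pmf_iff)
  qed
qed

lemma pmf_parent_le: "x \<ge> 1 \<Longrightarrow> pmf (\<mu> x) y \<le> C / real x"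
proof -
  assume x: "x \<ge> 1"
  have "pmf (\<mu> x) y = prob {w \<in> space N. parent x w \<in> {y}}"
    by (rule pmf_parent)
  also have "\<dots> \<le> prob {w \<in> space N. real y / real x \<le> X w \<and> X w \<le> (real y + 1) / real x}"
  proof (rule finite_measure_mono)
    show "{w \<in> space N. parent x w \<in> {y}} \<subseteq> {w \<in> space N. real y / real x \<le> X w \<and> X w \<le> (real y + 1) / real x}"
    proof safe
      fix w assume w: "w \<in> space N" and y: "y = parent x w"
      have "0 \<le> real x * X w" using X_range[OF w] by simp
      then have "real y \<le> real x * X w" "real x * X w \<le> real y + 1" unfolding y by linarith+
      then show "real (parent x w) / real x \<le> X w" "X w \<le> (real (parent x w) + 1) / real x"
        using x unfolding y by (auto simp: field_simps)
    qed
  qed simp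
  also have "\<dots> \<le> C * ((real y + 1) / real x - real y / real x)"
    by (rule prob_interval) (simp add: divide_right_mono)
  also have "\<dots> = C / real x" by (simp add: diff_divide_distrib[symmetric])
  finally show ?thesis .
qed

lemma sum_pmf_parent:
  assumes "finite A"
  shows "(\<Sum>y\<in>A. pmf (\<mu> x) y * g y) =
    expectation (\<lambda>w. of_bool (parent x w \<in> A) * g (parent x w))"
    "integrable N (\<lambda>w. of_bool (parent x w \<in> A) * g (parent x w) :: real)"
proof -
  let ?E = "\<lambda>y. {w \<in> space N. parent x w \<in> {y}}"
  have eq: "of_bool (parent x w \<in> A) * g (parent x w) = (\<Sum>y\<in>A. indicator (?E y) w * g y)"
    if "w \<in> space N" for w
    using assms that by (auto simp: indicator_def of_bool_def if_distrib[of "\<lambda>t. t * _"] cong: if_cong)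
  have int: "integrable N (\<lambda>w. indicator (?E y) w * g y)" for y
    by (intro integrable_mult_left integrable_real_indicator) (auto simp: less_top[symmetric])
  show "integrable N (\<lambda>w. of_bool (parent x w \<in> A) * g (parent x w))"
    using int by (subst Bochner_Integration.integrable_cong[OF refl eq]) auto
  have "expectation (\<lambda>w. of_bool (parent x w \<in> A) * g (parent x w)) =
     (\<Sum>y\<in>A. expectation (\<lambda>w. indicator (?E y) w * g y))"
    using int by (subst Bochner_Integration.integral_cong[OF refl eq]) auto
  also have "\<dots> = (\<Sum>y\<in>A. pmf (\<mu> x) y * g y)"
    by (intro sum.cong refl) (simp add: pmf_parent)
  finally show "(\<Sum>y\<in>A. pmf (\<mu> x) y * g y) =
    expectation (\<lambda>w. of_bool (parent x w \<in> A) * g (parent x w))" by simp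
qed

lemma sum_pmf_parent_le_1: "finite A \<Longrightarrow> (\<Sum>y\<in>A. pmf (\<mu> x) y) \<le> 1"
  by (subst measure_measure_pmf_finite[symmetric]) auto

lemma parent_bounds:
  assumes "w \<in> space N"
  shows "real (parent x w) \<le> real x * X w" "real x * X w < real (parent x w) + 1"
proof -
  have "0 \<le> real x * X w" using X_range[OF assms] by simp
  then show "real (parent x w) \<le> real x * X w" "real x * X w < real (parent x w) + 1" by linarith+
qed

text \<open>\<open>q0 * \<phi>\<close> moving at speed \<open>a\<close> in log x is a subsolution
  for \<open>1 - W\<close>: the k-th power is linearised with slope \<open>k'\<close>, and the gain
  \<open>s\<close> of the bump pays for the rounding of parents, the factor
  \<open>1 + \<eta>\<close> and the term \<open>\<kappa> / x\<close>. The bump vanishes for negative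
  arguments, so only nodes above \<open>m0\<close> matter, where rounding shifts log x by at most 1
  / m0; \<open>osc\<close> measures its effect.\<close>

lemma wave_lower_bound:
  assumes rec: "depth_recursion k \<mu> n \<eta> \<kappa> W" and \<eta>: "\<eta> \<ge> 0" and \<kappa>: "\<kappa> \<ge> 0" and a: "a > 0" and m0: "m0 \<ge> 1"
    and \<phi>: "\<And>u. 0 \<le> \<phi> u" "\<And>u. \<phi> u \<le> 1" "\<And>u. u < 0 \<Longrightarrow> \<phi> u = 0" "\<And>u. R < u \<Longrightarrow> \<phi> u = 0"
    and \<phi>_meas: "\<phi> \<in> borel_measurable borel"
    and sub: "\<And>u. 0 \<le> u \<Longrightarrow> u \<le> R \<Longrightarrow> \<phi> u + s \<le> k' * expectation (\<lambda>w. \<phi> (u + (a - Y w)))"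
    and q0: "0 < q0" "q0 \<le> 1" "\<And>v. 0 \<le> v \<Longrightarrow> v \<le> q0 \<Longrightarrow> (1 - v) ^ k \<le> 1 - k' * v"
    and k': "k' \<ge> 0"
    and osc: "\<And>v t. 0 \<le> v \<Longrightarrow> v \<le> R \<Longrightarrow> 0 \<le> t \<Longrightarrow> t \<le> 1 / real m0 \<Longrightarrow> \<phi> v - \<epsilon> \<le> \<phi> (v - t)" and \<epsilon>: "\<epsilon> \<ge> 0"
    and small: "k' * q0 * \<epsilon> + \<eta> + \<kappa> / real m0 \<le> q0 * s"
  shows "h \<le> n \<Longrightarrow> x \<in> {1..n} \<Longrightarrow> W h x \<le> 1 - q0 * \<phi> (ln (real x) - ln (real m0) - a * real h)"
proof (induction h arbitrary: x)
  case 0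
  have "q0 * \<phi> (ln (real x) - ln (real m0) - a * real 0) \<le> 1 * 1" using q0 \<phi> by (intro mult_mono) auto
  moreover have "W 0 x = 0" using rec unfolding depth_recursion_def by simp
  ultimately show ?case by simp
next
  case (Suc h)
  define u where "u = ln (real x) - ln (real m0) - a * real (Suc h)"
  have W01: "0 \<le> W h y" "W h y \<le> 1" for h y using rec unfolding depth_recursion_def by auto
  show ?case
  proof (cases "0 \<le> u \<and> u \<le> R")
    case False
    then have "\<phi> u = 0" using \<phi>(3,4) by force
    then show ?thesis using W01[of "Suc h" x] unfolding u_def[symmetric] by simp
  next
    case True
    have x: "x \<ge> 1" "x \<le> n" using Suc.prems by auto
    have "0 \<le> a * real (Suc h)" using a by simp
    then have "ln (real m0) \<le> ln (real x)" using True unfolding u_def by linarith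
    then have m0x: "m0 \<le> x" using m0 x by simp
    define v where "v y = ln (real y) - ln (real m0) - a * real h" for y :: nat
    have pow: "W h y ^ k \<le> 1 - k' * (q0 * \<phi> (v y))" if "y \<in> {1..<x}" for y
    proof -
      have "W h y \<le> 1 - q0 * \<phi> (v y)" unfolding v_def using Suc.prems that x by (intro Suc.IH) auto
      then have "W h y ^ k \<le> (1 - q0 * \<phi> (v y)) ^ k" using W01 by (intro power_mono) auto
      also have "\<dots> \<le> 1 - k' * (q0 * \<phi> (v y))" using q0 \<phi> by (intro q0(3)) (auto intro: mult_left_le)
      finally show ?thesis .
    qed
    have E_le: "expectation (\<lambda>w. \<phi> (u + (a - Y w))) - \<epsilon> \<le> (\<Sum>y\<in>{1..<x}. pmf (\<mu> x) y * \<phi> (v y))"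
    proof -
      have int: "integrable N (\<lambda>w. \<phi> (u + (a - Y w)))"
        using \<phi> \<phi>_meas by (intro integrable_const_bound[where B=1]) (auto intro!: AE_I2)
      have "expectation (\<lambda>w. \<phi> (u + (a - Y w)) - \<epsilon>) \<le>
        expectation (\<lambda>w. of_bool (parent x w \<in> {1..<x}) * \<phi> (v (parent x w)))"
      proof (rule integral_mono_AE)
        show "AE w in N. \<phi> (u + (a - Y w)) - \<epsilon> \<le>
           of_bool (parent x w \<in> {1..<x}) * \<phi> (v (parent x w))"
        using AE_X_pos AE_space
        proof eventually_elim
          case (elim w)
          define t where "t = u + (a - Y w)"
          define y where "y = parent x w"
          have t: "t = ln (real x * X w) - ln (real m0) - a * real h"
            unfolding t_def u_def Y_def using elim x by (simp add: ln_mult algebra_simps)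
          show ?case
          proof (cases "0 \<le> t \<and> t \<le> R")
            case False
            then have "\<phi> t = 0" using \<phi>(3,4) by force
            then show ?thesis using \<phi>(1)[of "v y"] \<epsilon> unfolding t_def[symmetric] y_def[symmetric] by auto
          next
            case True
            have "0 \<le> a * real h" using a by simp
            then have "ln (real m0) \<le> ln (real x * X w)" using True unfolding t by linarith
            then have "real m0 \<le> real x * X w" using m0 x elim by (subst (asm) ln_le_cancel_iff) auto
            then have ym: "m0 \<le> y" unfolding y_def by (simp add: le_nat_floor)
            have yb: "real y \<le> real x * X w" "real x * X w < real y + 1"
              unfolding y_def using parent_bounds[OF elim(2)] by auto
            have yx: "y < x" unfolding y_def using parent_lt[OF x(1) elim(2)] .
            \<comment> \<open>The loss in logarithmic position caused by rounding x X down to the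
              node \<open>y\<close>.\<close>
            define \<tau> where "\<tau> = ln (real x * X w) - ln (real y)"
            have "\<tau> \<ge> 0" unfolding \<tau>_def using yb ym m0 by simp
            moreover have "\<tau> \<le> 1 / real m0"
            proof -
              have "ln (real x * X w) \<le> ln (real y * (1 + 1 / real y))"
              proof -
                have "real y * (1 + 1 / real y) = real y + 1" using ym m0 by (simp add: field_simps)
                then show ?thesis using yb ym m0 x elim by (subst ln_le_cancel_iff) auto
              qed
              also have "\<dots> = ln (real y) + ln (1 + 1 / real y)"
              proof -
                have "1 + 1 / real y > 0" by (intro add_pos_nonneg) auto
                then show ?thesis using ym m0 by (subst ln_mult) auto
              qed
              also have "ln (1 + 1 / real y) \<le> 1 / real y" by (rule ln_add_one_self_le_self) simp
              also have "1 / real y \<le> 1 / real m0" using ym m0 by (simp add: field_simps)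
              finally show ?thesis unfolding \<tau>_def by simp
            qed
            ultimately have "\<phi> t - \<epsilon> \<le> \<phi> (t - \<tau>)" using True by (intro osc) auto
            also have "t - \<tau> = v y" unfolding t \<tau>_def v_def by simp
            finally show ?thesis unfolding t_def[symmetric] y_def[symmetric] using ym m0 yx by simp
          qed
        qed
      qed (use int sum_pmf_parent(2)[of "{1..<x}"] in auto)
      then show ?thesis using int by (simp add: sum_pmf_parent(1) prob_space)
    qed
    have "depth_mean k \<mu> (W h) x \<le> pmf (\<mu> x) 0 + (\<Sum>y\<in>{1..<x}. pmf (\<mu> x) y * (1 - k' * (q0 * \<phi> (v y))))"
      unfolding depth_mean_def by (intro add_left_mono sum_mono mult_left_mono pow) auto
    also have "\<dots> = (pmf (\<mu> x) 0 + (\<Sum>y\<in>{1..<x}. pmf (\<mu> x) y)) - k' * q0 * (\<Sum>y\<in>{1..<x}. pmf (\<mu> x) y * \<phi> (v y))"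
      by (simp add: right_diff_distrib sum_subtractf sum_distrib_left mult_ac)
    also have "pmf (\<mu> x) 0 + (\<Sum>y\<in>{1..<x}. pmf (\<mu> x) y) = (\<Sum>y\<in>insert 0 {1..<x}. pmf (\<mu> x) y)" by simp
    also have "\<dots> - k' * q0 * (\<Sum>y\<in>{1..<x}. pmf (\<mu> x) y * \<phi> (v y)) \<le>
       1 - k' * q0 * (expectation (\<lambda>w. \<phi> (u + (a - Y w))) - \<epsilon>)"
      using k' q0 by (intro diff_mono sum_pmf_parent_le_1 mult_left_mono E_le) auto
    also have "\<dots> = 1 - q0 * (k' * expectation (\<lambda>w. \<phi> (u + (a - Y w)))) + k' * q0 * \<epsilon>"
      by (simp add: algebra_simps)
    also have "\<dots> \<le> 1 - q0 * (\<phi> u + s) + k' * q0 * \<epsilon>"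
      using True q0 by (intro add_right_mono diff_left_mono mult_left_mono sub) auto
    finally have D: "depth_mean k \<mu> (W h) x \<le> 1 - q0 * (\<phi> u + s) + k' * q0 * \<epsilon>" .
    have D1: "depth_mean k \<mu> (W h) x \<le> 1"
    proof -
      have "depth_mean k \<mu> (W h) x \<le> pmf (\<mu> x) 0 + (\<Sum>y\<in>{1..<x}. pmf (\<mu> x) y * 1)"
        unfolding depth_mean_def using W01 by (intro add_left_mono sum_mono mult_left_mono power_le_one) auto
      also have "\<dots> = (\<Sum>y\<in>insert 0 {1..<x}. pmf (\<mu> x) y)" by simp
      also have "\<dots> \<le> 1" by (rule sum_pmf_parent_le_1) simp
      finally show ?thesis .
    qed
    have "W (Suc h) x \<le> (1 + \<eta>) * depth_mean k \<mu> (W h) x + \<kappa> / real x"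
      using rec Suc.prems unfolding depth_recursion_def by auto
    also have "\<dots> \<le> depth_mean k \<mu> (W h) x + \<eta> + \<kappa> / real m0"
    proof -
      have "\<eta> * depth_mean k \<mu> (W h) x \<le> \<eta> * 1" using D1 \<eta> by (intro mult_left_mono)
      moreover have "\<kappa> / real x \<le> \<kappa> / real m0" using m0x m0 \<kappa> by (intro divide_left_mono) auto
      ultimately show ?thesis by (simp add: algebra_simps)
    qed
    also have "\<dots> \<le> 1 - q0 * \<phi> u" using D small by (simp add: algebra_simps)
    finally show ?thesis unfolding u_def .
  qed
qed

text \<open>\<open>W ^ k \<le> r * W\<close> makes the recursion linear with contraction factor
  below 1. The term in \<open>m / x\<close> is a stationary supersolution fed by parents below
  \<open>m\<close> and by \<open>\<kappa> / x\<close>; the term \<open>r' ^ i\<close> forgets the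
  trivial initial bound \<open>W \<le> 1\<close>.\<close>

lemma depth_recursion_supersolution:
  assumes rec: "depth_recursion k \<mu> n \<eta> \<kappa> W" and k: "k \<ge> 1"
    and \<eta>: "0 \<le> \<eta>" "\<eta> \<le> 1" and m: "m \<ge> 1" and c: "c \<ge> 0"
    and tail: "\<And>t. 0 < t \<Longrightarrow> t \<le> 1 \<Longrightarrow> cdf_X t \<le> A0 * t powr c" and A0: "A0 \<ge> 0"
    and int: "integrable N (\<lambda>w. exp (c * Y w))"
    and r: "r \<ge> 0" "(1 + \<eta>) * r * 2 powr c * expectation (\<lambda>w. exp (c * Y w)) \<le> r'" "r' < 1"
    and Wr: "\<And>h y. h \<ge> h0 \<Longrightarrow> h < h0 + J \<Longrightarrow> y \<in> {m..n} \<Longrightarrow> W h y ^ (k - 1) \<le> r"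
    and err: "\<And>x. x \<in> {m..n} \<Longrightarrow> \<kappa> / real x \<le> (real m / real x) powr c"
    and Jn: "h0 + J \<le> n"
  shows "i \<le> J \<Longrightarrow> x \<in> {m..n} \<Longrightarrow> W (h0 + i) x \<le> (2 * A0 + 1) / (1 - r') * (real m / real x) powr c + r' ^ i"
proof (induction i arbitrary: x)
  have W01: "0 \<le> W h y" "W h y \<le> 1" for h y using rec unfolding depth_recursion_def by auto
  case 0
  have "0 \<le> (2 * A0 + 1) / (1 - r') * (real m / real x) powr c" using A0 r by simp
  then show ?case using W01[of h0 x] by simp
next
  have W01: "0 \<le> W h y" "W h y \<le> 1" for h y using rec unfolding depth_recursion_def by auto
  \<comment> \<open>The fixed point of \<open>A = 2 * A0 + 1 + A * r'\<close>: parents below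
    \<open>m\<close> with the factor 1 + \<eta> at most 2, then the error term, then the contracted
    old value.\<close>
  define A where "A = (2 * A0 + 1) / (1 - r')"
  have A: "A \<ge> 0" "A = 2 * A0 + 1 + A * r'" unfolding A_def using A0 r by (auto simp: field_simps)
  define B where "B = expectation (\<lambda>w. exp (c * Y w))"
  have B: "B \<ge> 1"
  proof -
    have "expectation (\<lambda>w. 1) \<le> B"
      unfolding B_def using int c by (intro integral_mono) (auto simp: Y_nonneg)
    then show ?thesis by (simp add: prob_space)
  qed
  have "1 * 1 \<le> 2 powr c * B" using B c by (intro mult_mono) (auto simp: ge_one_powr_ge_zero)
  then have "(1 + \<eta>) * r * 1 \<le> (1 + \<eta>) * r * (2 powr c * B)" using r \<eta> by (intro mult_left_mono) auto
  then have r': "(1 + \<eta>) * r \<le> r'" using r(2) unfolding B_def by (simp add: mult.assoc)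
  have r'0: "r' \<ge> 0" using r' r(1) \<eta> by (intro order_trans[OF _ r'] mult_nonneg_nonneg) auto
  case (Suc i)
  have x: "1 \<le> x" "m \<le> x" "x \<le> n" using Suc.prems m by auto
  define \<rho> where "\<rho> = (real m / real x) powr c"
  have \<rho>: "\<rho> \<ge> 0" unfolding \<rho>_def by simp
  let ?h = "h0 + i"
  have Wk: "W ?h y ^ k \<le> r * (A * (real m / real y) powr c + r' ^ i)" if y: "y \<in> {m..<x}" for y
  proof -
    have "W ?h y ^ k = W ?h y ^ (k - 1) * W ?h y" using k by (cases k) auto
    also have "\<dots> \<le> r * (A * (real m / real y) powr c + r' ^ i)"
      using y x Suc.prems W01 r Suc.IH[of y, folded A_def] by (intro mult_mono Wr) auto
    finally show ?thesis .
  qed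
  have low: "(\<Sum>y\<in>{..<m}. pmf (\<mu> x) y) \<le> A0 * \<rho>"
  proof -
    have "(\<Sum>y\<in>{..<m}. pmf (\<mu> x) y) = prob {w \<in> space N. parent x w \<in> {..<m}}"
      by (simp only: measure_parent[symmetric] measure_measure_pmf_finite finite_lessThan)
    also have "\<dots> \<le> cdf_X (real m / real x)"
    proof (rule finite_measure_mono)
      show "{w \<in> space N. parent x w \<in> {..<m}} \<subseteq> {w \<in> space N. X w \<le> real m / real x}"
      proof safe
        fix w assume w: "w \<in> space N" "parent x w < m"
        have "real x * X w < real (parent x w) + 1" by (rule parent_bounds(2)[OF w(1)])
        also have "\<dots> \<le> real m" using w(2) by linarith
        finally show "X w \<le> real m / real x" using x by (simp add: field_simps)
      qed
    qed simp
    also have "\<dots> \<le> A0 * \<rho>" unfolding \<rho>_def using x m by (intro tail) auto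
    finally show ?thesis .
  qed
  have high: "(\<Sum>y\<in>{m..<x}. pmf (\<mu> x) y * (real m / real y) powr c) \<le> 2 powr c * \<rho> * B"
  proof -
    have "(\<Sum>y\<in>{m..<x}. pmf (\<mu> x) y * (real m / real y) powr c) =
      expectation (\<lambda>w. of_bool (parent x w \<in> {m..<x}) * (real m / real (parent x w)) powr c)"
      by (rule sum_pmf_parent(1)) simp
    also have "\<dots> \<le> expectation (\<lambda>w. 2 powr c * \<rho> * exp (c * Y w))"
    proof (rule integral_mono_AE)
      show "AE w in N. of_bool (parent x w \<in> {m..<x}) * (real m / real (parent x w)) powr c
          \<le> 2 powr c * \<rho> * exp (c * Y w)"
      using AE_X_pos AE_space
      proof eventually_elim
        case (elim w)
        define y where "y = parent x w"
        show ?case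
        proof (cases "y \<in> {m..<x}")
          case False
          then show ?thesis unfolding y_def[symmetric] using \<rho> by auto
        next
          case True
          then have y1: "y \<ge> 1" using m by simp
          \<comment> \<open>Rounding down at most halves a position above 1; this is the origin of
            the factor \<open>2 powr c\<close>.\<close>
          have "real x * X w < real y + 1" unfolding y_def by (rule parent_bounds(2)[OF elim(2)])
          also have "\<dots> \<le> 2 * real y" using y1 by simp
          finally have "real m / real y \<le> 2 * (real m / real x) * (1 / X w)"
            using y1 x m elim by (simp add: field_simps)
          then have "(real m / real y) powr c \<le> (2 * (real m / real x) * (1 / X w)) powr c"
            using c by (intro powr_mono2) auto
          also have "\<dots> = 2 powr c * \<rho> * (1 / X w) powr c"
            unfolding \<rho>_def using elim by (simp add: powr_mult powr_divide)
          also have "(1 / X w) powr c = exp (c * Y w)"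
            using elim by (simp add: powr_def Y_def ln_div)
          finally show ?thesis using True unfolding y_def[symmetric] by simp
        qed
      qed
    qed (use int sum_pmf_parent(2)[of "{m..<x}"] in auto)
    also have "\<dots> = 2 powr c * \<rho> * B" unfolding B_def by simp
    finally show ?thesis .
  qed
  have "depth_mean k \<mu> (W ?h) x \<le>
      (\<Sum>y\<in>{..<m}. pmf (\<mu> x) y) + (\<Sum>y\<in>{m..<x}. pmf (\<mu> x) y * W ?h y ^ k)"
  proof -
    have split: "{1..<x} = {1..<m} \<union> {m..<x}" "{..<m} = insert 0 {1..<m}" using m x by auto
    have "(\<Sum>y\<in>{1..<x}. pmf (\<mu> x) y * W ?h y ^ k) =
       (\<Sum>y\<in>{1..<m}. pmf (\<mu> x) y * W ?h y ^ k) + (\<Sum>y\<in>{m..<x}. pmf (\<mu> x) y * W ?h y ^ k)"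
      unfolding split(1) by (rule sum.union_disjoint) auto
    moreover have "(\<Sum>y\<in>{1..<m}. pmf (\<mu> x) y * W ?h y ^ k) \<le> (\<Sum>y\<in>{1..<m}. pmf (\<mu> x) y * 1)"
      using W01 by (intro sum_mono mult_left_mono power_le_one) auto
    moreover have "(\<Sum>y\<in>{..<m}. pmf (\<mu> x) y) = pmf (\<mu> x) 0 + (\<Sum>y\<in>{1..<m}. pmf (\<mu> x) y)"
      unfolding split(2) by (subst sum.insert) auto
    ultimately show ?thesis unfolding depth_mean_def by simp
  qed
  also have "\<dots> \<le> A0 * \<rho> + (\<Sum>y\<in>{m..<x}. pmf (\<mu> x) y * (r * (A * (real m / real y) powr c + r' ^ i)))"
    by (intro add_mono low sum_mono mult_left_mono Wk) auto
  also have "(\<Sum>y\<in>{m..<x}. pmf (\<mu> x) y * (r * (A * (real m / real y) powr c + r' ^ i))) =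
      r * (A * (\<Sum>y\<in>{m..<x}. pmf (\<mu> x) y * (real m / real y) powr c) + r' ^ i * (\<Sum>y\<in>{m..<x}. pmf (\<mu> x) y))"
    by (simp add: sum_distrib_left sum.distrib distrib_left mult_ac)
  also have "A0 * \<rho> + \<dots> \<le> A0 * \<rho> + r * (A * (2 powr c * \<rho> * B) + r' ^ i * 1)"
    using r A r'0 by (intro add_left_mono mult_left_mono add_mono high sum_pmf_parent_le_1) auto
  finally have D: "depth_mean k \<mu> (W ?h) x \<le> A0 * \<rho> + r * (A * (2 powr c * \<rho> * B) + r' ^ i * 1)" .
  have "W (Suc ?h) x \<le> (1 + \<eta>) * depth_mean k \<mu> (W ?h) x + \<kappa> / real x"
    using rec x Suc.prems Jn unfolding depth_recursion_def by auto
  also have "\<dots> \<le> (1 + \<eta>) * (A0 * \<rho> + r * (A * (2 powr c * \<rho> * B) + r' ^ i * 1)) + \<rho>"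
    using \<eta> x unfolding \<rho>_def by (intro add_mono mult_left_mono D[unfolded \<rho>_def] err) auto
  also have "\<dots> = (1 + \<eta>) * (A0 * \<rho>) + (1 + \<eta>) * r * 2 powr c * B * (A * \<rho>) + ((1 + \<eta>) * r) * r' ^ i + \<rho>"
    by (simp add: algebra_simps)
  also have "\<dots> \<le> 2 * (A0 * \<rho>) + r' * (A * \<rho>) + r' * r' ^ i + \<rho>"
    using \<eta> A0 \<rho> A r'0 r' r(2) unfolding B_def by (intro add_mono mult_right_mono mult_nonneg_nonneg) auto
  also have "\<dots> = (2 * A0 + 1 + A * r') * \<rho> + r' ^ Suc i" by (simp add: algebra_simps)
  also have "2 * A0 + 1 + A * r' = A" using A(2) by simp
  finally show ?case unfolding A_def \<rho>_def by simp
qed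

lemma depth_recursion_mono: "depth_recursion k \<nu> n \<eta> \<kappa> W \<Longrightarrow> h \<le> h' \<Longrightarrow> W h x \<le> W h' x"
  unfolding depth_recursion_def mono_def le_fun_def by blast

text \<open>The concentration bound is applied to each of the \<open>n\<^sup>2\<close> pairs (h, x);
  the remaining clauses of \<open>depth_recursion\<close> hold for every \<open>d\<close>.\<close>

lemma measure_not_depth_recursion:
  assumes k: "k \<ge> 1" and \<eta>: "0 < \<eta>" "\<eta> \<le> 1"
  shows "measure (dag_pmf k \<mu> n)
     {d. \<not> depth_recursion k \<mu> n \<eta> (C * u / \<eta>) (\<lambda>h x. measure (\<mu> x) {y. d y < h})} \<le> (real n)\<^sup>2 * exp (- u)"
proof -
  let ?W = "\<lambda>d h x. measure (\<mu> x) {y. d y < h}"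
  let ?B = "\<lambda>(h, x). {d. ?W d (Suc h) x > (1 + \<eta>) * depth_mean k \<mu> (?W d h) x + C * u / (\<eta> * real x)}"
  have "{d. \<not> depth_recursion k \<mu> n \<eta> (C * u / \<eta>) (?W d)} \<subseteq> (\<Union>e\<in>{..<n} \<times> {1..n}. ?B e)"
  proof
    fix d assume d: "d \<in> {d. \<not> depth_recursion k \<mu> n \<eta> (C * u / \<eta>) (?W d)}"
    have "mono (?W d)" by (auto simp: mono_def le_fun_def intro!: measure_pmf.finite_measure_mono)
    then show "d \<in> (\<Union>e\<in>{..<n} \<times> {1..n}. ?B e)"
      using d unfolding depth_recursion_def by (force simp: not_le)
  qed
  then have "measure (dag_pmf k \<mu> n) {d. \<not> depth_recursion k \<mu> n \<eta> (C * u / \<eta>) (?W d)} \<le>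
      measure (dag_pmf k \<mu> n) (\<Union>e\<in>{..<n} \<times> {1..n}. ?B e)"
    by (intro measure_pmf.finite_measure_mono) auto
  also have "\<dots> \<le> (\<Sum>e\<in>{..<n} \<times> {1..n}. measure (dag_pmf k \<mu> n) (?B e))"
    by (intro measure_pmf.finite_measure_subadditive_finite) auto
  also have "\<dots> \<le> (\<Sum>e\<in>{..<n} \<times> {1..n}. exp (- u))"
  proof (intro sum_mono)
    fix e assume e: "e \<in> {..<n} \<times> {1..n}"
    obtain h x where hx: "e = (h, x)" "1 \<le> x" "x \<le> n" using e by auto
    show "measure (dag_pmf k \<mu> n) (?B e) \<le> exp (- u)"
      unfolding hx(1) prod.case
      by (intro measure_dag_pmf_concentration k set_parent_pmf hx \<eta> C_pos pmf_parent_le) auto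
  qed
  also have "\<dots> = (real n)\<^sup>2 * exp (- u)" by (simp add: card_cartesian_product power2_eq_square)
  finally show ?thesis .
qed

text \<open>The front of level \<open>h\<close> sits near log y = h / z, and the bound is required
  at distance \<open>\<tau> * ln (real n)\<close> ahead of it. \<open>K\<close> and
  \<open>\<tau>\<close> are quantified inside so that one \<eta> serves all of them, uniformly in
  \<open>W\<close>.\<close>

definition front_below :: "nat \<Rightarrow> real \<Rightarrow> real \<Rightarrow> real \<Rightarrow> bool" where
  "front_below k z \<eta> \<rho> \<longleftrightarrow> (\<forall>K \<tau>. 0 \<le> K \<longrightarrow> 0 < \<tau> \<longrightarrow>
     (\<forall>\<^sub>F n in sequentially. \<forall>W h y. depth_recursion k \<mu> n \<eta> (K * ln (real n)) W \<longrightarrow>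
        y \<in> {1..n} \<longrightarrow> real h / z + \<tau> * ln (real n) \<le> ln (real y) \<longrightarrow> W h y \<le> \<rho>))"

lemma front_belowD:
  "front_below k z \<eta> \<rho> \<Longrightarrow> 0 \<le> K \<Longrightarrow> 0 < \<tau> \<Longrightarrow>
     \<forall>\<^sub>F n in sequentially. \<forall>W h y. depth_recursion k \<mu> n \<eta> (K * ln (real n)) W \<longrightarrow>
        y \<in> {1..n} \<longrightarrow> real h / z + \<tau> * ln (real n) \<le> ln (real y) \<longrightarrow> W h y \<le> \<rho>"
  unfolding front_below_def by blast

text \<open>The bump at speed 1 / z keeps \<open>1 - W\<close> above a constant wherever it is
  bounded below. Starting it at a power of n makes the error of order log n / m0 vanish.\<close>

lemma front_density:
  assumes crit: "critical k z \<theta>" and k: "k \<ge> 2"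
  obtains \<rho> \<eta>1 where "0 < \<rho>" "\<rho> < 1" "0 < \<eta>1"
    "\<And>\<eta>. 0 < \<eta> \<Longrightarrow> \<eta> \<le> \<eta>1 \<Longrightarrow> front_below k z \<eta> \<rho>"
proof -
  have z: "0 < z" and \<theta>: "0 \<le> \<theta>"
    and centred: "expectation (\<lambda>w. (1 / z - Y w) * exp (\<theta> * (1 / z - Y w))) = 0"
    and super: "1 < real k * expectation (\<lambda>w. exp (\<theta> * (1 / z - Y w)))"
    using crit unfolding critical_def[OF k] by auto
  define a where "a = 1 / z"
  have a: "a > 0" unfolding a_def using z by simp
  define M where "M = expectation (\<lambda>w. exp (\<theta> * (1 / z - Y w)))"
  have M: "1 < real k * M" using super unfolding M_def .
  have "0 < real k * M" by (rule less_trans[OF zero_less_one M])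
  then have Mpos: "M > 0" by (auto simp: zero_less_mult_iff)
  define b where "b = 1 / M"
  \<comment> \<open>Strictly between 1 / M and k: above 1 / M the tilted walk still gains, and below
    k the k-th power admits this slope near 0. The bump also requires slope at least 1.\<close>
  define k' where "k' = max 1 ((real k + b) / 2)"
  have "b < real k" unfolding b_def using M Mpos by (simp add: field_simps)
  then have "b < (real k + b) / 2" "(real k + b) / 2 < real k" by (simp_all add: field_simps)
  then have k': "1 \<le> k'" "k' < real k" "b < k'" unfolding k'_def using k by (auto simp: less_max_iff_disj)
  have "1 < k' * M" using k'(3) Mpos unfolding b_def by (simp add: field_simps)
  then obtain R s q \<phi> where R: "R \<ge> 6 * a" and s: "s > 0" and q: "q > 0" and cont: "continuous_on UNIV \<phi>"
    and \<phi>: "\<And>u. 0 \<le> \<phi> u" "\<And>u. \<phi> u \<le> 1" "\<And>u. u < 0 \<Longrightarrow> \<phi> u = 0" "\<And>u. R < u \<Longrightarrow> \<phi> u = 0"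
    and \<phi>q: "\<And>u. R / 3 \<le> u \<Longrightarrow> u \<le> 2 * R / 3 \<Longrightarrow> q \<le> \<phi> u"
    and sub: "\<And>u. 0 \<le> u \<Longrightarrow> u \<le> R \<Longrightarrow> \<phi> u + s \<le> k' * expectation (\<lambda>w. \<phi> (u + (a - Y w)))"
    using bump_subsolution[OF a \<theta> k'(1) centred[folded a_def]] unfolding M_def a_def by blast
  obtain q0 where q0: "0 < q0" "q0 \<le> 1" "\<And>v. 0 \<le> v \<Longrightarrow> v \<le> q0 \<Longrightarrow> (1 - v) ^ k \<le> 1 - k' * v"
    using one_minus_power_le[OF k'(2)] k'(1) by auto
  have Rpos: "R > 0" using R a by simp
  have q1: "q \<le> 1" using \<phi>q[of "R / 3"] \<phi>(2)[of "R / 3"] Rpos by simp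
  \<comment> \<open>One third of the gain \<open>q0 * s\<close> goes to rounding, one third to
    \<eta> and one third to the term K log n / m0.\<close>
  define \<epsilon> where "\<epsilon> = s / (3 * k')"
  have \<epsilon>: "\<epsilon> > 0" unfolding \<epsilon>_def using s k' by simp
  have "uniformly_continuous_on {-1..R} \<phi>"
    by (intro compact_uniformly_continuous continuous_on_subset[OF cont]) auto
  then obtain \<delta> where \<delta>: "\<delta> > 0" "\<And>v v'. v \<in> {-1..R} \<Longrightarrow> v' \<in> {-1..R} \<Longrightarrow> dist v' v < \<delta> \<Longrightarrow> dist (\<phi> v') (\<phi> v) < \<epsilon>"
    unfolding uniformly_continuous_on_def using \<epsilon> by metis
  define \<rho> where "\<rho> = max (1/2) (1 - q0 * q)"
  show ?thesis
  proof (rule that[of \<rho> "q0 * s / 3"])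
    show "0 < \<rho>" "\<rho> < 1" "0 < q0 * s / 3" unfolding \<rho>_def using q q0 s by auto
    fix \<eta> :: real assume \<eta>: "0 < \<eta>" "\<eta> \<le> q0 * s / 3"
    show "front_below k z \<eta> \<rho>"
      unfolding front_below_def
    proof (intro allI impI)
      fix K \<tau> :: real assume K: "0 \<le> K" and \<tau>: "0 < \<tau>"
      define m0 where "m0 n = nat \<lceil>real n powr (\<tau> / 2)\<rceil>" for n
      have e1: "\<forall>\<^sub>F n in sequentially. K * ln (real n) / real n powr (\<tau> / 2) \<le> q0 * s / 3"
      proof -
        have "(\<lambda>n. K * ln (real n) / real n powr (\<tau> / 2)) \<longlonglongrightarrow> 0" using \<tau> by real_asymp
        moreover have "0 < q0 * s / 3" using q0 s by simp
        ultimately have "\<forall>\<^sub>F n in sequentially. K * ln (real n) / real n powr (\<tau> / 2) < q0 * s / 3"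
          by (rule order_tendstoD(2))
        then show ?thesis by (rule eventually_mono) simp
      qed
      have e2: "\<forall>\<^sub>F n in sequentially. 1 / real n powr (\<tau> / 2) < min \<delta> 1"
      proof -
        have "(\<lambda>n. 1 / real n powr (\<tau> / 2)) \<longlonglongrightarrow> 0" using \<tau> by real_asymp
        then show ?thesis using \<delta>(1) by (intro order_tendstoD(2)[of _ 0]) auto
      qed
      have e3: "\<forall>\<^sub>F n in sequentially. ln 2 + \<tau> / 2 * ln (real n) + R / 3 \<le> \<tau> * ln (real n)"
        using \<tau> by real_asymp
      have e4: "\<forall>\<^sub>F n in sequentially. ln (real n) / a \<le> real n" using a by real_asymp
      show "\<forall>\<^sub>F n in sequentially. \<forall>W h y. depth_recursion k \<mu> n \<eta> (K * ln (real n)) W \<longrightarrow>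
           y \<in> {1..n} \<longrightarrow> real h / z + \<tau> * ln (real n) \<le> ln (real y) \<longrightarrow> W h y \<le> \<rho>"
        using e1 e2 e3 e4 eventually_ge_at_top[of 1]
      proof eventually_elim
        case (elim n)
        show ?case
        proof (intro allI impI)
          fix W :: "nat \<Rightarrow> nat \<Rightarrow> real" and h y :: nat
          assume rec: "depth_recursion k \<mu> n \<eta> (K * ln (real n)) W"
            and y: "y \<in> {1..n}" and hy: "real h / z + \<tau> * ln (real n) \<le> ln (real y)"
          have npos: "real n powr (\<tau> / 2) \<ge> 1" using elim \<tau> by (intro ge_one_powr_ge_zero) auto
          have m0: "real n powr (\<tau> / 2) \<le> real (m0 n)" "real (m0 n) \<le> 2 * real n powr (\<tau> / 2)" "m0 n \<ge> 1"
            unfolding m0_def using npos by linarith+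
          have lnm0: "ln (real (m0 n)) \<le> ln 2 + \<tau> / 2 * ln (real n)"
          proof -
            have "ln (real (m0 n)) \<le> ln (2 * real n powr (\<tau> / 2))"
              using m0 elim(5) by (subst ln_le_cancel_iff) auto
            also have "\<dots> = ln 2 + \<tau> / 2 * ln (real n)" using elim(5) by (simp add: ln_mult ln_powr)
            finally show ?thesis .
          qed
          \<comment> \<open>At this level the node \<open>y\<close> would sit at R / 3 inside the
            bump. Its floor \<open>h'\<close> is at least \<open>h\<close> and moves the position by
            at most \<open>a\<close>, so \<open>y\<close> stays in the middle third; monotonicity in
            the level carries the bound from \<open>h'\<close> back to \<open>h\<close>.\<close>
          define t where "t = (ln (real y) - ln (real (m0 n)) - R / 3) / a"
          have ht: "real h \<le> t"
          proof -
            have "a * real h \<le> ln (real y) - ln (real (m0 n)) - R / 3"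
              using hy lnm0 elim(3) unfolding a_def by (simp add: field_simps)
            then show ?thesis unfolding t_def using a by (simp add: field_simps)
          qed
          define h' where "h' = nat \<lfloor>t\<rfloor>"
          have h': "real h' \<le> t" "t \<le> real h' + 1" "h \<le> h'" unfolding h'_def using ht by linarith+
          have "t \<le> ln (real n) / a"
          proof -
            have "0 \<le> ln (real (m0 n))" "ln (real y) \<le> ln (real n)" using m0 y by auto
            then show ?thesis unfolding t_def using a Rpos by (intro divide_right_mono) auto
          qed
          then have h'n: "h' \<le> n" using h'(1) elim(4) by linarith
          define u where "u = ln (real y) - ln (real (m0 n)) - a * real h'"
          have at: "a * t = ln (real y) - ln (real (m0 n)) - R / 3" unfolding t_def using a by simp
          have "a * real h' \<le> a * t" "a * t \<le> a * real h' + a"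
            using h' a mult_left_mono[of t "real h' + 1" a] by (auto simp: algebra_simps)
          then have u: "R / 3 \<le> u" "u \<le> 2 * R / 3" unfolding u_def using at R a by auto
          have im0: "1 / real (m0 n) \<le> 1 / real n powr (\<tau> / 2)" using m0 elim(5) by (intro divide_left_mono mult_pos_pos) auto
          have "W h' y \<le> 1 - q0 * \<phi> (ln (real y) - ln (real (m0 n)) - a * real h')"
          proof (rule wave_lower_bound[OF rec _ _ a m0(3) \<phi> _ sub q0, where \<epsilon>=\<epsilon>])
            show "\<phi> \<in> borel_measurable borel" using cont by (rule borel_measurable_continuous_onI)
            show "0 \<le> K * ln (real n)" using K elim by simp
            show "\<phi> v - \<epsilon> \<le> \<phi> (v - t)" if "0 \<le> v" "v \<le> R" "0 \<le> t" "t \<le> 1 / real (m0 n)" for v t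
            proof -
              have "t < \<delta>" "t < 1" using that im0 elim(2) by auto
              then have "dist (\<phi> (v - t)) (\<phi> v) < \<epsilon>" using that by (intro \<delta>(2)) (auto simp: dist_real_def)
              then show ?thesis by (simp add: dist_real_def)
            qed
            have "K * ln (real n) / real (m0 n) \<le> K * ln (real n) / real n powr (\<tau> / 2)"
              using m0 K elim(5) by (intro divide_left_mono mult_pos_pos) auto
            then have "K * ln (real n) / real (m0 n) \<le> q0 * s / 3" using elim(1) by (rule order_trans)
            moreover have "k' * q0 * \<epsilon> = q0 * s / 3" unfolding \<epsilon>_def using k' by simp
            ultimately show "k' * q0 * \<epsilon> + \<eta> + K * ln (real n) / real (m0 n) \<le> q0 * s" using \<eta>(2) by linarith
          qed (use \<eta> k' \<epsilon> h'n y in auto)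
          also have "\<dots> \<le> 1 - q0 * q" using q0 u unfolding u_def[symmetric] by (intro diff_left_mono mult_left_mono \<phi>q) auto
          also have "\<dots> \<le> \<rho>" unfolding \<rho>_def by simp
          finally show "W h y \<le> \<rho>" using depth_recursion_mono[OF rec h'(3), of y] by simp
        qed
      qed
    qed
  qed
qed

text \<open>\<open>front_density\<close> gives W at most some \<rho> < 1. With r = \<rho> the linear
  recursion contracts if c is small enough, and running it for a small multiple of log n levels
  brings W below any constant while the front hardly advances.\<close>

lemma small_density:
  assumes crit: "critical k z \<theta>" and k: "k \<ge> 2"
    and \<delta>0: "0 < \<delta>0"
  obtains \<eta>1 where "0 < \<eta>1" "\<eta>1 \<le> 1"
    "\<And>\<eta>. 0 < \<eta> \<Longrightarrow> \<eta> \<le> \<eta>1 \<Longrightarrow> front_below k z \<eta> \<delta>0"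
proof -
  have z: "0 < z" using crit unfolding critical_def[OF k] by simp
  obtain \<rho> \<eta>0 where \<rho>: "0 < \<rho>" "\<rho> < 1" and \<eta>0: "0 < \<eta>0"
    and front: "\<And>\<eta>. 0 < \<eta> \<Longrightarrow> \<eta> \<le> \<eta>0 \<Longrightarrow> front_below k z \<eta> \<rho>"
    using front_density[OF crit k] by blast
  define D where "D = expectation (\<lambda>w. exp (Y w / 2)) - 1"
  have D: "D \<ge> 0"
  proof -
    have "expectation (\<lambda>w. 1) \<le> expectation (\<lambda>w. exp (Y w / 2))"
      using integrable_exp_half by (intro integral_mono) (auto simp: Y_nonneg)
    then show ?thesis unfolding D_def by (simp add: prob_space)
  qed
  define \<delta> where "\<delta> = (1 - \<rho>) / 8"
  have \<delta>: "0 < \<delta>" "\<delta> \<le> 1" unfolding \<delta>_def using \<rho> by auto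
  \<comment> \<open>Makes 2^c E[exp(c Y)] at most 1 + c (1 + 4 D), hence at most 1 + \<delta>; with
    \<delta> = (1 - \<rho>) / 8 the contraction factor stays below (1 + \<rho>) / 2.\<close>
  define c where "c = min (1 / 2) (\<delta> / (1 + 4 * D))"
  have D4: "1 + 4 * D > 0" using D by simp
  have "0 < c" unfolding c_def using \<delta> D4 by auto
  moreover have "c \<le> 1 / 2" unfolding c_def by (rule min.cobounded1)
  moreover have "c \<le> \<delta> / (1 + 4 * D)" unfolding c_def by (rule min.cobounded2)
  ultimately have c: "0 < c" "c \<le> 1 / 2" "c * (1 + 4 * D) \<le> \<delta>" using D4 by (simp_all add: pos_le_divide_eq)
  define B where "B = expectation (\<lambda>w. exp (c * Y w))"
  have intB: "integrable N (\<lambda>w. exp (c * Y w))" and B: "B \<le> 1 + 2 * c * D"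
    using expectation_exp_small[of c] c unfolding B_def D_def by auto
  have B0: "B \<ge> 0" unfolding B_def by (intro integral_nonneg_AE) auto
  define r' where "r' = (1 + \<rho>) / 2"
  have r': "0 < r'" "r' < 1" unfolding r'_def using \<rho> by auto
  have contr: "(1 + \<eta>) * \<rho> * 2 powr c * B \<le> r'" if "0 < \<eta>" "\<eta> \<le> \<delta>" for \<eta>
  proof -
    have "2 powr c * B \<le> (1 + c) * (1 + 2 * c * D)"
      using c B B0 by (intro mult_mono two_powr_le) auto
    also have "\<dots> \<le> 1 + c * (1 + 4 * D)"
    proof -
      have "c * (2 * c * D) \<le> 1 * (2 * c * D)" using c D by (intro mult_right_mono mult_nonneg_nonneg) auto
      then show ?thesis by (simp add: algebra_simps)
    qed
    also have "\<dots> \<le> 1 + \<delta>" using c by simp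
    finally have "(1 + \<eta>) * \<rho> * (2 powr c * B) \<le> (1 + \<delta>) * \<rho> * (1 + \<delta>)"
      using that \<rho> \<delta> B0 by (intro mult_mono) auto
    also have "\<dots> = \<rho> * (1 + 2 * \<delta> + \<delta> * \<delta>)" by (simp add: algebra_simps)
    also have "\<dots> \<le> \<rho> * (1 + 3 * \<delta>)"
      using \<delta> \<rho> mult_right_mono[of \<delta> 1 \<delta>] by (intro mult_left_mono) auto
    also have "\<dots> \<le> \<rho> + 1 * (3 * \<delta>)" using \<rho> \<delta> mult_right_mono[of \<rho> 1 "3 * \<delta>"] by (simp add: algebra_simps)
    also have "\<dots> \<le> r'" unfolding r'_def \<delta>_def using \<rho> by (simp add: field_simps)
    finally show ?thesis by (simp add: mult.assoc)
  qed
  define A where "A = (2 * C + 1) / (1 - r')"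
  have A: "A > 0" unfolding A_def using C_pos r' by (intro divide_pos_pos) auto
  show ?thesis
  proof (rule that[of "min (min \<eta>0 \<delta>) 1"])
    show "0 < min (min \<eta>0 \<delta>) 1" "min (min \<eta>0 \<delta>) 1 \<le> 1" using \<eta>0 \<delta> by auto
    fix \<eta> :: real assume \<eta>: "0 < \<eta>" "\<eta> \<le> min (min \<eta>0 \<delta>) 1"
    show "front_below k z \<eta> \<delta>0"
      unfolding front_below_def
    proof (intro allI impI)
      fix K \<tau> :: real assume K: "0 \<le> K" and \<tau>: "0 < \<tau>"
      define t where "t n = \<tau> * z / 4 * ln (real n)" for n
      define b where "b = - (\<tau> * z / 4 * ln r')"
      have b: "b > 0" unfolding b_def using r' \<tau> z by (simp add: mult_pos_neg)
      define b' where "b' = \<tau> / 2 * c"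
      have b': "b' > 0" unfolding b'_def using \<tau> c by simp
      have pow: "(2 * real n powr (- \<tau> / 2)) powr c = 2 powr c * real n powr (- b')" for n
        unfolding b'_def by (simp add: powr_mult powr_powr)
      define A' where "A' = A * 2 powr c"
      have "(\<lambda>n. A' * real n powr (- b')) \<longlonglongrightarrow> 0" using b' by real_asymp
      moreover have "(\<lambda>n. real n powr (- b)) \<longlonglongrightarrow> 0" using b by real_asymp
      ultimately have "(\<lambda>n. A' * real n powr (- b') + real n powr (- b)) \<longlonglongrightarrow> 0 + 0"
        by (rule tendsto_add)
      then have "(\<lambda>n. A * (2 * real n powr (- \<tau> / 2)) powr c + real n powr (- b)) \<longlonglongrightarrow> 0"
        unfolding pow A'_def mult.assoc by simp
      then have e1: "\<forall>\<^sub>F n in sequentially. A * (2 * real n powr (- \<tau> / 2)) powr c + real n powr (- b) < \<delta>0"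
        by (rule order_tendstoD(2)) (rule \<delta>0)
      have e2: "\<forall>\<^sub>F n in sequentially. \<tau> / 4 * ln (real n) + 1 / z + \<tau> / 8 * ln (real n) \<le> \<tau> / 2 * ln (real n)"
        using \<tau> by real_asymp
      have e3: "\<forall>\<^sub>F n in sequentially. z * ln (real n) + \<tau> * z / 4 * ln (real n) + 1 \<le> real n"
        using \<tau> z by real_asymp
      have e4: "\<forall>\<^sub>F n in sequentially. K * ln (real n) \<le> real n powr (\<tau> / 2)" using \<tau> by real_asymp
      have e5: "\<forall>\<^sub>F n in sequentially. 2 \<le> real n powr (\<tau> / 2)" using \<tau> by real_asymp
      have ef: "\<forall>\<^sub>F n in sequentially. \<forall>W h y. depth_recursion k \<mu> n \<eta> (K * ln (real n)) W \<longrightarrow>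
           y \<in> {1..n} \<longrightarrow> real h / z + \<tau> / 8 * ln (real n) \<le> ln (real y) \<longrightarrow> W h y \<le> \<rho>"
        using \<eta> K \<tau> by (intro front_belowD[OF front]) auto
      show "\<forall>\<^sub>F n in sequentially. \<forall>W h y. depth_recursion k \<mu> n \<eta> (K * ln (real n)) W \<longrightarrow>
           y \<in> {1..n} \<longrightarrow> real h / z + \<tau> * ln (real n) \<le> ln (real y) \<longrightarrow> W h y \<le> \<delta>0"
        using e1 e2 e3 e4 e5 ef eventually_ge_at_top[of 1]
      proof eventually_elim
        case (elim n)
        show ?case
        proof (intro allI impI)
          fix W :: "nat \<Rightarrow> nat \<Rightarrow> real" and h y :: nat
          assume rec: "depth_recursion k \<mu> n \<eta> (K * ln (real n)) W"
            and y: "y \<in> {1..n}" and hy: "real h / z + \<tau> * ln (real n) \<le> ln (real y)"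
          have W01: "0 \<le> W h y" "W h y \<le> 1" for h y using rec unfolding depth_recursion_def by auto
          have n1: "1 \<le> n" using elim(7) .
          have lnn: "0 \<le> ln (real n)" using n1 by simp
          have t0: "0 \<le> t n" unfolding t_def using \<tau> z lnn by simp
          define J where "J = nat \<lceil>t n\<rceil>"
          have J: "real J \<le> t n + 1" unfolding J_def using t0 by linarith
          \<comment> \<open>The base node m, about e^g, lies halfway between the front of level
            \<open>h\<close> and the required position of \<open>y\<close>. The next
            \<open>J\<close> levels advance the front by little more than (\<tau> / 4) log n, so W
            is at most \<rho> above \<open>m\<close> throughout, while m / y is at most 2 n^(-\<tau>
            / 2).\<close>
          define g where "g = real h / z + \<tau> / 2 * ln (real n)"
          have g: "1 \<le> exp g" "real n powr (\<tau> / 2) \<le> exp g"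
            unfolding g_def using z \<tau> lnn n1 by (auto simp: powr_def)
          define m where "m = nat \<lceil>exp g\<rceil>"
          have m: "exp g \<le> real m" "real m \<le> 2 * exp g" "1 \<le> m" unfolding m_def using g(1) by linarith+
          have my: "m \<le> y"
          proof -
            have "2 * exp g \<le> real n powr (\<tau> / 2) * exp g" using elim(5) by (intro mult_right_mono) auto
            then have "real m \<le> real n powr (\<tau> / 2) * exp g" using m(2) by linarith
            also have "\<dots> = exp (real h / z + \<tau> * ln (real n))"
              unfolding g_def using n1 by (simp add: powr_def exp_add[symmetric] field_simps)
            also have "\<dots> \<le> exp (ln (real y))" using hy by simp
            finally show ?thesis using y by simp
          qed
          have hn: "real h \<le> z * ln (real n)"
          proof -
            have "real h / z \<le> ln (real y)" using hy \<tau> lnn mult_nonneg_nonneg[of \<tau> "ln (real n)"] by linarith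
            also have "\<dots> \<le> ln (real n)" using y by simp
            finally show ?thesis using z by (simp add: field_simps)
          qed
          have hJ: "h + J \<le> n"
          proof -
            have "real (h + J) \<le> real n" using hn J elim(3) unfolding t_def by simp
            then show ?thesis by simp
          qed
          have "W (h + J) y \<le> (2 * C + 1) / (1 - r') * (real m / real y) powr c + r' ^ J"
          proof (rule depth_recursion_supersolution[OF rec, where r=\<rho>])
            show "(1 + \<eta>) * \<rho> * 2 powr c * expectation (\<lambda>w. exp (c * Y w)) \<le> r'"
              using contr[of \<eta>] \<eta> unfolding B_def by simp
            show "cdf_X t \<le> C * t powr c" if t: "0 < t" "t \<le> 1" for t
            proof -
              have "t powr 1 \<le> t powr c" using t c by (intro powr_mono') auto
              then have "C * t \<le> C * t powr c" using C_pos t by simp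
              then show ?thesis using prob_le[of t] t by simp
            qed
            show "W h' y' ^ (k - 1) \<le> \<rho>" if h': "h \<le> h'" "h' < h + J" "y' \<in> {m..n}" for h' y'
            proof -
              have "real h' \<le> real h + (t n + 1)" using h' J by simp
              then have "real h' / z \<le> (real h + (t n + 1)) / z" using z by (intro divide_right_mono) auto
              also have "\<dots> = real h / z + \<tau> / 4 * ln (real n) + 1 / z"
                unfolding t_def using z by (simp add: field_simps)
              finally have "real h' / z + \<tau> / 8 * ln (real n) \<le> g" using elim(2) unfolding g_def by simp
              also have "g \<le> ln (real m)" using m by (subst ln_ge_iff) auto
              also have "\<dots> \<le> ln (real y')" using m h' by simp
              finally have "W h' y' \<le> \<rho>" using elim(6) rec h' m by auto
              moreover have "W h' y' ^ (k - 1) \<le> W h' y' ^ 1" using W01 k by (intro power_decreasing) auto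
              ultimately show ?thesis by simp
            qed
            show "K * ln (real n) / real x \<le> (real m / real x) powr c" if x: "x \<in> {m..n}" for x
            proof -
              have "K * ln (real n) \<le> real m" using elim(4) g m by linarith
              then have "K * ln (real n) / real x \<le> (real m / real x) powr 1"
                using x m by (simp add: divide_right_mono)
              also have "\<dots> \<le> (real m / real x) powr c" using x m c by (intro powr_mono') auto
              finally show ?thesis .
            qed
          qed (use k \<eta> c \<rho> r' C_pos intB hJ m my y in auto)
          also have "\<dots> \<le> A * (2 * real n powr (- \<tau> / 2)) powr c + real n powr (- b)"
          proof (intro add_mono)
            have "real m / real y \<le> 2 * real n powr (- \<tau> / 2)"
            proof -
              have "exp (real h / z + \<tau> * ln (real n)) \<le> exp (ln (real y))" using hy by simp
              also have "exp (ln (real y)) = real y" using y by simp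
              finally have "real m / real y \<le> 2 * exp g / exp (real h / z + \<tau> * ln (real n))"
                using m y by (intro frac_le) auto
              also have "\<dots> = 2 * exp (g - (real h / z + \<tau> * ln (real n)))" by (simp add: exp_diff)
              also have "g - (real h / z + \<tau> * ln (real n)) = - \<tau> / 2 * ln (real n)" unfolding g_def by simp
              finally show ?thesis using n1 by (simp add: powr_def)
            qed
            then show "(2 * C + 1) / (1 - r') * (real m / real y) powr c \<le> A * (2 * real n powr (- \<tau> / 2)) powr c"
              unfolding A_def[symmetric] using A c by (intro mult_left_mono powr_mono2) auto
            have "r' ^ J \<le> r' powr t n" unfolding J_def by (rule power_nat_ceiling_le[OF r' t0])
            also have "\<dots> = real n powr (- b)" unfolding t_def b_def powr_def using r' n1 by simp
            finally show "r' ^ J \<le> real n powr (- b)" .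
          qed
          also have "\<dots> \<le> \<delta>0" using elim(1) by simp
          finally show "W h y \<le> \<delta>0" using depth_recursion_mono[OF rec, of h "h + J" y] by simp
        qed
      qed
    qed
  qed
qed

text \<open>With c close to \<alpha> the factor 2^c E[exp(c Y)] may be large, so the recursion
  contracts only because \<open>small_density\<close> supplies an arbitrarily small
  \<open>\<delta>0\<close>. Taking m = n^g with g slightly below \<beta> then gives W a decay
  exponent strictly larger than 1 / k, as a union bound over n nodes requires.\<close>

lemma final_density:
  assumes crit: "critical k z \<theta>" and k: "k \<ge> 2"
    and \<alpha>: "\<alpha> > 0"
    and tail: "\<And>c. 0 < c \<Longrightarrow> c < \<alpha> \<Longrightarrow> \<exists>A\<ge>0. \<forall>t. 0 < t \<longrightarrow> t \<le> 1 \<longrightarrow> cdf_X t \<le> A * t powr c"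
    and \<zeta>: "\<zeta> \<ge> 0" "\<zeta> / z < 1 - 1 / (real k * \<alpha>)"
  obtains \<eta> \<epsilon> where "0 < \<eta>" "\<eta> \<le> 1" "0 < \<epsilon>"
    "\<And>K. 0 \<le> K \<Longrightarrow> \<forall>\<^sub>F n in sequentially. \<forall>W. depth_recursion k \<mu> n \<eta> (K * ln (real n)) W \<longrightarrow>
         (\<forall>x\<in>{1..n}. real n / 2 \<le> real x \<longrightarrow> W (nat \<lceil>\<zeta> * ln (real n)\<rceil>) x \<le> real n powr (- (1 / real k) - \<epsilon>))"
proof -
  have z: "0 < z" using crit unfolding critical_def[OF k] by simp
  define \<beta> where "\<beta> = 1 - 1 / (real k * \<alpha>)"
  define \<tau> where "\<tau> = min ((\<beta> - \<zeta> / z) / 8) (1 / (8 * \<alpha>))"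
  have "\<tau> \<le> (\<beta> - \<zeta> / z) / 8" unfolding \<tau>_def by (rule min.cobounded1)
  then have "\<tau> * 8 \<le> \<beta> - \<zeta> / z" by (simp only: pos_le_divide_eq zero_less_numeral)
  moreover have "\<tau> > 0" unfolding \<tau>_def \<beta>_def using \<zeta> \<alpha> by auto
  ultimately have \<tau>: "\<tau> > 0" "8 * \<tau> \<le> \<beta> - \<zeta> / z" by (simp_all only: mult.commute)
  have "\<tau> \<le> 1 / (8 * \<alpha>)" unfolding \<tau>_def by simp
  then have \<tau>\<alpha>: "0 < \<tau> * \<alpha>" "\<tau> * \<alpha> \<le> 1 / 8" using \<tau>(1) \<alpha> by (auto simp: field_simps)
  define g where "g = \<beta> - 2 * \<tau>"
  have "\<zeta> / z \<ge> 0" using \<zeta> z by simp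
  then have g0: "g > 0" unfolding g_def using \<tau> by linarith
  have g1: "g < 1"
  proof -
    have "1 / (real k * \<alpha>) > 0" using k \<alpha> by simp
    then show ?thesis unfolding g_def \<beta>_def using \<tau>(1) by linarith
  qed
  have kpos: "1 / real k > 0" "1 / real k \<le> 1 / 2" using k by (auto simp: field_simps)
  have ga: "(1 - g) * \<alpha> = 1 / real k + 2 * (\<tau> * \<alpha>)" unfolding g_def \<beta>_def using \<alpha> k by (simp add: field_simps)
  \<comment> \<open>The solution of (1 - g) c = 1 / k + \<tau> \<alpha>. Of the surplus 2 \<tau>
    \<alpha> in (1 - g) \<alpha>, half pays for replacing \<alpha> by c and half keeps the exponent
    above 1 / k.\<close>
  define c where "c = \<alpha> * ((1 / real k + \<tau> * \<alpha>) / (1 / real k + 2 * (\<tau> * \<alpha>)))"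
  have den: "1 / real k + 2 * (\<tau> * \<alpha>) > 0" using kpos \<tau>\<alpha> by linarith
  have c: "0 < c" "c < \<alpha>"
  proof -
    have "0 < (1 / real k + \<tau> * \<alpha>) / (1 / real k + 2 * (\<tau> * \<alpha>))"
      by (rule divide_pos_pos[OF add_pos_pos[OF kpos(1) \<tau>\<alpha>(1)] den])
    then show "0 < c" unfolding c_def using \<alpha> by (intro mult_pos_pos)
    have "1 / real k + \<tau> * \<alpha> < 1 / real k + 2 * (\<tau> * \<alpha>)" using \<tau>\<alpha>(1) by linarith
    then have "(1 / real k + \<tau> * \<alpha>) / (1 / real k + 2 * (\<tau> * \<alpha>)) < 1" using den by (simp only: divide_less_eq_1_pos)
    then have "c < \<alpha> * 1" unfolding c_def using \<alpha> by (intro mult_strict_left_mono)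
    then show "c < \<alpha>" by simp
  qed
  have gc: "(1 - g) * c = 1 / real k + \<tau> * \<alpha>"
    unfolding c_def mult.assoc[symmetric] ga using den by simp
  define p where "p = 1 / real k + \<tau> * \<alpha>"
  have p: "0 < p" "p < 1" unfolding p_def using kpos \<tau>\<alpha> by linarith+
  have gcp: "(g - 1) * c = - p" using gc unfolding p_def by (simp add: algebra_simps)
  obtain A0 where A0: "A0 \<ge> 0" "\<And>t. 0 < t \<Longrightarrow> t \<le> 1 \<Longrightarrow> cdf_X t \<le> A0 * t powr c"
    using tail[OF c] by auto
  have int: "integrable N (\<lambda>w. exp (c * Y w))"
  proof -
    obtain A1 where "\<And>t. 0 < t \<Longrightarrow> t \<le> 1 \<Longrightarrow> cdf_X t \<le> A1 * t powr ((c + \<alpha>) / 2)"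
      using tail[of "(c + \<alpha>) / 2"] c by auto
    then show ?thesis by (rule integrable_exp_of_tail) (use c in auto)
  qed
  define B where "B = expectation (\<lambda>w. exp (c * Y w))"
  have B: "B > 0"
    unfolding B_def using int by (intro expectation_greater) auto
  \<comment> \<open>Chosen so that about \<tau> z log n levels reduce the initial bound 1 to 1 /
    n.\<close>
  define r' where "r' = exp (- 1 / (\<tau> * z))"
  have r': "0 < r'" "r' < 1" unfolding r'_def using \<tau> z by auto
  define \<delta>0 where "\<delta>0 = r' / (2 * 2 powr c * B)"
  have \<delta>0: "\<delta>0 > 0" unfolding \<delta>0_def using r' B by simp
  obtain \<eta> where \<eta>: "0 < \<eta>" "\<eta> \<le> 1" and small0: "\<And>\<eta>'. 0 < \<eta>' \<Longrightarrow> \<eta>' \<le> \<eta> \<Longrightarrow> front_below k z \<eta>' \<delta>0"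
    using small_density[OF crit k \<delta>0] by blast
  note small = front_belowD[OF small0[OF \<eta>(1) order_refl] _ \<tau>(1)]
  define A where "A = (2 * A0 + 1) / (1 - r')"
  have A: "A > 0" unfolding A_def using A0 r' by (intro divide_pos_pos) auto
  show ?thesis
  proof (rule that[OF \<eta>, of "\<tau> * \<alpha> / 2"])
    show "0 < \<tau> * \<alpha> / 2" using \<tau>\<alpha> by simp
    fix K :: real assume K: "0 \<le> K"
    define p' where "p' = 1 / real k + \<tau> * \<alpha> / 2"
    have p': "p' < p" "p' < 1" unfolding p'_def p_def using \<tau>\<alpha> kpos by linarith+
    have e1: "\<forall>\<^sub>F n in sequentially. A * 4 powr c * real n powr (- p) + 1 / real n \<le> real n powr (- p')"
    proof -
      define A4 where "A4 = A * 4 powr c"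
      have "A4 > 0" unfolding A4_def using A by simp
      then have "\<forall>\<^sub>F n in sequentially. A4 * real n powr (- p) \<le> 1 / 2 * real n powr (- p')"
        using p'(1) by real_asymp
      moreover have "\<forall>\<^sub>F n in sequentially. 1 / real n \<le> 1 / 2 * real n powr (- p')"
        using p'(2) by real_asymp
      ultimately show ?thesis unfolding A4_def[symmetric] by eventually_elim simp
    qed
    have e2: "\<forall>\<^sub>F n in sequentially. 2 / z \<le> 4 * \<tau> * ln (real n)" using \<tau> by real_asymp
    have e3: "\<forall>\<^sub>F n in sequentially. (\<zeta> + \<tau> * z) * ln (real n) + 2 \<le> real n" by real_asymp
    have e4: "\<forall>\<^sub>F n in sequentially. K * ln (real n) \<le> real n powr g" using g0 by real_asymp
    have e8: "\<forall>\<^sub>F n in sequentially. 2 * real n powr g \<le> real n / 2" using g1 by real_asymp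
    \<comment> \<open>Equivalent to (1 - g) c < 1. For c > 1 the error log n / y decays more slowly
      in y than (m / y)^c, and this is what keeps it smaller for all y up to n.\<close>
    have "c - 1 < g * c" using gcp p by (simp add: algebra_simps)
    then have e5: "\<forall>\<^sub>F n in sequentially. K * ln (real n) * real n powr (c - 1) \<le> real n powr (g * c)"
      by real_asymp
    show "\<forall>\<^sub>F n in sequentially. \<forall>W. depth_recursion k \<mu> n \<eta> (K * ln (real n)) W \<longrightarrow>
         (\<forall>x\<in>{1..n}. real n / 2 \<le> real x \<longrightarrow> W (nat \<lceil>\<zeta> * ln (real n)\<rceil>) x \<le> real n powr (- (1 / real k) - \<tau> * \<alpha> / 2))"
      using e1 e2 e3 e4 e5 small[OF K] eventually_ge_at_top[of 1] e8
    proof eventually_elim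
      case (elim n)
      show ?case
      proof (intro allI impI ballI)
        fix W :: "nat \<Rightarrow> nat \<Rightarrow> real" and x :: nat
        assume rec: "depth_recursion k \<mu> n \<eta> (K * ln (real n)) W"
          and x: "x \<in> {1..n}" "real n / 2 \<le> real x"
        have W01: "0 \<le> W h y" "W h y \<le> 1" for h y using rec unfolding depth_recursion_def by auto
        have n1: "1 \<le> n" using elim(7) .
        have lnn: "0 \<le> ln (real n)" using n1 by simp
        define h where "h = nat \<lceil>\<zeta> * ln (real n)\<rceil>"
        define J where "J = nat \<lceil>\<tau> * z * ln (real n)\<rceil>"
        have "0 \<le> \<zeta> * ln (real n)" "0 \<le> \<tau> * z * ln (real n)" using \<zeta> \<tau> z lnn by auto
        then have hJ: "real h \<le> \<zeta> * ln (real n) + 1" "real J \<le> \<tau> * z * ln (real n) + 1"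
          "0 \<le> \<tau> * z * ln (real n)" unfolding h_def J_def by linarith+
        have ng: "real n powr g \<ge> 1" using n1 g0 by (intro ge_one_powr_ge_zero) auto
        define m where "m = nat \<lceil>real n powr g\<rceil>"
        have m: "real n powr g \<le> real m" "real m \<le> 2 * real n powr g" "1 \<le> m" unfolding m_def using ng by linarith+
        have mx: "m \<le> x" using elim(8) m(2) x(2) by linarith
        have "W (h + J) x \<le> (2 * A0 + 1) / (1 - r') * (real m / real x) powr c + r' ^ J"
        proof (rule depth_recursion_supersolution[OF rec, where r=\<delta>0])
          have "(1 + \<eta>) * (\<delta>0 * 2 powr c * B) \<le> 2 * (\<delta>0 * 2 powr c * B)"
            using \<eta> \<delta>0 B by (intro mult_right_mono) auto
          also have "\<dots> = r'" unfolding \<delta>0_def using B by simp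
          finally show "(1 + \<eta>) * \<delta>0 * 2 powr c * expectation (\<lambda>w. exp (c * Y w)) \<le> r'"
            unfolding B_def[symmetric] by (simp add: mult.assoc)
          show "W h' y' ^ (k - 1) \<le> \<delta>0" if h': "h \<le> h'" "h' < h + J" "y' \<in> {m..n}" for h' y'
          proof -
            have "real h' \<le> (\<zeta> * ln (real n) + 1) + (\<tau> * z * ln (real n) + 1)" using h' hJ by simp
            then have "real h' / z \<le> ((\<zeta> * ln (real n) + 1) + (\<tau> * z * ln (real n) + 1)) / z"
              using z by (intro divide_right_mono) auto
            also have "\<dots> = (\<zeta> / z) * ln (real n) + \<tau> * ln (real n) + 2 / z" using z by (simp add: field_simps)
            also have "(\<zeta> / z) * ln (real n) \<le> (\<beta> - 8 * \<tau>) * ln (real n)" using \<tau>(2) lnn by (intro mult_right_mono) auto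
            finally have "real h' / z + \<tau> * ln (real n) \<le> g * ln (real n)"
              using elim(2) unfolding g_def by (simp add: algebra_simps)
            also have "\<dots> \<le> ln (real m)" using m n1 by (subst ln_ge_iff) (auto simp: powr_def)
            also have "\<dots> \<le> ln (real y')" using m h' by simp
            finally have "W h' y' \<le> \<delta>0" using elim(6) rec h' m by auto
            moreover have "W h' y' ^ (k - 1) \<le> W h' y' ^ 1" using W01 k by (intro power_decreasing) auto
            ultimately show ?thesis by simp
          qed
          show "K * ln (real n) / real y \<le> (real m / real y) powr c" if y: "y \<in> {m..n}" for y
          proof (cases "c \<le> 1")
            case True
            have "K * ln (real n) / real y \<le> (real m / real y) powr 1"
              using elim(4) m y by (simp add: divide_right_mono)
            also have "\<dots> \<le> (real m / real y) powr c" using y m c True by (intro powr_mono') auto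
            finally show ?thesis .
          next
            case False
            have y1: "1 \<le> y" using y m by simp
            have "K * ln (real n) / real y = K * ln (real n) * real y powr (c - 1) / real y powr c"
              using y1 by (simp add: powr_diff)
            also have "\<dots> \<le> K * ln (real n) * real n powr (c - 1) / real y powr c"
              using K lnn y False by (intro divide_right_mono mult_left_mono powr_mono2) auto
            also have "\<dots> \<le> real n powr (g * c) / real y powr c" using elim(5) by (intro divide_right_mono) auto
            also have "real n powr (g * c) = (real n powr g) powr c" by (simp add: powr_powr)
            also have "(real n powr g) powr c / real y powr c \<le> real m powr c / real y powr c"
              using m c by (intro divide_right_mono powr_mono2) auto
            also have "\<dots> = (real m / real y) powr c" by (simp add: powr_divide)
            finally show ?thesis .
          qed
          show "h + J \<le> n"
          proof -
            have "real (h + J) \<le> real n" using hJ elim(3) by (simp add: algebra_simps)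
            then show ?thesis by simp
          qed
        qed (use k \<eta> c \<delta>0 r' A0 int m mx x in auto)
        also have "\<dots> \<le> A * 4 powr c * real n powr (- p) + 1 / real n"
        proof (intro add_mono)
          have "real m / real x \<le> (2 * real n powr g) / (real n / 2)" using m x n1 by (intro frac_le) auto
          also have "\<dots> = 4 * real n powr (g - 1)" using n1 by (simp add: powr_diff)
          finally have "(real m / real x) powr c \<le> (4 * real n powr (g - 1)) powr c" using c by (intro powr_mono2) auto
          also have "\<dots> = 4 powr c * real n powr (- p)" using gcp by (simp add: powr_mult powr_powr)
          finally show "(2 * A0 + 1) / (1 - r') * (real m / real x) powr c \<le> A * 4 powr c * real n powr (- p)"
            unfolding A_def[symmetric] mult.assoc using A by (intro mult_left_mono) auto
          have "r' ^ J \<le> r' powr (\<tau> * z * ln (real n))" unfolding J_def by (rule power_nat_ceiling_le[OF r' hJ(3)])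
          also have "\<dots> = exp (- ln (real n))" unfolding r'_def powr_def using \<tau> z by simp
          also have "\<dots> = 1 / real n" using n1 by (simp add: exp_minus inverse_eq_divide)
          finally show "r' ^ J \<le> 1 / real n" .
        qed
        also have "\<dots> \<le> real n powr (- p')" by (rule elim(1))
        finally show "W (nat \<lceil>\<zeta> * ln (real n)\<rceil>) x \<le> real n powr (- (1 / real k) - \<tau> * \<alpha> / 2)"
          using depth_recursion_mono[OF rec, of h "h + J" x] unfolding p'_def h_def by simp
      qed
    qed
  qed
qed

end

section \<open>Both tails of the minimum\<close>

text \<open>Near 0 the exponent \<alpha> + e(t) exceeds c; away from 0 the bound 1 is absorbed into
  the constant.\<close>

lemma tail_upper:
  assumes e: "(e \<longlongrightarrow> 0) (at_right 0)" and p: "\<forall>\<^sub>F t in at_right 0. p t = t powr (\<alpha> + e t)"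
    and p1: "\<And>t. p t \<le> (1::real)" and c: "0 < c" "c < \<alpha>"
  shows "\<exists>A\<ge>0. \<forall>t. 0 < t \<longrightarrow> t \<le> 1 \<longrightarrow> p t \<le> A * t powr c"
proof -
  have "\<forall>\<^sub>F t in at_right 0. e t > c - \<alpha>" using e c by (intro order_tendstoD(1)) auto
  moreover have "\<forall>\<^sub>F t in at_right 0. t \<in> {0<..<1::real}" by (rule eventually_at_right_real) simp
  ultimately have "\<forall>\<^sub>F t in at_right 0. p t \<le> t powr c"
    using p
  proof eventually_elim
    case (elim t)
    then show ?case by (auto intro!: powr_mono')
  qed
  then obtain b where b: "b > 0" "\<And>t. 0 < t \<Longrightarrow> t < b \<Longrightarrow> p t \<le> t powr c"
    unfolding eventually_at_right_field by auto
  show ?thesis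
  proof (intro exI[of _ "max 1 (1 / b powr c)"] conjI allI impI)
    fix t :: real assume t: "0 < t" "t \<le> 1"
    show "p t \<le> max 1 (1 / b powr c) * t powr c"
    proof (cases "t < b")
      case True
      then have "p t \<le> 1 * t powr c" using b(2)[of t] t by simp
      also have "\<dots> \<le> max 1 (1 / b powr c) * t powr c" by (intro mult_right_mono) auto
      finally show ?thesis .
    next
      case False
      have "p t \<le> 1" by (rule p1)
      also have "1 \<le> 1 / b powr c * t powr c" using False b(1) c powr_mono2[of c b t] by (simp add: field_simps)
      also have "\<dots> \<le> max 1 (1 / b powr c) * t powr c" by (intro mult_right_mono) auto
      finally show ?thesis .
    qed
  qed auto
qed

lemma tail_lower:
  assumes e: "(e \<longlongrightarrow> 0) (at_right 0)" and p: "\<forall>\<^sub>F t in at_right 0. p t = t powr (\<alpha> + e t)"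
    and c: "\<alpha> < (c::real)"
  shows "\<forall>\<^sub>F t in at_right 0. t powr c \<le> p t"
proof -
  have "\<forall>\<^sub>F t in at_right 0. e t < c - \<alpha>" using e c by (intro order_tendstoD(2)) auto
  moreover have "\<forall>\<^sub>F t in at_right 0. t \<in> {0<..<1::real}" by (rule eventually_at_right_real) simp
  ultimately show ?thesis
    using p
  proof eventually_elim
    case (elim t)
    then show ?case by (auto intro!: powr_mono')
  qed
qed

context bounded_density_variable
begin

lemma lower_tail:
  assumes k: "k \<ge> 2" and \<alpha>: "\<alpha> > 0"
    and tail: "\<And>c. 0 < c \<Longrightarrow> c < \<alpha> \<Longrightarrow> \<exists>A\<ge>0. \<forall>t. 0 < t \<longrightarrow> t \<le> 1 \<longrightarrow> cdf_X t \<le> A * t powr c"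
    and \<epsilon>: "\<epsilon> > 0"
  shows "(\<lambda>n. measure (dag_pmf k \<mu> n) {d. \<exists>x\<in>{1..n}. real n / 2 \<le> real x \<and>
      real (d x) < (max (1 - 1 / (real k * \<alpha>)) 0 * lambda_const N X k - \<epsilon>) * ln (real n)}) \<longlonglongrightarrow> 0"
proof -
  define \<beta> where "\<beta> = max (1 - 1 / (real k * \<alpha>)) 0"
  define \<zeta> where "\<zeta> = \<beta> * lambda_const N X k - \<epsilon>"
  have "(\<lambda>n. measure (dag_pmf k \<mu> n) {d. \<exists>x\<in>{1..n}. real n / 2 \<le> real x \<and> real (d x) < \<zeta> * ln (real n)}) \<longlonglongrightarrow> 0"
  proof (cases "\<zeta> \<le> 0")
    case True
    have "measure (dag_pmf k \<mu> n) {d. \<exists>x\<in>{1..n}. real n / 2 \<le> real x \<and> real (d x) < \<zeta> * ln (real n)} = 0"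
      if "n \<ge> 1" for n
    proof -
      have "\<zeta> * ln (real n) \<le> 0" using True that by (simp add: mult_nonpos_nonneg)
      then have "{d :: nat \<Rightarrow> nat. \<exists>x\<in>{1..n}. real n / 2 \<le> real x \<and> real (d x) < \<zeta> * ln (real n)} = {}"
        by (auto simp: not_less intro: order_trans)
      then show ?thesis by (simp only: measure_empty)
    qed
    then show ?thesis by (intro tendsto_eventually) (auto simp: eventually_at_top_linorder)
  next
    case False
    then have \<zeta>: "\<zeta> > 0" by simp
    have lpos: "lambda_const N X k > 0" by (rule lambda_const_pos[OF k])
    have "\<beta> * lambda_const N X k > 0" using \<zeta> \<epsilon> unfolding \<zeta>_def by linarith
    then have \<beta>: "\<beta> > 0" using lpos by (simp add: zero_less_mult_iff)
    then have \<beta>': "\<beta> = 1 - 1 / (real k * \<alpha>)" unfolding \<beta>_def by (auto simp: max_def split: if_splits)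
    have "\<zeta> / \<beta> < lambda_const N X k" unfolding \<zeta>_def using \<beta> \<epsilon> by (simp add: field_simps)
    then obtain z \<theta> where "\<zeta> / \<beta> < z" and crit: "critical k z \<theta>"
      by (rule critical_tilt[OF k])
    then have z: "\<zeta> / \<beta> < z" "0 < z" unfolding critical_def[OF k] by auto
    have "\<zeta> / z < 1 - 1 / (real k * \<alpha>)" unfolding \<beta>'[symmetric] using z \<beta> by (simp add: field_simps)
    then obtain \<eta> \<epsilon>1 where \<eta>: "0 < \<eta>" "\<eta> \<le> 1" and \<epsilon>1: "0 < \<epsilon>1" and final:
      "\<And>K. 0 \<le> K \<Longrightarrow> \<forall>\<^sub>F n in sequentially. \<forall>W. depth_recursion k \<mu> n \<eta> (K * ln (real n)) W \<longrightarrow>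
         (\<forall>x\<in>{1..n}. real n / 2 \<le> real x \<longrightarrow> W (nat \<lceil>\<zeta> * ln (real n)\<rceil>) x \<le> real n powr (- (1 / real k) - \<epsilon>1))"
      using final_density[OF crit k \<alpha> tail less_imp_le[OF \<zeta>]] by blast
    \<comment> \<open>From u = 3 log n in the concentration bound: n^2 pairs, each failing with
      probability n^(-3), leave 1 / n.\<close>
    define K where "K = 3 * C / \<eta>"
    have K: "K \<ge> 0" unfolding K_def using C_pos \<eta> by simp
    define b where "b = real k * \<epsilon>1"
    have b: "b > 0" unfolding b_def using k \<epsilon>1 by simp
    have lim: "(\<lambda>n. 1 / real n + real n powr (- b)) \<longlonglongrightarrow> 0"
    proof -
      have "(\<lambda>n. real n powr (- b)) \<longlonglongrightarrow> 0" using b by real_asymp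
      with lim_1_over_n have "(\<lambda>n. 1 / real n + real n powr (- b)) \<longlonglongrightarrow> 0 + 0" by (rule tendsto_add)
      then show ?thesis by simp
    qed
    have "\<forall>\<^sub>F n in sequentially. measure (dag_pmf k \<mu> n) {d. \<exists>x\<in>{1..n}. real n / 2 \<le> real x \<and> real (d x) < \<zeta> * ln (real n)}
        \<le> 1 / real n + real n powr (- b)"
      using final[OF K] eventually_ge_at_top[of 1]
    proof eventually_elim
      case (elim n)
      define S where "S = {x \<in> {1..n}. real n / 2 \<le> real x}"
      define h where "h = nat \<lceil>\<zeta> * ln (real n)\<rceil>"
      define p where "p = real n powr (- (1 / real k) - \<epsilon>1)"
      let ?W = "\<lambda>d h x. measure (\<mu> x) {y. d y < h}"
      let ?B = "{d. \<not> depth_recursion k \<mu> n \<eta> (K * ln (real n)) (?W d)}"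
      let ?D = "{d. (\<forall>x\<in>S. measure (\<mu> x) {z. d z < h} \<le> p) \<and> (\<exists>x\<in>S. d x < Suc h)}"
      have sub: "{d. \<exists>x\<in>{1..n}. real n / 2 \<le> real x \<and> real (d x) < \<zeta> * ln (real n)} \<subseteq> ?B \<union> ?D"
      proof
        fix d :: "nat \<Rightarrow> nat" assume "d \<in> {d. \<exists>x\<in>{1..n}. real n / 2 \<le> real x \<and> real (d x) < \<zeta> * ln (real n)}"
        then obtain x where x: "x \<in> S" "real (d x) < \<zeta> * ln (real n)" unfolding S_def by auto
        have "\<zeta> * ln (real n) \<le> real h" unfolding h_def by (rule real_nat_ceiling_ge)
        then have "d x < Suc h" using x(2) by linarith
        moreover have "\<forall>x\<in>S. measure (\<mu> x) {z. d z < h} \<le> p" if "d \<notin> ?B"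
          using elim(1)[rule_format, of "?W d"] that unfolding S_def h_def p_def by auto
        ultimately show "d \<in> ?B \<union> ?D" using x(1) by blast
      qed
      have B: "measure (dag_pmf k \<mu> n) ?B \<le> 1 / real n"
      proof -
        have "C * (3 * ln (real n)) / \<eta> = K * ln (real n)" unfolding K_def by simp
        then have "measure (dag_pmf k \<mu> n) ?B \<le> (real n)\<^sup>2 * exp (- (3 * ln (real n)))"
          using measure_not_depth_recursion[of k \<eta> n "3 * ln (real n)"] k \<eta> by simp
        also have "exp (- (3 * ln (real n))) = 1 / real n ^ 3"
        proof -
          have "exp (3 * ln (real n)) = exp (ln (real n)) ^ 3" by (simp add: exp_of_nat_mult[symmetric])
          then show ?thesis using elim(2) by (simp add: exp_minus inverse_eq_divide)
        qed
        also have "(real n)\<^sup>2 * (1 / real n ^ 3) = 1 / real n" using elim(2) by (simp add: power2_eq_square power3_eq_cube)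
        finally show ?thesis .
      qed
      have D: "measure (dag_pmf k \<mu> n) ?D \<le> real n powr (- b)"
      proof -
        have "measure (dag_pmf k \<mu> n) ?D \<le> real (card S) * p ^ k"
          by (rule measure_dag_pmf_depth_less[OF _ set_parent_pmf]) (use k in \<open>auto simp: S_def p_def\<close>)
        also have "\<dots> \<le> real n * p ^ k"
        proof -
          have "card S \<le> card {1..n}" unfolding S_def by (intro card_mono) auto
          then show ?thesis by (intro mult_right_mono) (auto simp: p_def)
        qed
        \<comment> \<open>The surplus \<epsilon>1 over 1 / k turns into the exponent b that survives
          the sum over at most n nodes.\<close>
        also have "p ^ k = real n powr (- 1 - b)"
        proof -
          have "p ^ k = real n powr ((- (1 / real k) - \<epsilon>1) * real k)"
            unfolding p_def using elim(2) by (simp add: powr_powr[symmetric] powr_realpow)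
          also have "(- (1 / real k) - \<epsilon>1) * real k = - 1 - b" unfolding b_def using k by (simp add: field_simps)
          finally show ?thesis .
        qed
        also have "real n * real n powr (- 1 - b) = real n powr (- b)"
          using elim(2) by (simp add: powr_diff powr_minus field_simps)
        finally show ?thesis .
      qed
      have "measure (dag_pmf k \<mu> n) {d. \<exists>x\<in>{1..n}. real n / 2 \<le> real x \<and> real (d x) < \<zeta> * ln (real n)}
         \<le> measure (dag_pmf k \<mu> n) (?B \<union> ?D)" using sub by (intro measure_pmf.finite_measure_mono) auto
      also have "\<dots> \<le> measure (dag_pmf k \<mu> n) ?B + measure (dag_pmf k \<mu> n) ?D"
        by (rule measure_Un_le) auto
      finally show ?case using B D by linarith
    qed
    then show ?thesis by (rule tendsto_sandwich[OF always_eventually _ tendsto_const lim, rotated]) auto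
  qed
  then show ?thesis unfolding \<zeta>_def \<beta>_def .
qed

section \<open>The upper tail: weights x^\<theta> for long paths, and nodes with all parents
  small\<close>

lemma sum_pmf_parent_powr:
  assumes "\<theta> \<ge> 0" "y \<ge> 1"
  shows "(\<Sum>z\<in>{1..<y}. pmf (\<mu> y) z * real z powr \<theta>) \<le> mgf \<theta> * real y powr \<theta>"
proof -
  have "(\<Sum>z\<in>{1..<y}. pmf (\<mu> y) z * real z powr \<theta>) =
    expectation (\<lambda>w. of_bool (parent y w \<in> {1..<y}) * real (parent y w) powr \<theta>)"
    by (rule sum_pmf_parent(1)) simp
  also have "\<dots> \<le> expectation (\<lambda>w. real y powr \<theta> * exp (- \<theta> * Y w))"
  proof (rule integral_mono_AE)
    show "AE w in N. of_bool (parent y w \<in> {1..<y}) * real (parent y w) powr \<theta>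
       \<le> real y powr \<theta> * exp (- \<theta> * Y w)"
    using AE_X_pos AE_space
    proof eventually_elim
      case (elim w)
      \<comment> \<open>Rounding down is favourable because \<theta> is nonnegative, so no
        correction factor appears.\<close>
      have "real (parent y w) powr \<theta> \<le> (real y * X w) powr \<theta>"
        using parent_bounds(1)[OF elim(2), of y] assms by (intro powr_mono2) auto
      also have "\<dots> = real y powr \<theta> * exp (- \<theta> * Y w)"
      proof -
        have "X w powr \<theta> = exp (- \<theta> * Y w)" using elim by (simp add: Y_def powr_def)
        then show ?thesis using elim by (simp add: powr_mult)
      qed
      finally show ?case by (auto simp: of_bool_def)
    qed
  qed (use sum_pmf_parent(2)[of "{1..<y}"] integrable_exp_neg[OF assms(1)] in auto)
  also have "\<dots> = mgf \<theta> * real y powr \<theta>" unfolding mgf_def by simp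
  finally show ?thesis .
qed

text \<open>With \<gamma> slightly above \<beta>, the mean number T of nodes above n / 2 whose
  parents are all at most n^\<gamma> grows like a power of n. With z slightly above \<lambda>_k,
  each single node up to about n^\<gamma> has distance beyond \<gamma> z log n only with
  polynomially small probability. \<open>measure_dag_pmf_all_deep\<close> combines the two.\<close>

lemma upper_tail:
  assumes k: "k \<ge> 2" and \<alpha>: "\<alpha> > 0"
    and tail: "\<And>c. \<alpha> < c \<Longrightarrow> \<forall>\<^sub>F t in at_right 0. t powr c \<le> cdf_X t"
    and \<epsilon>: "\<epsilon> > 0"
  shows "(\<lambda>n. measure (dag_pmf k \<mu> n) {d. \<forall>x\<in>{1..n}. real n / 2 \<le> real x \<longrightarrow>
      real (d x) > (max (1 - 1 / (real k * \<alpha>)) 0 * lambda_const N X k + \<epsilon>) * ln (real n)}) \<longlonglongrightarrow> 0"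
proof -
  define \<beta> where "\<beta> = max (1 - 1 / (real k * \<alpha>)) 0"
  define L where "L = lambda_const N X k"
  have L: "L > 0" unfolding L_def by (rule lambda_const_pos[OF k])
  have \<beta>: "0 \<le> \<beta>" "\<beta> < 1" "1 - 1 / (real k * \<alpha>) \<le> \<beta>" unfolding \<beta>_def using k \<alpha> by auto
  \<comment> \<open>One slack for both parameters: (\<beta> + s) (L + s) is at most \<beta> L +
    \<epsilon> / 2, and \<beta> + s stays below 1. The other \<epsilon> / 2 pays for rounding and
    for the extra step to the parent.\<close>
  define s where "s = min ((1 - \<beta>) / 2) (min 1 (\<epsilon> / (2 * (\<beta> + L + 1))))"
  have den: "2 * (\<beta> + L + 1) > 0" using \<beta> L by simp
  have "s \<le> (1 - \<beta>) / 2" "s \<le> 1" "s \<le> \<epsilon> / (2 * (\<beta> + L + 1))" unfolding s_def by linarith+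
  moreover have "0 < s" unfolding s_def using \<beta> den \<epsilon> by auto
  ultimately have s: "0 < s" "s < 1 - \<beta>" "s \<le> 1" "s * (2 * (\<beta> + L + 1)) \<le> \<epsilon>"
    using \<beta> den by (simp_all only: pos_le_divide_eq)
  define \<gamma> where "\<gamma> = \<beta> + s"
  define z where "z = L + s"
  have \<gamma>: "0 < \<gamma>" "\<gamma> < 1" "1 - 1 / (real k * \<alpha>) < \<gamma>" unfolding \<gamma>_def using s \<beta> by auto
  have z: "z > lambda_const N X k" "z > 0" unfolding z_def L_def[symmetric] using s L by auto
  have \<gamma>z: "\<gamma> * z \<le> \<beta> * L + \<epsilon> / 2"
  proof -
    have "s * s \<le> s * 1" using s by (intro mult_left_mono) auto
    then show ?thesis unfolding \<gamma>_def z_def using s(4) by (simp add: algebra_simps)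
  qed
  obtain \<theta> where \<theta>: "\<theta> > 0" "real k * mgf \<theta> * exp (\<theta> / z) < 1"
    by (rule mgf_above_lambda_const[OF k z(1)])
  define r where "r = real k * mgf \<theta>"
  have r0: "r > 0" unfolding r_def using mgf_pos[of \<theta>] \<theta> k by simp
  have "r * 1 < r * exp (\<theta> / z)" using r0 \<theta> z by (intro mult_strict_left_mono) auto
  then have r: "0 < r" "r < 1" using r0 \<theta>(2) unfolding r_def by auto
  \<comment> \<open>The first moment bound r^t y^\<theta>, at t = \<gamma> z log n and y =
    n^\<gamma>, is n^(-b).\<close>
  define b where "b = - (\<gamma> * z * (ln r + \<theta> / z))"
  have b: "b > 0"
  proof -
    have "ln (r * exp (\<theta> / z)) < 0" using \<theta>(2) r0 unfolding r_def by (subst ln_less_zero_iff) auto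
    then have "ln r + \<theta> / z < 0" using r0 by (simp add: ln_mult)
    then show ?thesis unfolding b_def using \<gamma> z by (simp add: mult_pos_neg)
  qed
  have "(1 - \<gamma>) * (real k * \<alpha>) < 1"
  proof -
    have "1 - \<gamma> < 1 / (real k * \<alpha>)" using \<gamma>(3) by linarith
    then show ?thesis using k \<alpha> by (simp add: field_simps)
  qed
  then have "\<alpha> < 1 / ((1 - \<gamma>) * real k)" using \<gamma>(2) k by (simp add: field_simps)
  \<comment> \<open>An exponent above \<alpha>, for which the lower bound on the tail is available,
    yet with (1 - \<gamma>) c k < 1, so that T is at least of order n^p with p > 0.\<close>
  then obtain c where c: "\<alpha> < c" "c < 1 / ((1 - \<gamma>) * real k)" using dense by blast
  define p where "p = 1 - (1 - \<gamma>) * c * real k"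
  have p: "p > 0" unfolding p_def using c(2) \<gamma>(2) k by (simp add: field_simps)
  define m where "m n = nat \<lceil>real n powr \<gamma>\<rceil>" for n
  define a where "a n = nat \<lceil>real n / 2\<rceil>" for n
  define t where "t n = nat \<lceil>\<gamma> * z * ln (real n)\<rceil>" for n
  define bound where "bound n = exp (- (real n powr p / 4) / 2) + 2 * real k * (2 powr \<theta> * real n powr (- b))" for n
  have lim: "bound \<longlonglongrightarrow> 0"
  proof -
    have "(\<lambda>n. exp (- (real n powr p / 4) / 2)) \<longlonglongrightarrow> 0" using p by real_asymp
    moreover have "(\<lambda>n. real n powr (- b)) \<longlonglongrightarrow> 0" using b by real_asymp
    then have "(\<lambda>n. 2 * real k * (2 powr \<theta> * real n powr (- b))) \<longlonglongrightarrow> 2 * real k * (2 powr \<theta> * 0)"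
      by (intro tendsto_mult tendsto_const)
    ultimately have "bound \<longlonglongrightarrow> 0 + 2 * real k * (2 powr \<theta> * 0)" unfolding bound_def by (rule tendsto_add)
    then show ?thesis by simp
  qed
  have e1: "\<forall>\<^sub>F n in sequentially. (real n powr (\<gamma> - 1)) powr c \<le> cdf_X (real n powr (\<gamma> - 1))"
  proof -
    have "filterlim (\<lambda>n. real n powr (\<gamma> - 1)) (at_right 0) sequentially" using \<gamma>(2) by real_asymp
    then show ?thesis using tail[OF c(1)] by (rule eventually_compose_filterlim[rotated])
  qed
  have e2: "\<forall>\<^sub>F n in sequentially. 2 * real n powr \<gamma> \<le> real n / 2" using \<gamma>(2) by real_asymp
  have e3: "\<forall>\<^sub>F n in sequentially. 2 \<le> \<epsilon> / 2 * ln (real n)" using \<epsilon> by real_asymp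
  have "\<forall>\<^sub>F n in sequentially. measure (dag_pmf k \<mu> n) {d. \<forall>x\<in>{1..n}. real n / 2 \<le> real x \<longrightarrow>
      real (d x) > (\<beta> * L + \<epsilon>) * ln (real n)} \<le> bound n"
    using e1 e2 e3 eventually_ge_at_top[of 4]
  proof eventually_elim
    case (elim n)
    have n: "n \<ge> 4" by (rule elim)
    have lnn: "ln (real n) \<ge> 0" using n by simp
    have n\<gamma>: "real n powr \<gamma> \<ge> 1" using n \<gamma> by (intro ge_one_powr_ge_zero) auto
    have m: "real n powr \<gamma> \<le> real (m n)" "real (m n) \<le> 2 * real n powr \<gamma>" "m n \<ge> 1"
      unfolding m_def using n\<gamma> by linarith+
    have a: "real n / 2 \<le> real (a n)" "real (a n) \<le> real n / 2 + 1" unfolding a_def by linarith+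
    have ma: "m n \<le> a n" using m(2) elim(2) a(1) by linarith
    have an: "a n \<le> n" using a(2) n by linarith
    have "0 \<le> \<gamma> * z * ln (real n)" using \<gamma> z lnn by simp
    then have t: "\<gamma> * z * ln (real n) \<le> real (t n)" "real (t n) \<le> \<gamma> * z * ln (real n) + 1"
      unfolding t_def by linarith+
    define s' where "s' = 2 powr \<theta> * real n powr (- b)"
    have s': "measure (dag_pmf k \<mu> (m n)) {d. d y > t n} \<le> s'" if y: "y \<le> m n" for y
    proof (cases "y = 0")
      case True
      then show ?thesis unfolding s'_def by (simp add: measure_dag_pmf_root[simplified])
    next
      case False
      have "measure (dag_pmf k \<mu> (m n)) {d. d y > t n} \<le> (real k * mgf \<theta>) ^ t n * real y powr \<theta>"
        by (rule measure_dag_pmf_depth_greater[OF _ set_parent_pmf])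
          (use k False y \<theta> mgf_pos[of \<theta>] in \<open>auto intro!: ge_one_powr_ge_zero sum_pmf_parent_powr[simplified]\<close>)
      also have "\<dots> \<le> r powr (\<gamma> * z * ln (real n)) * (2 * real n powr \<gamma>) powr \<theta>"
      proof (intro mult_mono)
        have "r ^ t n \<le> r powr (\<gamma> * z * ln (real n))"
          unfolding t_def using r \<open>0 \<le> \<gamma> * z * ln (real n)\<close> by (rule power_nat_ceiling_le)
        then show "(real k * mgf \<theta>) ^ t n \<le> r powr (\<gamma> * z * ln (real n))" unfolding r_def .
        show "real y powr \<theta> \<le> (2 * real n powr \<gamma>) powr \<theta>" using y m \<theta> by (intro powr_mono2) auto
      qed auto
      also have "\<dots> = s'"
      proof -
        have "r powr (\<gamma> * z * ln (real n)) * real n powr (\<gamma> * \<theta>) = real n powr (- b)"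
          unfolding b_def using r z n by (simp add: powr_def exp_add[symmetric] field_simps)
        then show ?thesis unfolding s'_def by (simp add: powr_mult powr_powr)
      qed
      finally show ?thesis .
    qed
    define T where "T = (\<Sum>x\<in>{a n<..n}. measure (\<mu> x) {y. y \<le> m n} ^ k)"
    have T: "T \<ge> real n powr p / 4"
    proof -
      have "real n / 4 * real n powr (p - 1) \<le> real (card {a n<..n}) * real n powr (p - 1)"
        using a an n by (intro mult_right_mono) (auto simp: of_nat_diff)
      also have "\<dots> = (\<Sum>x\<in>{a n<..n}. real n powr (p - 1))" by simp
      also have "\<dots> \<le> T"
        unfolding T_def
      proof (intro sum_mono)
        fix x assume x: "x \<in> {a n<..n}"
        have "real n powr (p - 1) = ((real n powr (\<gamma> - 1)) powr c) ^ k"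
          unfolding p_def using n by (simp add: powr_powr powr_realpow[symmetric] algebra_simps)
        also have "\<dots> \<le> (cdf_X (real n powr (\<gamma> - 1))) ^ k"
          using elim(1) by (intro power_mono) auto
        also have "\<dots> \<le> measure (\<mu> x) {y. y \<le> m n} ^ k"
        proof (intro power_mono)
          show "cdf_X (real n powr (\<gamma> - 1)) \<le> measure (\<mu> x) {y. y \<le> m n}"
            unfolding measure_parent
          proof (rule finite_measure_mono)
            show "{w \<in> space N. X w \<le> real n powr (\<gamma> - 1)} \<subseteq> {w \<in> space N. parent x w \<in> {y. y \<le> m n}}"
            proof safe
              fix w assume w: "w \<in> space N" "X w \<le> real n powr (\<gamma> - 1)"
              have "real x * X w \<le> real n * real n powr (\<gamma> - 1)"
                using w X_range[OF w(1)] x by (intro mult_mono) auto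
              also have "\<dots> = real n powr \<gamma>" using n by (simp add: powr_diff)
              finally show "parent x w \<le> m n" using parent_bounds(1)[OF w(1), of x] m(1) by linarith
            qed
          qed simp
        qed auto
        finally show "real n powr (p - 1) \<le> measure (\<mu> x) {y. y \<le> m n} ^ k" .
      qed
      finally show ?thesis using n by (simp add: powr_diff)
    qed
    have "0 < real n powr p / 4" using n by simp
    then have Tpos: "T > 0" using T by (rule less_le_trans)
    have "measure (dag_pmf k \<mu> n) {d. \<forall>x\<in>{1..n}. real n / 2 \<le> real x \<longrightarrow> real (d x) > (\<beta> * L + \<epsilon>) * ln (real n)}
      \<le> measure (dag_pmf k \<mu> n) {d. \<forall>x\<in>{a n<..n}. d x > Suc (t n)}"
    proof (intro measure_pmf.finite_measure_mono subsetI)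
      fix d :: "nat \<Rightarrow> nat"
      assume d: "d \<in> {d. \<forall>x\<in>{1..n}. real n / 2 \<le> real x \<longrightarrow> real (d x) > (\<beta> * L + \<epsilon>) * ln (real n)}"
      have "\<gamma> * z * ln (real n) \<le> (\<beta> * L + \<epsilon> / 2) * ln (real n)" using \<gamma>z lnn by (intro mult_right_mono)
      then have le: "real (Suc (t n)) \<le> (\<beta> * L + \<epsilon>) * ln (real n)" using t(2) elim(3) by (simp add: algebra_simps)
      have "d x > Suc (t n)" if x: "x \<in> {a n<..n}" for x
      proof -
        have "real (d x) > (\<beta> * L + \<epsilon>) * ln (real n)" using d x a(1) by auto
        then show ?thesis using le by linarith
      qed
      then show "d \<in> {d. \<forall>x\<in>{a n<..n}. d x > Suc (t n)}" by simp
    qed auto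
    also have "\<dots> \<le> exp (- T / 2) + 2 * real k * s'"
      by (rule measure_dag_pmf_all_deep[OF _ set_parent_pmf ma an s' T_def Tpos]) (use k in auto)
    also have "\<dots> \<le> bound n" unfolding bound_def s'_def using T by simp
    finally show ?case .
  qed
  then have "(\<lambda>n. measure (dag_pmf k \<mu> n) {d. \<forall>x\<in>{1..n}. real n / 2 \<le> real x \<longrightarrow>
      real (d x) > (\<beta> * L + \<epsilon>) * ln (real n)}) \<longlonglongrightarrow> 0"
    by (rule tendsto_sandwich[OF always_eventually _ tendsto_const lim, rotated]) auto
  then show ?thesis unfolding \<beta>_def L_def .
qed

end

text \<open>The maximum with 1 makes the constant positive.\<close>

lemma bounded_density_variableI:
  assumes "prob_space N" and X: "X \<in> borel_measurable N"
    and range: "\<And>\<omega>. \<omega> \<in> space N \<Longrightarrow> X \<omega> \<in> {0..<1}"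
    and f: "\<And>t. 0 \<le> f t \<and> f t \<le> C" and density: "distributed N lborel X (\<lambda>t. ennreal (f t))"
  shows "bounded_density_variable N X (max C 1)"
proof -
  interpret prob_space N by fact
  show ?thesis
  proof
    fix a b :: real assume ab: "a \<le> b"
    have "emeasure N (X -` {a..b} \<inter> space N) = (\<integral>\<^sup>+ t. ennreal (f t) * indicator {a..b} t \<partial>lborel)"
      by (rule distributed_emeasure[OF density]) simp
    also have "\<dots> \<le> (\<integral>\<^sup>+ t. ennreal (max C 1) * indicator {a..b} t \<partial>lborel)"
      using f by (intro nn_integral_mono mult_right_mono ennreal_leI) (auto simp: le_max_iff_disj)
    also have "\<dots> = ennreal (max C 1 * (b - a))"
      using ab by (subst nn_integral_cmult) (auto simp: ennreal_mult'[symmetric])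
    also have "X -` {a..b} \<inter> space N = {\<omega> \<in> space N. a \<le> X \<omega> \<and> X \<omega> \<le> b}" by auto
    finally show "prob {\<omega> \<in> space N. a \<le> X \<omega> \<and> X \<omega> \<le> b} \<le> max C 1 * (b - a)"
      using ab by (simp add: emeasure_eq_measure)
  qed (use X range in auto)
qed

theorem theorem5p1:
  fixes k :: nat and \<alpha> :: real
    and N :: "'b measure" and X :: "'b \<Rightarrow> real"
    and M :: "'a measure" and U :: "nat \<Rightarrow> nat \<Rightarrow> 'a \<Rightarrow> real"
  assumes k: "k \<ge> 2"
    and N: "prob_space N"
    and X: "X \<in> borel_measurable N"
    and X_range: "\<And>\<omega>. \<omega> \<in> space N \<Longrightarrow> X \<omega> \<in> {0..<1}"
    and bounded_density:
      "\<exists>(f :: real \<Rightarrow> real) C. (\<forall>t. 0 \<le> f t \<and> f t \<le> C) \<and> distributed N lborel X (\<lambda>t. ennreal (f t))"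
    and \<alpha>: "\<alpha> > 0"
    and tail:
      "\<exists>e :: real \<Rightarrow> real. (e \<longlongrightarrow> 0) (at_right 0) \<and>
         (\<forall>\<^sub>F t in at_right 0. measure N {\<omega> \<in> space N. X \<omega> \<le> t} = t powr (\<alpha> + e t))"
    and M: "prob_space M"
    and indep: "prob_space.indep_vars M (\<lambda>_. borel) (\<lambda>(x, p). U x p) (UNIV \<times> {1..k})"
    and copies: "\<And>x p. p \<in> {1..k} \<Longrightarrow> distr M borel (U x p) = distr N borel X"
    and U_range: "\<And>x p \<omega>. p \<in> {1..k} \<Longrightarrow> \<omega> \<in> space M \<Longrightarrow> U x p \<omega> \<in> {0..<1}"
  shows "tendsto_in_probability M
           (\<lambda>n \<omega>. real (Min (longest_path_dist k (\<lambda>x p. U x p \<omega>) `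
                               {x. real n / 2 \<le> real x \<and> x \<le> n})) / ln (real n))
           (max (1 - 1 / (real k * \<alpha>)) 0 * lambda_const N X k)"
  unfolding tendsto_in_probability_def
proof (intro allI impI)
  fix \<epsilon> :: real assume \<epsilon>: "\<epsilon> > 0"
  obtain f C where f: "\<And>t. 0 \<le> f t \<and> f t \<le> C" "distributed N lborel X (\<lambda>t. ennreal (f t))"
    using bounded_density by blast
  interpret bounded_density_variable N X "max C 1"
    by (rule bounded_density_variableI[OF N X X_range f])
  obtain e where e: "(e \<longlongrightarrow> 0) (at_right 0)"
    "\<forall>\<^sub>F t in at_right 0. cdf_X t = t powr (\<alpha> + e t)" using tail by blast
  define c where "c = max (1 - 1 / (real k * \<alpha>)) 0 * lambda_const N X k"
  let ?D = "\<lambda>\<omega>. longest_path_dist k (\<lambda>x p. U x p \<omega>)"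
  let ?S = "\<lambda>n. {x. real n / 2 \<le> real x \<and> x \<le> n}"
  let ?R = "\<lambda>n d. \<epsilon> < \<bar>real (Min (d ` ?S n)) / ln (real n) - c\<bar>"
  let ?low = "\<lambda>n. {d. \<exists>x\<in>{1..n}. real n / 2 \<le> real x \<and> real (d x) < (c - \<epsilon>) * ln (real n)}"
  let ?high = "\<lambda>n. {d. \<forall>x\<in>{1..n}. real n / 2 \<le> real x \<longrightarrow> real (d x) > (c + \<epsilon>) * ln (real n)}"
  let ?b = "\<lambda>n. measure (dag_pmf k (parent_pmf N X) n) (?low n) + measure (dag_pmf k (parent_pmf N X) n) (?high n)"
  \<comment> \<open>The event involves only nodes up to \<open>n\<close>, so it can be evaluated in
    the Markov chain. There a deviation of the minimum means that some node is too shallow or that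
    all nodes are too deep; n is at least 2 so that the logarithm is positive.\<close>
  have "measure M {\<omega> \<in> space M. ?R n (?D \<omega>)} \<le> ?b n" if n: "n \<ge> 2" for n
  proof -
    have lnn: "ln (real n) > 0" using n by simp
    have S: "finite (?S n)" "n \<in> ?S n" using finite_subset[of "?S n" "{..n}"] by auto
    have "measure M {\<omega> \<in> space M. ?R n (?D \<omega>)} = measure (dag_pmf k (parent_pmf N X) n) {d. ?R n d}"
    proof (rule measure_longest_path_dist[OF _ N X M indep copies U_range])
      fix d d' :: "nat \<Rightarrow> nat" assume "\<And>y. y \<le> n \<Longrightarrow> d y = d' y"
      then have "d ` ?S n = d' ` ?S n" by (intro image_cong) auto
      then show "?R n d \<longleftrightarrow> ?R n d'" by simp
    qed (use k n in auto)
    also have "\<dots> \<le> measure (dag_pmf k (parent_pmf N X) n) (?low n \<union> ?high n)"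
    proof (intro measure_pmf.finite_measure_mono subsetI)
      fix d assume "d \<in> {d. ?R n d}"
      then consider "real (Min (d ` ?S n)) / ln (real n) < c - \<epsilon>" | "real (Min (d ` ?S n)) / ln (real n) > c + \<epsilon>"
        by (auto simp: abs_if split: if_splits)
      then show "d \<in> ?low n \<union> ?high n"
      proof cases
        case 1
        have "Min (d ` ?S n) \<in> d ` ?S n" using S by (intro Min_in finite_imageI) blast+
        then obtain x where x: "x \<in> ?S n" "Min (d ` ?S n) = d x" by auto
        have "x \<in> {1..n}" using x(1) n by auto
        moreover have "real (d x) < (c - \<epsilon>) * ln (real n)" using 1 lnn unfolding x(2) by (simp add: field_simps)
        ultimately show ?thesis using x(1) by auto
      next
        case 2
        have "real (d x) > (c + \<epsilon>) * ln (real n)" if "x \<in> {1..n}" "real n / 2 \<le> real x" for x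
        proof -
          have "Min (d ` ?S n) \<le> d x" using S that by (intro Min_le) auto
          moreover have "(c + \<epsilon>) * ln (real n) < real (Min (d ` ?S n))" using 2 lnn by (simp add: field_simps)
          ultimately show ?thesis by linarith
        qed
        then show ?thesis by auto
      qed
    qed auto
    also have "\<dots> \<le> ?b n" by (rule measure_Un_le) auto
    finally show ?thesis .
  qed
  then have le: "\<forall>\<^sub>F n in sequentially. measure M {\<omega> \<in> space M. ?R n (?D \<omega>)} \<le> ?b n"
    by (auto simp: eventually_at_top_linorder)
  have "(\<lambda>n. measure (dag_pmf k (parent_pmf N X) n) (?low n)) \<longlonglongrightarrow> 0"
    unfolding c_def by (intro lower_tail k \<alpha> \<epsilon> tail_upper[OF e]) auto
  moreover have "(\<lambda>n. measure (dag_pmf k (parent_pmf N X) n) (?high n)) \<longlonglongrightarrow> 0"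
    unfolding c_def by (intro upper_tail k \<alpha> \<epsilon> tail_lower[OF e])
  ultimately have "?b \<longlonglongrightarrow> 0 + 0" by (rule tendsto_add)
  then have "?b \<longlonglongrightarrow> 0" by simp
  then show "(\<lambda>n. measure M {\<omega> \<in> space M. \<epsilon> < \<bar>real (Min (?D \<omega> ` ?S n)) / ln (real n) -
      max (1 - 1 / (real k * \<alpha>)) 0 * lambda_const N X k\<bar>}) \<longlonglongrightarrow> 0"
    unfolding c_def[symmetric]
    by (rule tendsto_sandwich[OF always_eventually le tendsto_const, rotated]) auto
qed

end
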